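(* Let $\mathbf x,\mathbf y\in W^+$ with $\mathbf x$ spherical, and let $\mathcal C^\infty_{\mathbf x}(\mathbf y)$ be the set of $C_\infty$-Hecke open paths of type $\mathbf x$ with end alcove $C_{\mathbf y}$. Then $\mathcal C^\infty_{\mathbf x}(\mathbf y)$ is finite, and it is empty if $\mathbf y\not\le\mathbf x$ for the affine Bruhat order on $W^+$.
   Context: Root data. $\mathcal D=(A,X,Y,(\alpha_i)_{i\in I},(\alpha_i^\vee)_{i\in I})$ is a Kac-Moody root datum: $I$ finite, $A=(a_{ij})$ a generalized Cartan matrix, $X,Y$ dual free $\mathbb Z$-modules of finite rank with pairing $\langle\cdot,\cdot\rangle:Y\times X\to\mathbb Z$, linearly independent simple roots $\alpha_i\in X$ and simple coroots $\alpha_i^\vee\in Y$, $\langle\alpha_i^\vee,\alpha_j\rangle=a_{ij}$. $W^v$ is the group generated by $s_i:y\mapsto y-\langle y,\alpha_i\rangle\alpha_i^\vee$ on $Y$ (acting dually on $X$), a Coxeter group with length $\ell$ and Bruhat order; $\Phi=W^v\{\alpha_i\}=\Phi_+\sqcup\Phi_-$ (real roots), $\beta^\vee=w\alpha_i^\vee$ and $s_\beta=ws_iw^{-1}$ if $\beta=w\alpha_i$. $\mathbb A=Y\otimes\mathbb R$, $C^v_f=\{x\in\mathbb A:\langle x,\alpha_i\rangle>0\ \forall i\}$, $C^v_w=wC^v_f$; Tits cone $\mathscr T=\bigcup_w\overline{C^v_w}$, with interior $\mathring{\mathscr T}$ (the elements of $\mathscr T$ with finite stabilizer in $W^v$, called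 spherical); $Y^+=Y\cap\mathscr T$. Affine Weyl semi-group and affine Bruhat order. $W^+=Y^+\rtimes W^v\subset Y\rtimes W^v$, elements written $\varpi^\lambda w$; $\varpi^\lambda w$ is spherical if $\lambda$ is. $Y\rtimes W^v$ acts on $\mathbb A$ by $\varpi^\lambda w(x)=-\lambda+w(x)$. For $\beta\in\Phi$, $n\in\mathbb Z$: affine wall $M_{\beta[n]}=\{x:\langle x,\beta\rangle+n=0\}$ and reflection $s_{\beta[n]}=\varpi^{n\beta^\vee}s_\beta$ (so $\beta[n]$ and $(-\beta)[-n]$ are identified). The affine Bruhat order on $W^+$ is the transitive closure of the relations $s_{\beta[n]}\mathbf x<\mathbf x$ for $\mathbf x=\varpi^\lambda w\in W^+$, $\beta\in\Phi_+$, $n\in\mathbb Z$ such that, with $\sigma=\operatorname{sgn}(n)$ ($\operatorname{sgn}(0)=+1$), either $|n|<\sigma\langle\lambda,\beta\rangle$, or $|n|=\sigma\langle\lambda,\beta\rangle$ and $\sigma w^{-1}\beta\in\Phi_-$. Alcoves. For $x\in\mathbb A$, $\varepsilon\in\{+,-\}$, $w\in W^v$, the alcove $a(x,\varepsilon w)$ is the filter generated by the sets $(x+\varepsilon\overline{C^v_w})\cap B(x,r)$, $r>0$; it is based at $x$, has sign $\varepsilon$, direction $\varepsilon C^v_w$ and sector $x+\varepsilon\overline{C^v_w}$. $Y\rtimes W^v$ acts by $\varpi^\lambda w.a(x,\varepsilon v)=a(wx-\lambda,\varepsilon wv)$. $C_0=a(0,+1)$, $C_{\varpi^\lambda w}=\varpi^\lambda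 w.C_0=a(-\lambda,+w)$. The positive side of a wall is the side containing $C_0$. For alcoves at the same point, $d^\varepsilon(a(x,\varepsilon w_1),a(x,\varepsilon w_2))=w_1^{-1}w_2$ and $d^*(a(x,\varepsilon w_1),a(x,-\varepsilon w_2))=w_1^{-1}w_2$. Germs and projections. For a piecewise affine path $\mathfrak c:[0,1]\to\mathbb A$, $\mathfrak c_+(t)$ and $\mathfrak c_-(t)$ are the germs at $t$ of $\mathfrak c|_{[t,1]}$ and $\mathfrak c|_{[0,t]}$; an alcove dominates such a germ if it is based at $\mathfrak c(t)$ and its closed direction contains $\mathfrak c'_+(t)$, resp. $-\mathfrak c'_-(t)$. If $y-x\in\pm\mathscr T$ and $a$ is an alcove based at $y$, $\mathrm{proj}_x(a)$ is the unique alcove based at $x$ whose sector contains $a$ ($\mathrm{proj}_x(a)=a$ if $x=y$). For a germ based at $x$ with direction in $\pm\mathring{\mathscr T}$, the projection of $a$ on the germ is the unique alcove (of the corresponding sign) containing the germ and closest to $\mathrm{proj}_x(a)$: minimizing the length of the distance if the signs agree, maximizing the length of the codistance $d^*$ if they are opposite (equivalently, no hyperplane of root direction containing the germ separates it from $a$). Open paths. $[t,t']^{\pm}=([t,t')\times\{+\})\sqcup((t,t']\times\{-\})$. An open path is $\underline{\mathfrak c}=(\mathfrak c,D,\underline{\mathfrak c}(1))$ where $\mathfrak c:[0,1]\to\mathbb A$ is a $(-\lambda)$-path for some spherical $\lambda$ (piecewise affine with left/right derivatives in $-W^v\lambda$), $D$ assigns to each $(t,\varepsilon)\in[0,1]^\pm$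 an alcove $D^\varepsilon_t$ dominating $\mathfrak c_\varepsilon(t)$ ($D_t^+$ negative, $D_t^-$ positive), and $\underline{\mathfrak c}(1)$ is an alcove based at $\mathfrak c(1)$ (the end alcove). It is admissible if whenever $\mathfrak c$ is affine on $[t_0,t_1]$, $D^\varepsilon_t=\mathrm{proj}_{\mathfrak c_\varepsilon(t)}(D^{\varepsilon'}_{t'})$ for all $(t,\varepsilon),(t',\varepsilon')\in[t_0,t_1]^\pm$. For spherical $\mathbf x=\varpi^\lambda w$, $\underline{\mathfrak s}_{\mathbf x}$ is the admissible open path with path $\mathfrak s_\lambda:t\mapsto-t\lambda$, decoration $D^\varepsilon_{\mathbf x,t}=\mathrm{proj}_{\mathfrak s_{\lambda,\varepsilon}(t)}(C_{\mathbf x})$, end alcove $C_{\mathbf x}$. Foldings and Hecke open paths. If $\mathfrak c(t_0)\in M_{\beta[n]}$, the folding $\varphi_{t_0,\beta[n]}(\underline{\mathfrak c})$ is obtained by applying $s_{\beta[n]}$ to $\mathfrak c(t)$ for $t\ge t_0$, to $D^\varepsilon_t$ for $t>t_0$ or $(t,\varepsilon)=(t_0,+)$, and to the end alcove, leaving the rest unchanged. It is positive if $D^+_{t_0}$ (if $t_0<1$), resp. $\underline{\mathfrak c}(1)$ (if $t_0=1$), is on the side of $M_{\beta[n]}$ not containing $C_0$. A $C_\infty$-Hecke open path of type $\mathbf x=\varpi^\lambda w$ ($\mathbf x$ spherical) is an admissible open path of the form $\varphi_{t_r,\beta_r[n_r]}\circ\dots\circ\varphi_{t_0,\beta_0[n_0]}(\underline{\mathfrak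 s}_{\mathbf x})$ with all successive foldings positive, $(t_i)$ non-decreasing in $[0,1]$ and $s_{\beta_{i-1}[n_{i-1}]}\cdots s_{\beta_0[n_0]}(-t_i\lambda)\in M_{\beta_i[n_i]}$ for all $i$ (the empty sequence being allowed). *)

theory Defs
  imports "HOL-Analysis.Analysis"
begin

datatype sign = Pos | Neg

primrec sval :: "sign \<Rightarrow> real" where
  "sval Pos = 1"
| "sval Neg = -1"

primrec opp :: "sign \<Rightarrow> sign" where
  "opp Pos = Neg"
| "opp Neg = Pos"

definition generalized_cartan_matrix :: "'i set \<Rightarrow> ('i \<Rightarrow> 'i \<Rightarrow> int) \<Rightarrow> bool" where
  "generalized_cartan_matrix I A \<longleftrightarrow>
     (\<forall>i\<in>I. A i i = 2) \<and>
     (\<forall>i\<in>I. \<forall>j\<in>I. i \<noteq> j \<longrightarrow> A i j \<le> 0) \<and>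
     (\<forall>i\<in>I. \<forall>j\<in>I. A i j = 0 \<longleftrightarrow> A j i = 0)"

definition full_lattice :: "'a::real_vector set \<Rightarrow> bool" where
  "full_lattice Y \<longleftrightarrow>
     (\<exists>B. finite B \<and> independent B \<and> span B = UNIV \<and>
          Y = range (\<lambda>c::'a \<Rightarrow> int. \<Sum>b\<in>B. of_int (c b) *\<^sub>R b))"

text \<open>The \<open>\<int>\<close>-linear maps from \<open>Y\<close> to \<open>\<int>\<close>, each identified with its
  \<open>\<real>\<close>-linear extension to \<open>Y \<otimes> \<real>\<close>.\<close>

definition dual_lattice :: "'a::real_vector set \<Rightarrow> ('a \<Rightarrow> real) set" where
  "dual_lattice Y = {f. linear f \<and> (\<forall>y\<in>Y. f y \<in> \<int>)}"

text \<open>The type \<open>'a\<close> is the vector space \<open>Y \<otimes> \<real>\<close>, which has finite dimension, possibly zero;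
  the norm only serves to provide its topology. The lattice \<open>X\<close> is \<open>dual_lattice Y\<close>, and the
  pairing of \<open>y\<close> with \<open>f\<close> is \<open>f y\<close>. For elements of a lattice, linear independence over
  \<open>\<int>\<close> and over \<open>\<real>\<close> is the same.\<close>

locale kac_moody_root_datum =
  fixes I :: "'i set"
    and A :: "'i \<Rightarrow> 'i \<Rightarrow> int"
    and Y :: "'a::real_normed_vector set"
    and \<alpha> :: "'i \<Rightarrow> 'a \<Rightarrow> real"
    and \<alpha>v :: "'i \<Rightarrow> 'a"
  assumes finite_I: "finite I"
    and cartan: "generalized_cartan_matrix I A"
    and lattice: "full_lattice Y"
    and roots_in_X: "\<And>i. i \<in> I \<Longrightarrow> \<alpha> i \<in> dual_lattice Y"
    and coroots_in_Y: "\<And>i. i \<in> I \<Longrightarrow> \<alpha>v i \<in> Y"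
    and roots_independent:
      "\<And>c :: 'i \<Rightarrow> real. (\<forall>x. (\<Sum>i\<in>I. c i * \<alpha> i x) = 0) \<Longrightarrow> \<forall>i\<in>I. c i = 0"
    and coroots_independent:
      "\<And>c :: 'i \<Rightarrow> real. (\<Sum>i\<in>I. c i *\<^sub>R \<alpha>v i) = 0 \<Longrightarrow> \<forall>i\<in>I. c i = 0"
    and pairing: "\<And>i j. i \<in> I \<Longrightarrow> j \<in> I \<Longrightarrow> \<alpha> j (\<alpha>v i) = of_int (A i j)"
begin

definition simple_refl :: "'i \<Rightarrow> 'a \<Rightarrow> 'a" where
  "simple_refl i y = y - \<alpha> i y *\<^sub>R \<alpha>v i"

text \<open>The simple reflections are involutions, so the monoid they generate is a group.\<close>

inductive_set Weyl :: "('a \<Rightarrow> 'a) set" where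
  Weyl_id: "id \<in> Weyl"
| Weyl_step: "i \<in> I \<Longrightarrow> w \<in> Weyl \<Longrightarrow> simple_refl i \<circ> w \<in> Weyl"

definition Weyl_length :: "('a \<Rightarrow> 'a) \<Rightarrow> nat" where
  "Weyl_length w =
     (LEAST n. \<exists>js. set js \<subseteq> I \<and> length js = n \<and> w = foldr (\<lambda>i f. simple_refl i \<circ> f) js id)"

definition dual_act :: "('a \<Rightarrow> 'a) \<Rightarrow> ('a \<Rightarrow> real) \<Rightarrow> 'a \<Rightarrow> real" where
  "dual_act w f = f \<circ> inv w"

definition real_roots :: "('a \<Rightarrow> real) set" where
  "real_roots = {dual_act w (\<alpha> i) |w i. w \<in> Weyl \<and> i \<in> I}"

definition pos_roots :: "('a \<Rightarrow> real) set" where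
  "pos_roots = {\<beta> \<in> real_roots. \<exists>c :: 'i \<Rightarrow> nat. \<beta> = (\<lambda>x. \<Sum>i\<in>I. of_nat (c i) * \<alpha> i x)}"

definition neg_roots :: "('a \<Rightarrow> real) set" where
  "neg_roots = {\<beta> \<in> real_roots. \<exists>c :: 'i \<Rightarrow> nat. \<beta> = (\<lambda>x. - (\<Sum>i\<in>I. of_nat (c i) * \<alpha> i x))}"

text \<open>A presentation \<open>\<beta> = w \<alpha>\<^sub>i\<close> of a root; coroot and reflection do not depend on the choice.\<close>

definition root_pres :: "('a \<Rightarrow> real) \<Rightarrow> ('a \<Rightarrow> 'a) \<times> 'i" where
  "root_pres \<beta> = (SOME (w, i). w \<in> Weyl \<and> i \<in> I \<and> \<beta> = dual_act w (\<alpha> i))"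

definition coroot :: "('a \<Rightarrow> real) \<Rightarrow> 'a" where
  "coroot \<beta> = (case root_pres \<beta> of (w, i) \<Rightarrow> w (\<alpha>v i))"

definition root_refl :: "('a \<Rightarrow> real) \<Rightarrow> 'a \<Rightarrow> 'a" where
  "root_refl \<beta> = (case root_pres \<beta> of (w, i) \<Rightarrow> w \<circ> simple_refl i \<circ> inv w)"

definition fund_chamber :: "'a set" where
  "fund_chamber = {x. \<forall>i\<in>I. \<alpha> i x > 0}"

definition chamber :: "('a \<Rightarrow> 'a) \<Rightarrow> 'a set" where
  "chamber w = w ` fund_chamber"

definition Tits_cone :: "'a set" where
  "Tits_cone = (\<Union>w\<in>Weyl. closure (chamber w))"

definition spherical :: "'a \<Rightarrow> bool" where
  "spherical x \<longleftrightarrow> x \<in> interior Tits_cone"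

definition Yplus :: "'a set" where
  "Yplus = Y \<inter> Tits_cone"

text \<open>The pair \<open>(\<mu>, w)\<close> stands for \<open>\<varpi>\<^sup>\<mu> w\<close>.\<close>

definition Wplus :: "('a \<times> ('a \<Rightarrow> 'a)) set" where
  "Wplus = Yplus \<times> Weyl"

definition aff_mult ::
  "'a \<times> ('a \<Rightarrow> 'a) \<Rightarrow> 'a \<times> ('a \<Rightarrow> 'a) \<Rightarrow> 'a \<times> ('a \<Rightarrow> 'a)" where
  "aff_mult g h = (fst g + snd g (fst h), snd g \<circ> snd h)"

definition aff_act :: "'a \<times> ('a \<Rightarrow> 'a) \<Rightarrow> 'a \<Rightarrow> 'a" where
  "aff_act g x = - fst g + snd g x"

definition wall :: "('a \<Rightarrow> real) \<Rightarrow> int \<Rightarrow> 'a set" where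
  "wall \<beta> n = {x. \<beta> x + of_int n = 0}"

definition aff_refl :: "('a \<Rightarrow> real) \<Rightarrow> int \<Rightarrow> 'a \<times> ('a \<Rightarrow> 'a)" where
  "aff_refl \<beta> n = (of_int n *\<^sub>R coroot \<beta>, root_refl \<beta>)"

definition sgn_int :: "int \<Rightarrow> real" where
  "sgn_int n = (if n \<ge> 0 then 1 else -1)"

inductive aff_bruhat_step ::
  "'a \<times> ('a \<Rightarrow> 'a) \<Rightarrow> 'a \<times> ('a \<Rightarrow> 'a) \<Rightarrow> bool" where
  "(\<mu>, w) \<in> Wplus \<Longrightarrow> \<beta> \<in> pos_roots \<Longrightarrow>
   of_int \<bar>n\<bar> < sgn_int n * \<beta> \<mu> \<or>
   of_int \<bar>n\<bar> = sgn_int n * \<beta> \<mu> \<and> (\<lambda>x. sgn_int n * dual_act (inv w) \<beta> x) \<in> neg_roots \<Longrightarrow>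
   aff_bruhat_step (aff_mult (aff_refl \<beta> n) (\<mu>, w)) (\<mu>, w)"

definition aff_bruhat_less ::
  "'a \<times> ('a \<Rightarrow> 'a) \<Rightarrow> 'a \<times> ('a \<Rightarrow> 'a) \<Rightarrow> bool" where
  "aff_bruhat_less = aff_bruhat_step\<^sup>+\<^sup>+"

definition aff_bruhat_le ::
  "'a \<times> ('a \<Rightarrow> 'a) \<Rightarrow> 'a \<times> ('a \<Rightarrow> 'a) \<Rightarrow> bool" where
  "aff_bruhat_le x y \<longleftrightarrow> x = y \<or> aff_bruhat_less x y"

definition closed_direction :: "sign \<Rightarrow> ('a \<Rightarrow> 'a) \<Rightarrow> 'a set" where
  "closed_direction \<epsilon> w = (\<lambda>v. sval \<epsilon> *\<^sub>R v) ` closure (chamber w)"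

definition sector :: "'a \<Rightarrow> sign \<Rightarrow> ('a \<Rightarrow> 'a) \<Rightarrow> 'a set" where
  "sector x \<epsilon> w = (\<lambda>v. x + v) ` closed_direction \<epsilon> w"

text \<open>An alcove is a filter. It determines its base point and its direction, but not the pair
  \<open>(\<epsilon>, w)\<close>: if the Weyl group is finite, with longest element \<open>w\<^sub>0\<close>, then
  \<open>alcove x Neg w = alcove x Pos (w \<circ> w\<^sub>0)\<close>. Signs and chambers of alcoves are therefore
  handled through presentations \<open>alcove x \<epsilon> w\<close>.\<close>

definition alcove :: "'a \<Rightarrow> sign \<Rightarrow> ('a \<Rightarrow> 'a) \<Rightarrow> 'a filter" where
  "alcove x \<epsilon> w = (INF r\<in>{0<..}. principal (sector x \<epsilon> w \<inter> ball x r))"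

definition alcoves_at :: "sign \<Rightarrow> 'a \<Rightarrow> 'a filter set" where
  "alcoves_at \<epsilon> x = {alcove x \<epsilon> w |w. w \<in> Weyl}"

definition base_alcove :: "'a filter" where
  "base_alcove = alcove 0 Pos id"

definition alcove_act :: "'a \<times> ('a \<Rightarrow> 'a) \<Rightarrow> 'a filter \<Rightarrow> 'a filter" where
  "alcove_act g a = filtermap (aff_act g) a"

definition alcove_of :: "'a \<times> ('a \<Rightarrow> 'a) \<Rightarrow> 'a filter" where
  "alcove_of g = alcove_act g base_alcove"

definition half_space :: "sign \<Rightarrow> ('a \<Rightarrow> real) \<Rightarrow> int \<Rightarrow> 'a set" where
  "half_space \<epsilon> \<beta> n = {x. sval \<epsilon> * (\<beta> x + of_int n) \<ge> 0}"

definition on_negative_side :: "('a \<Rightarrow> real) \<Rightarrow> int \<Rightarrow> 'a filter \<Rightarrow> bool" where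
  "on_negative_side \<beta> n a \<longleftrightarrow>
     (\<exists>\<epsilon>. a \<le> principal (half_space \<epsilon> \<beta> n) \<and> \<not> base_alcove \<le> principal (half_space \<epsilon> \<beta> n))"

definition alcove_dist :: "sign \<Rightarrow> 'a filter \<Rightarrow> 'a filter \<Rightarrow> 'a \<Rightarrow> 'a" where
  "alcove_dist \<epsilon> a b =
     (THE w. \<exists>x. \<exists>w1\<in>Weyl. \<exists>w2\<in>Weyl.
        a = alcove x \<epsilon> w1 \<and> b = alcove x \<epsilon> w2 \<and> w = inv w1 \<circ> w2)"

text \<open>Here \<open>\<epsilon>\<close> is the sign of the first alcove.\<close>

definition alcove_codist :: "sign \<Rightarrow> 'a filter \<Rightarrow> 'a filter \<Rightarrow> 'a \<Rightarrow> 'a" where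
  "alcove_codist \<epsilon> a b =
     (THE w. \<exists>x. \<exists>w1\<in>Weyl. \<exists>w2\<in>Weyl.
        a = alcove x \<epsilon> w1 \<and> b = alcove x (opp \<epsilon>) w2 \<and> w = inv w1 \<circ> w2)"

definition alcove_proj :: "'a \<Rightarrow> 'a filter \<Rightarrow> 'a filter" where
  "alcove_proj x a =
     (THE b. \<exists>\<epsilon>. \<exists>w\<in>Weyl. b = alcove x \<epsilon> w \<and> a \<le> principal (sector x \<epsilon> w))"

text \<open>A germ of a piecewise affine path is given by its base point \<open>x\<close> and its direction \<open>v\<close>.\<close>

definition dominating_alcoves :: "sign \<Rightarrow> 'a \<Rightarrow> 'a \<Rightarrow> 'a filter set" where
  "dominating_alcoves \<epsilon> x v = {alcove x \<epsilon> w |w. w \<in> Weyl \<and> v \<in> closed_direction \<epsilon> w}"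

definition is_germ_proj :: "'a \<Rightarrow> 'a \<Rightarrow> 'a filter \<Rightarrow> 'a filter \<Rightarrow> bool" where
  "is_germ_proj x v a b \<longleftrightarrow>
     (\<exists>\<epsilon>. spherical (sval \<epsilon> *\<^sub>R v) \<and>
       (alcove_proj x a \<in> alcoves_at \<epsilon> x \<and>
        is_arg_min (\<lambda>b. Weyl_length (alcove_dist \<epsilon> (alcove_proj x a) b))
          (\<lambda>b. b \<in> dominating_alcoves \<epsilon> x v) b
      \<or> alcove_proj x a \<in> alcoves_at (opp \<epsilon>) x \<and>
        is_arg_max (\<lambda>b. Weyl_length (alcove_codist (opp \<epsilon>) (alcove_proj x a) b))
          (\<lambda>b. b \<in> dominating_alcoves \<epsilon> x v) b))"

definition germ_proj :: "'a \<Rightarrow> 'a \<Rightarrow> 'a filter \<Rightarrow> 'a filter" where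
  "germ_proj x v a = (THE b. is_germ_proj x v a b)"

end

text \<open>The direction of the germ \<open>c\<^sub>\<epsilon>(t)\<close>.\<close>

definition germ_dir :: "(real \<Rightarrow> 'a::real_normed_vector) \<Rightarrow> real \<times> sign \<Rightarrow> 'a" where
  "germ_dir c p =
     (case p of (t, \<epsilon>) \<Rightarrow>
        (case \<epsilon> of
           Pos \<Rightarrow> vector_derivative c (at t within {t..1})
         | Neg \<Rightarrow> - vector_derivative c (at t within {0..t})))"

definition affine_on :: "(real \<Rightarrow> 'a::real_vector) \<Rightarrow> real \<Rightarrow> real \<Rightarrow> bool" where
  "affine_on c t0 t1 \<longleftrightarrow> (\<exists>u v. \<forall>t\<in>{t0..t1}. c t = u + t *\<^sub>R v)"

definition piecewise_affine :: "(real \<Rightarrow> 'a::real_vector) \<Rightarrow> bool" where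
  "piecewise_affine c \<longleftrightarrow>
     (\<exists>(n::nat) s. s 0 = 0 \<and> s n = 1 \<and>
        (\<forall>k<n. s k < s (Suc k) \<and> affine_on c (s k) (s (Suc k))))"

definition signed_interval :: "real \<Rightarrow> real \<Rightarrow> (real \<times> sign) set" where
  "signed_interval t t' = ({t..<t'} \<times> {Pos}) \<union> ({t<..t'} \<times> {Neg})"

text \<open>Functions on \<open>[0,1]\<close> and on \<open>signed_interval 0 1\<close> are extensional, so that
  equality of open paths is equality on these domains.\<close>

record 'a open_path =
  curve :: "real \<Rightarrow> 'a"
  deco :: "real \<times> sign \<Rightarrow> 'a filter"
  end_alcove :: "'a filter"

context kac_moody_root_datum
begin

definition neg_lambda_path :: "'a \<Rightarrow> (real \<Rightarrow> 'a) \<Rightarrow> bool" where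
  "neg_lambda_path \<mu> c \<longleftrightarrow> piecewise_affine c \<and>
     (\<forall>t\<in>{0..<1}. vector_derivative c (at t within {t..1}) \<in> (\<lambda>w. - w \<mu>) ` Weyl) \<and>
     (\<forall>t\<in>{0<..1}. vector_derivative c (at t within {0..t}) \<in> (\<lambda>w. - w \<mu>) ` Weyl)"

definition is_open_path :: "'a open_path \<Rightarrow> bool" where
  "is_open_path P \<longleftrightarrow>
     curve P \<in> extensional {0..1} \<and> deco P \<in> extensional (signed_interval 0 1) \<and>
     (\<exists>\<mu>. spherical \<mu> \<and> neg_lambda_path \<mu> (curve P)) \<and>
     (\<forall>(t, \<epsilon>) \<in> signed_interval 0 1.
        deco P (t, \<epsilon>) \<in> dominating_alcoves (opp \<epsilon>) (curve P t) (germ_dir (curve P) (t, \<epsilon>))) \<and>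
     (\<exists>\<epsilon>. end_alcove P \<in> alcoves_at \<epsilon> (curve P 1))"

definition admissible :: "'a open_path \<Rightarrow> bool" where
  "admissible P \<longleftrightarrow>
     (\<forall>t0 t1. 0 \<le> t0 \<and> t0 < t1 \<and> t1 \<le> 1 \<and> affine_on (curve P) t0 t1 \<longrightarrow>
        (\<forall>(t, \<epsilon>) \<in> signed_interval t0 t1. \<forall>(t', \<epsilon>') \<in> signed_interval t0 t1.
           deco P (t, \<epsilon>) =
             germ_proj (curve P t) (germ_dir (curve P) (t, \<epsilon>)) (deco P (t', \<epsilon>'))))"

definition straight_path :: "'a \<Rightarrow> real \<Rightarrow> 'a" where
  "straight_path \<mu> = (\<lambda>t\<in>{0..1}. - t *\<^sub>R \<mu>)"

definition straight_open_path :: "'a \<times> ('a \<Rightarrow> 'a) \<Rightarrow> 'a open_path" where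
  "straight_open_path x =
     \<lparr>curve = straight_path (fst x),
      deco = (\<lambda>(t, \<epsilon>) \<in> signed_interval 0 1.
        germ_proj (straight_path (fst x) t) (germ_dir (straight_path (fst x)) (t, \<epsilon>)) (alcove_of x)),
      end_alcove = alcove_of x\<rparr>"

definition folding :: "real \<Rightarrow> ('a \<Rightarrow> real) \<Rightarrow> int \<Rightarrow> 'a open_path \<Rightarrow> 'a open_path" where
  "folding t0 \<beta> n P =
     \<lparr>curve = (\<lambda>t\<in>{0..1}. if t \<ge> t0 then aff_act (aff_refl \<beta> n) (curve P t) else curve P t),
      deco = (\<lambda>(t, \<epsilon>) \<in> signed_interval 0 1.
        if t > t0 \<or> (t, \<epsilon>) = (t0, Pos) then alcove_act (aff_refl \<beta> n) (deco P (t, \<epsilon>))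
        else deco P (t, \<epsilon>)),
      end_alcove = alcove_act (aff_refl \<beta> n) (end_alcove P)\<rparr>"

definition positive_folding :: "real \<Rightarrow> ('a \<Rightarrow> real) \<Rightarrow> int \<Rightarrow> 'a open_path \<Rightarrow> bool" where
  "positive_folding t0 \<beta> n P \<longleftrightarrow>
     on_negative_side \<beta> n (if t0 < 1 then deco P (t0, Pos) else end_alcove P)"

text \<open>A list \<open>(t\<^sub>0, \<beta>\<^sub>0, n\<^sub>0), \<dots>, (t\<^sub>r, \<beta>\<^sub>r, n\<^sub>r)\<close> encodes a sequence of foldings, the head being
  applied first.\<close>

definition fold_seq :: "(real \<times> ('a \<Rightarrow> real) \<times> int) list \<Rightarrow> 'a open_path \<Rightarrow> 'a open_path" where
  "fold_seq fs = fold (\<lambda>(t, \<beta>, n). folding t \<beta> n) fs"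

definition refl_seq :: "(real \<times> ('a \<Rightarrow> real) \<times> int) list \<Rightarrow> 'a \<Rightarrow> 'a" where
  "refl_seq fs = fold (\<lambda>(t, \<beta>, n). aff_act (aff_refl \<beta> n)) fs"

definition hecke_folding_data ::
  "'a \<times> ('a \<Rightarrow> 'a) \<Rightarrow> (real \<times> ('a \<Rightarrow> real) \<times> int) list \<Rightarrow> bool" where
  "hecke_folding_data x fs \<longleftrightarrow>
     sorted (map fst fs) \<and>
     (\<forall>k<length fs. case fs ! k of (t, \<beta>, n) \<Rightarrow>
        t \<in> {0..1} \<and> \<beta> \<in> real_roots \<and>
        refl_seq (take k fs) (- t *\<^sub>R fst x) \<in> wall \<beta> n \<and>
        positive_folding t \<beta> n (fold_seq (take k fs) (straight_open_path x)))"

definition hecke_open_path :: "'a \<times> ('a \<Rightarrow> 'a) \<Rightarrow> 'a open_path \<Rightarrow> bool" where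
  "hecke_open_path x P \<longleftrightarrow>
     is_open_path P \<and> admissible P \<and>
     (\<exists>fs. hecke_folding_data x fs \<and> P = fold_seq fs (straight_open_path x))"

definition hecke_open_paths ::
  "'a \<times> ('a \<Rightarrow> 'a) \<Rightarrow> 'a \<times> ('a \<Rightarrow> 'a) \<Rightarrow> 'a open_path set" where
  "hecke_open_paths x y = {P. hecke_open_path x P \<and> end_alcove P = alcove_of y}"

end

end

theory Submission
  imports Defs
begin

text \<open>
  Let \<open>\<^bold>x\<^sub>k\<close> be the product of the first \<open>k\<close> folding reflections with \<open>\<^bold>x\<close>. For \<open>t < 1\<close> the
  sector of the alcove \<open>D\<^sup>+\<^sub>t\<close> of the straight path contains the end alcove, and the folding wall
  passes through the vertex of its image; so positivity of the next folding puts the alcove of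
  \<open>\<^bold>x\<^sub>k\<close> on the negative side of the wall, which is the defining condition of
  \<open>\<^bold>x\<^sub>k\<^sub>+\<^sub>1 < \<^bold>x\<^sub>k\<close>. Hence \<open>\<^bold>y \<le> \<^bold>x\<close>.

  The interval \<open>[\<^bold>y, \<^bold>x]\<close> is finite. Let \<open>h\<close> be a linear form with value 1 on simple coroots and
  \<open>\<mu>\<^sup>+\<^sup>+\<close> the dominant representative of \<open>\<mu>\<close>. Going up in the Bruhat order, either \<open>h(\<mu>\<^sup>+\<^sup>+)\<close>
  increases by at least the height of a coroot, or \<open>\<mu>\<close> is reflected towards the dominant chamber
  and \<open>h(\<mu>)\<close> increases, or only the Weyl group part changes. As \<open>h(\<mu>\<^sup>+\<^sup>+)\<close> is bounded by its
  value at the top, each translation part has finitely many successors and there are finitely many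
  in the interval; for a fixed one, descending steps shorten \<open>v\<inverse>w\<close>, where \<open>v\<close> is the shortest
  element moving \<open>\<mu>\<^sup>+\<^sup>+\<close> to \<open>\<mu>\<close>.

  At each time a Hecke path is the image of the straight path under one of the finitely many
  elements \<open>\<^bold>z\<^bold>x\<inverse>\<close> with \<open>\<^bold>z\<close> in the interval, and it can change direction only when two of the
  corresponding rays cross. Between two crossing times it is affine, so by admissibility it is
  determined by its points and one decoration at each crossing time, which leaves finitely many
  paths.
\<close>

subsection \<open>Preliminaries\<close>

text \<open>Counting downwards from \<open>x\<close> alone cannot work: if the Weyl group is
  infinite, a spherical translation part is positive on all but finitely many positive roots, and
  each of these gives an element below \<open>x\<close> with \<open>n = 0\<close>. Finiteness has to
  come from climbing from \<open>y\<close>, with the orbit height of \<open>x\<close> as a ceiling;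
  the descent from \<open>x\<close> branches finitely only once the translation parts of the
  interval are known to be finite in number. There are infinitely many roots, so they are counted by
  heights of coroots. This rests on three facts: a real root is positive or negative, its coroot
  does not depend on the chosen presentation, and a positive root is determined by its coroot.
  Sphericity enters through a neighbourhood inside the Tits cone: only finitely many roots can
  change sign near a spherical vector, so one closed chamber contains the germ to be projected. If
  the Weyl group is finite, an alcove has both signs, and uniqueness of projections must be checked
  across the two.\<close>

lemma independent_coefficients_bounded:
  fixes B :: "'a::real_normed_vector set"
  assumes "finite B" "independent B"
  shows "\<exists>m>0. \<forall>c. m * (\<Sum>b\<in>B. \<bar>c b\<bar>) \<le> norm (\<Sum>b\<in>B. c b *\<^sub>R b)"
  using assms
proof (induction B rule: finite_induct)
  case empty
  show ?case by (intro exI[of _ 1]) auto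
next
  case (insert b B)
  then have indB: "independent B" and b: "b \<notin> span B"
    by (auto simp: independent_insert split: if_splits)
  then obtain m where m: "m > 0"
    and mB: "\<And>c. m * (\<Sum>b\<in>B. \<bar>c b\<bar>) \<le> norm (\<Sum>b\<in>B. c b *\<^sub>R b)"
    using insert.IH by blast
  \<comment> \<open>The new vector keeps a positive distance from the span of \<open>B\<close>.
    Otherwise combinations of \<open>B\<close> would converge to \<open>- b\<close>; by the
    induction bound their coefficients are Cauchy, so the limit would lie in the span.\<close>
  have "\<exists>\<delta>>0. \<forall>c. \<delta> \<le> norm (b + (\<Sum>b\<in>B. c b *\<^sub>R b))"
  proof (rule ccontr)
    assume "\<not> ?thesis"
    then have "\<forall>n::nat. \<exists>c. norm (b + (\<Sum>b\<in>B. c b *\<^sub>R b)) < 1 / real (Suc n)"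
      by (metis of_nat_0_less_iff not_le zero_less_Suc zero_less_divide_1_iff)
    then obtain c where c: "\<And>n. norm (b + (\<Sum>b\<in>B. c n b *\<^sub>R b)) < 1 / real (Suc n)"
      by metis
    have lim0: "(\<lambda>n. b + (\<Sum>b\<in>B. c n b *\<^sub>R b)) \<longlonglongrightarrow> 0"
      by (rule tendsto_norm_zero_cancel, rule tendsto_sandwich[OF _ _ tendsto_const LIMSEQ_inverse_real_of_nat])
        (use c in \<open>auto intro!: always_eventually less_imp_le simp: inverse_eq_divide\<close>)
    have "convergent (\<lambda>n. c n b')" if b': "b' \<in> B" for b'
    proof -
      have bound: "m * \<bar>c n b' - c k b'\<bar> \<le> norm ((b + (\<Sum>b\<in>B. c n b *\<^sub>R b)) - (b + (\<Sum>b\<in>B. c k b *\<^sub>R b)))" for n k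
      proof -
        have "\<bar>c n b' - c k b'\<bar> \<le> (\<Sum>b\<in>B. \<bar>c n b - c k b\<bar>)"
          using insert.hyps(1) b' by (intro member_le_sum) auto
        then have "m * \<bar>c n b' - c k b'\<bar> \<le> m * (\<Sum>b\<in>B. \<bar>c n b - c k b\<bar>)"
          using m by simp
        also have "\<dots> \<le> norm (\<Sum>b\<in>B. (c n b - c k b) *\<^sub>R b)"
          by (rule mB)
        finally show ?thesis
          by (simp add: scaleR_diff_left sum_subtractf)
      qed
      have "Cauchy (\<lambda>n. b + (\<Sum>b\<in>B. c n b *\<^sub>R b))"
        using lim0 by (rule LIMSEQ_imp_Cauchy)
      have "Cauchy (\<lambda>n. c n b')"
        unfolding Cauchy_iff
      proof (intro allI impI)
        fix e :: real assume "e > 0"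
        then have "m * e > 0" using m by simp
        then obtain M where M: "\<And>n k. n \<ge> M \<Longrightarrow> k \<ge> M \<Longrightarrow>
            norm ((b + (\<Sum>b\<in>B. c n b *\<^sub>R b)) - (b + (\<Sum>b\<in>B. c k b *\<^sub>R b))) < m * e"
          using \<open>Cauchy (\<lambda>n. b + (\<Sum>b\<in>B. c n b *\<^sub>R b))\<close> unfolding Cauchy_iff by metis
        show "\<exists>M. \<forall>n\<ge>M. \<forall>k\<ge>M. norm (c n b' - c k b') < e"
        proof (intro exI[of _ M] allI impI)
          fix n k assume "M \<le> n" "M \<le> k"
          then have "m * \<bar>c n b' - c k b'\<bar> < m * e"
            using M[of n k] bound[of n k] by linarith
          then show "norm (c n b' - c k b') < e" using m by simp
        qed
      qed
      then show ?thesis by (rule Cauchy_convergent)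
    qed
    then obtain L where L: "\<And>b'. b' \<in> B \<Longrightarrow> (\<lambda>n. c n b') \<longlonglongrightarrow> L b'"
      unfolding convergent_def by metis
    have "(\<lambda>n. b + (\<Sum>b\<in>B. c n b *\<^sub>R b)) \<longlonglongrightarrow> b + (\<Sum>b\<in>B. L b *\<^sub>R b)"
      using L by (intro tendsto_intros) auto
    then have "b + (\<Sum>b\<in>B. L b *\<^sub>R b) = 0"
      using lim0 LIMSEQ_unique by blast
    then have "b = - (\<Sum>b\<in>B. L b *\<^sub>R b)"
      by (simp add: eq_neg_iff_add_eq_0)
    then show False
      using b by (auto intro: span_neg span_sum span_scale span_base)
  qed
  then obtain \<delta> where \<delta>: "\<delta> > 0" and \<delta>B: "\<And>c. \<delta> \<le> norm (b + (\<Sum>b\<in>B. c b *\<^sub>R b))"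
    by blast
  have t: "\<delta> * \<bar>t\<bar> \<le> norm (t *\<^sub>R b + (\<Sum>b\<in>B. c b *\<^sub>R b))" for t c
  proof (cases "t = 0")
    case False
    have "t *\<^sub>R b + (\<Sum>b\<in>B. c b *\<^sub>R b) = t *\<^sub>R (b + (\<Sum>b\<in>B. (c b / t) *\<^sub>R b))"
      using False by (simp add: scaleR_right_distrib scaleR_sum_right)
    then show ?thesis
      using mult_left_mono[OF \<delta>B[of "\<lambda>b. c b / t"], of "\<bar>t\<bar>"] by (simp add: mult.commute)
  qed simp
  \<comment> \<open>With \<open>N\<close> the norm of the whole combination, the new coefficient is
    at most \<open>N / \<delta>\<close> and the others sum to at most
    \<open>(N + (N / \<delta>) * norm b) / m\<close>; \<open>K\<close> adds the two bounds.\<close>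
  define K where "K = 1 / \<delta> + (1 + norm b / \<delta>) / m"
  have K: "K > 0" using m \<delta> by (simp add: K_def add_pos_nonneg)
  have "(\<Sum>b\<in>insert b B. \<bar>c b\<bar>) \<le> K * norm (\<Sum>b\<in>insert b B. c b *\<^sub>R b)" for c
  proof -
    let ?N = "norm (c b *\<^sub>R b + (\<Sum>b\<in>B. c b *\<^sub>R b))"
    have t1: "\<bar>c b\<bar> \<le> ?N / \<delta>"
      using t[of "c b" c] \<delta> by (simp add: field_simps)
    have "norm (\<Sum>b\<in>B. c b *\<^sub>R b) \<le> ?N + norm (c b *\<^sub>R b)"
      by (metis add.commute add_diff_cancel norm_triangle_ineq4)
    also have "norm (c b *\<^sub>R b) \<le> (?N / \<delta>) * norm b"
      using mult_right_mono[OF t1 norm_ge_zero[of b]] by simp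
    finally have "m * (\<Sum>b\<in>B. \<bar>c b\<bar>) \<le> ?N + (?N / \<delta>) * norm b"
      using mB[of c] by linarith
    then have "(\<Sum>b\<in>B. \<bar>c b\<bar>) \<le> (?N + (?N / \<delta>) * norm b) / m"
      using m by (simp add: field_simps)
    then have "\<bar>c b\<bar> + (\<Sum>b\<in>B. \<bar>c b\<bar>) \<le> ?N / \<delta> + (?N + (?N / \<delta>) * norm b) / m"
      using t1 by simp
    also have "\<dots> = K * ?N"
      by (simp add: K_def algebra_simps add_divide_distrib)
    finally show ?thesis
      using insert.hyps by simp
  qed
  then show ?case
    using K by (intro exI[of _ "1 / K"]) (simp add: field_simps)
qed

lemma linear_bounded_finite_dimensional:
  fixes f :: "'a::real_normed_vector \<Rightarrow> 'b::real_normed_vector" and B :: "'a set"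
  assumes B: "finite B" "independent B" "span B = UNIV" and f: "linear f"
  shows "\<exists>K>0. \<forall>x. norm (f x) \<le> K * norm x"
proof -
  obtain m where m: "m > 0" and mB: "\<And>c. m * (\<Sum>b\<in>B. \<bar>c b\<bar>) \<le> norm (\<Sum>b\<in>B. c b *\<^sub>R b)"
    using independent_coefficients_bounded[OF B(1,2)] by blast
  define M where "M = (\<Sum>b\<in>B. norm (f b))"
  have "norm (f x) \<le> (M + 1) / m * norm x" for x
  proof -
    obtain c where x: "x = (\<Sum>b\<in>B. c b *\<^sub>R b)"
      using span_finite[OF B(1)] B(3) by blast
    have "norm (f x) \<le> (\<Sum>b\<in>B. \<bar>c b\<bar> * norm (f b))"
      unfolding x linear_sum[OF f] linear_cmul[OF f] by (rule order_trans[OF norm_sum]) simp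
    also have "\<dots> \<le> (\<Sum>b\<in>B. \<bar>c b\<bar> * M)"
      unfolding M_def by (intro sum_mono mult_left_mono member_le_sum) (use B(1) in auto)
    also have "\<dots> \<le> (\<Sum>b\<in>B. \<bar>c b\<bar>) * (M + 1)"
      by (simp add: sum_distrib_right[symmetric] mult_left_mono sum_nonneg)
    also have "\<dots> \<le> norm x / m * (M + 1)"
      using mB[of c] m by (intro mult_right_mono) (auto simp: x field_simps M_def sum_nonneg add_nonneg_nonneg)
    finally show ?thesis by (simp add: mult.commute)
  qed
  then show ?thesis
    using m by (intro exI[of _ "(M + 1) / m"]) (auto simp: M_def intro!: divide_pos_pos add_nonneg_pos sum_nonneg)
qed

text \<open>Serves to compare two reflections in both orders: with the same root and two candidate
  coroots, or with two roots and the same coroot.\<close>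

lemma two_reflections:
  fixes f g :: "'a::real_vector \<Rightarrow> real"
  assumes "linear g" "g c = 2"
  shows "(y - f y *\<^sub>R c) - g (y - f y *\<^sub>R c) *\<^sub>R c' = y - f y *\<^sub>R c - (g y - f y) *\<^sub>R c' + f y *\<^sub>R c'"
proof -
  have "g (y - f y *\<^sub>R c) = (g y - f y) - f y"
    using assms by (simp add: linear_diff linear_cmul)
  then show ?thesis by (simp only: scaleR_left_diff_distrib) simp
qed

text \<open>Koenig's lemma in well-founded form. It is applied twice, to ascents of translation
  parts and to descents inside a Bruhat interval.\<close>

lemma finite_reachable:
  assumes wf: "wf {(b, a). R a b}" and fin: "\<And>a. finite {b. R a b}"
  shows "finite {b. R\<^sup>*\<^sup>* a b}"
  using wf
proof (induction a rule: wf_induct_rule)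
  case (less a)
  have "{b. R\<^sup>*\<^sup>* a b} \<subseteq> insert a (\<Union>b\<in>{b. R a b}. {c. R\<^sup>*\<^sup>* b c})"
    by (auto elim: converse_rtranclpE)
  moreover have "finite (\<Union>b\<in>{b. R a b}. {c. R\<^sup>*\<^sup>* b c})"
    using fin less by blast
  ultimately show ?case by (meson finite_insert finite_subset)
qed

text \<open>Heights are real numbers, but they change by at least 1; rounding up makes them usable
  as well-founded measures.\<close>

lemma nat_ceiling_less:
  fixes a b :: real
  assumes "0 \<le> a" "a + 1 \<le> b"
  shows "nat \<lceil>a\<rceil> < nat \<lceil>b\<rceil>"
proof -
  have "\<lceil>a\<rceil> + 1 \<le> \<lceil>b\<rceil>" using assms(2) by linarith
  moreover have "0 \<le> \<lceil>a\<rceil>" using assms(1) by linarith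
  ultimately show ?thesis by linarith
qed

text \<open>Containment of an alcove in a set only concerns small vectors; this shrinks a given
  vector into the ball where something is known.\<close>

lemma scale_below:
  fixes a b :: real
  assumes "a \<ge> 0" "b > 0"
  obtains s where "s > 0" "\<And>s'. 0 < s' \<Longrightarrow> s' \<le> s \<Longrightarrow> s' * a < b"
proof
  show "b / (a + 1) > 0" using assms by simp
  fix s' assume s': "0 < s'" "s' \<le> b / (a + 1)"
  have "s' * a < s' * (a + 1)" using s' by simp
  also have "\<dots> \<le> b" using s' assms by (simp add: field_simps)
  finally show "s' * a < b" .
qed

lemma affine_on_determined:
  fixes c d :: "real \<Rightarrow> 'a::real_vector"
  assumes "affine_on c a b" "affine_on d a b" "a < b" "c a = d a" "c b = d b" "t \<in> {a..b}"
  shows "c t = d t"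
proof -
  obtain u v where c: "\<And>t. t \<in> {a..b} \<Longrightarrow> c t = u + t *\<^sub>R v"
    using assms(1) unfolding affine_on_def by blast
  obtain u' v' where d: "\<And>t. t \<in> {a..b} \<Longrightarrow> d t = u' + t *\<^sub>R v'"
    using assms(2) unfolding affine_on_def by blast
  have e: "u + a *\<^sub>R v = u' + a *\<^sub>R v'" "u + b *\<^sub>R v = u' + b *\<^sub>R v'"
    using c[of a] d[of a] c[of b] d[of b] assms(3-5) by auto
  have "(b - a) *\<^sub>R v = (u + b *\<^sub>R v) - (u + a *\<^sub>R v)" by (simp add: scaleR_left_diff_distrib)
  also have "\<dots> = (b - a) *\<^sub>R v'" unfolding e by (simp add: scaleR_left_diff_distrib)
  finally have "v = v'" using assms(3) by simp
  then show ?thesis using e(1) c[OF assms(6)] d[OF assms(6)] by simp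
qed

definition consecutive :: "real set \<Rightarrow> real \<Rightarrow> real \<Rightarrow> bool" where
  "consecutive T a b \<longleftrightarrow> a \<in> T \<and> b \<in> T \<and> a < b \<and> T \<inter> {a<..<b} = {}"

text \<open>A germ of sign \<open>Pos\<close> looks to the right, so its gap may begin at
  \<open>t\<close>; a germ of sign \<open>Neg\<close> looks to the left, so its gap may end at
  \<open>t\<close>. Hence the different strictness in the two cases.\<close>

lemma signed_interval_consecutive:
  assumes "finite T" "0 \<in> T" "1 \<in> T" and p: "(t, \<epsilon>) \<in> signed_interval 0 1"
  shows "\<exists>a b. consecutive T a b \<and> (t, \<epsilon>) \<in> signed_interval a b"
proof (cases \<epsilon>)
  case Pos
  then have t: "0 \<le> t" "t < 1" using p by (auto simp: signed_interval_def)
  let ?A = "{\<theta> \<in> T. \<theta> \<le> t}" and ?B = "{\<theta> \<in> T. t < \<theta>}"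
  have A: "finite ?A" "?A \<noteq> {}" and B: "finite ?B" "?B \<noteq> {}" using assms t by auto
  have a: "Max ?A \<in> ?A" and b: "Min ?B \<in> ?B" using Max_in[OF A] Min_in[OF B] by auto
  have "T \<inter> {Max ?A<..<Min ?B} = {}"
    using Max_ge[OF A(1)] Min_le[OF B(1)] by (force simp: not_le)
  then show ?thesis
    using a b Pos unfolding consecutive_def by (intro exI[of _ "Max ?A"] exI[of _ "Min ?B"]) (auto simp: signed_interval_def)
next
  case Neg
  then have t: "0 < t" "t \<le> 1" using p by (auto simp: signed_interval_def)
  let ?A = "{\<theta> \<in> T. \<theta> < t}" and ?B = "{\<theta> \<in> T. t \<le> \<theta>}"
  have A: "finite ?A" "?A \<noteq> {}" and B: "finite ?B" "?B \<noteq> {}" using assms t by auto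
  have a: "Max ?A \<in> ?A" and b: "Min ?B \<in> ?B" using Max_in[OF A] Min_in[OF B] by auto
  have "T \<inter> {Max ?A<..<Min ?B} = {}"
    using Max_ge[OF A(1)] Min_le[OF B(1)] by (force simp: not_le)
  then show ?thesis
    using a b Neg unfolding consecutive_def by (intro exI[of _ "Max ?A"] exI[of _ "Min ?B"]) (auto simp: signed_interval_def)
qed

context kac_moody_root_datum
begin

subsection \<open>Words and length in the Weyl group\<close>

lemma finite_basis: "\<exists>B::'a set. finite B \<and> independent B \<and> span B = UNIV"
  using lattice unfolding full_lattice_def by blast

lemma functional_bounded:
  fixes f :: "'a \<Rightarrow> real"
  assumes "linear f"
  shows "\<exists>K>0. \<forall>x. \<bar>f x\<bar> \<le> K * norm x"
  using linear_bounded_finite_dimensional[OF _ _ _ assms] finite_basis by (metis real_norm_def)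

lemma functional_continuous:
  fixes f :: "'a \<Rightarrow> real"
  assumes "linear f"
  shows "continuous_on S f"
proof -
  have "bounded_linear f"
  proof -
    obtain K where "\<And>x. \<bar>f x\<bar> \<le> K * norm x"
      using functional_bounded[OF assms] by blast
    then show ?thesis
      using assms by (intro bounded_linear_intro[of f K]) (simp_all add: linear_add linear_cmul mult.commute)
  qed
  then show ?thesis by (rule linear_continuous_on)
qed

lemma lattice_add: "x \<in> Y \<Longrightarrow> y \<in> Y \<Longrightarrow> x + y \<in> Y"
  and lattice_scale: "x \<in> Y \<Longrightarrow> of_int n *\<^sub>R x \<in> Y"
proof -
  obtain B where Y: "Y = range (\<lambda>c::'a \<Rightarrow> int. \<Sum>b\<in>B. of_int (c b) *\<^sub>R b)"
    using lattice unfolding full_lattice_def by blast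
  show "x + y \<in> Y" if xy: "x \<in> Y" "y \<in> Y"
  proof -
    obtain c d :: "'a \<Rightarrow> int" where "x = (\<Sum>b\<in>B. of_int (c b) *\<^sub>R b)" "y = (\<Sum>b\<in>B. of_int (d b) *\<^sub>R b)"
      using xy unfolding Y by blast
    then show ?thesis unfolding Y
      by (intro range_eqI[of _ _ "\<lambda>b. c b + d b"]) (simp add: sum.distrib scaleR_left_distrib)
  qed
  show "of_int n *\<^sub>R x \<in> Y" if x: "x \<in> Y"
  proof -
    obtain c where "x = (\<Sum>b\<in>B. of_int (c b :: int) *\<^sub>R b)" using x Y by blast
    then show ?thesis unfolding Y
      by (intro range_eqI[of _ _ "\<lambda>b. n * c b"]) (simp add: scaleR_sum_right)
  qed
qed

lemma linear_root: "i \<in> I \<Longrightarrow> linear (\<alpha> i)"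
  and root_int: "i \<in> I \<Longrightarrow> y \<in> Y \<Longrightarrow> \<alpha> i y \<in> \<int>"
  using roots_in_X unfolding dual_lattice_def by auto

lemmas simple_root_add = linear_add[OF linear_root]
lemmas simple_root_diff = linear_diff[OF linear_root]
lemmas simple_root_scale = linear_cmul[OF linear_root]
lemmas simple_root_neg = linear_neg[OF linear_root]
lemmas simple_root_zero = linear_0[OF linear_root]

lemma root_diag: "i \<in> I \<Longrightarrow> \<alpha> i (\<alpha>v i) = 2"
  using pairing[of i i] cartan unfolding generalized_cartan_matrix_def by simp

lemma linear_simple_refl: "i \<in> I \<Longrightarrow> linear (simple_refl i)"
  unfolding simple_refl_def
  by (rule linearI) (simp_all add: simple_root_add simple_root_scale algebra_simps)

lemma simple_refl_involution: "i \<in> I \<Longrightarrow> simple_refl i (simple_refl i y) = y"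
  unfolding simple_refl_def
  by (simp add: simple_root_diff simple_root_scale root_diag algebra_simps)

lemma simple_refl_comp_self: "i \<in> I \<Longrightarrow> simple_refl i \<circ> simple_refl i = id"
  by (auto simp: simple_refl_involution)

definition wprod :: "'i list \<Rightarrow> 'a \<Rightarrow> 'a" where
  "wprod js = foldr (\<lambda>i f. simple_refl i \<circ> f) js id"

lemma wprod_simps [simp]: "wprod [] = id" "wprod (i # js) = simple_refl i \<circ> wprod js"
  by (simp_all add: wprod_def)

lemma wprod_append: "wprod (us @ vs) = wprod us \<circ> wprod vs"
  by (induction us) auto

lemma Weyl_iff_wprod: "w \<in> Weyl \<longleftrightarrow> (\<exists>js. set js \<subseteq> I \<and> w = wprod js)"
proof
  assume "w \<in> Weyl"
  then show "\<exists>js. set js \<subseteq> I \<and> w = wprod js"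
  proof induction
    case Weyl_id
    then show ?case by (intro exI[of _ "[]"]) simp
  next
    case (Weyl_step i w)
    then obtain js where "set js \<subseteq> I" "w = wprod js" by blast
    then show ?case using Weyl_step by (intro exI[of _ "i # js"]) simp
  qed
next
  have "set js \<subseteq> I \<Longrightarrow> wprod js \<in> Weyl" for js
    by (induction js) (auto simp: id_def[symmetric] intro: Weyl_id Weyl_step)
  then show "\<exists>js. set js \<subseteq> I \<and> w = wprod js \<Longrightarrow> w \<in> Weyl" by blast
qed

lemma wprod_in_Weyl: "set js \<subseteq> I \<Longrightarrow> wprod js \<in> Weyl"
  using Weyl_iff_wprod by blast

lemma simple_refl_in_Weyl: "i \<in> I \<Longrightarrow> simple_refl i \<in> Weyl"
  using wprod_in_Weyl[of "[i]"] by simp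

lemma Weyl_comp: "v \<in> Weyl \<Longrightarrow> w \<in> Weyl \<Longrightarrow> v \<circ> w \<in> Weyl"
  unfolding Weyl_iff_wprod by (metis Un_least set_append wprod_append)

lemma Weyl_linear: "w \<in> Weyl \<Longrightarrow> linear w"
  by (induction rule: Weyl.induct)
    (simp_all only: linear_id linear_compose linear_simple_refl)

lemmas Weyl_add = linear_add[OF Weyl_linear]
lemmas Weyl_diff = linear_diff[OF Weyl_linear]
lemmas Weyl_scale = linear_cmul[OF Weyl_linear]
lemmas Weyl_neg = linear_neg[OF Weyl_linear]
lemmas Weyl_zero = linear_0[OF Weyl_linear]
lemma wprod_rev: "set js \<subseteq> I \<Longrightarrow> wprod js \<circ> wprod (rev js) = id \<and> wprod (rev js) \<circ> wprod js = id"
proof (induction js)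
  case (Cons i js)
  then have IH: "wprod js (wprod (rev js) x) = x" "wprod (rev js) (wprod js x) = x" for x
    by (auto simp: fun_eq_iff)
  show ?case using Cons.prems
    by (auto simp: wprod_append fun_eq_iff IH simple_refl_involution)
qed simp

lemma inv_wprod: "set js \<subseteq> I \<Longrightarrow> inv (wprod js) = wprod (rev js)"
  using wprod_rev by (metis inv_unique_comp)

lemma bij_wprod: "set js \<subseteq> I \<Longrightarrow> bij (wprod js)"
  using wprod_rev o_bij by blast

lemma Weyl_bij: "w \<in> Weyl \<Longrightarrow> bij w"
  unfolding Weyl_iff_wprod using bij_wprod by blast

lemma Weyl_inv: "w \<in> Weyl \<Longrightarrow> inv w \<in> Weyl"
  unfolding Weyl_iff_wprod using inv_wprod by (metis set_rev)

lemma Weyl_inv_cancel [simp]: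
  "w \<in> Weyl \<Longrightarrow> w (inv w x) = x" "w \<in> Weyl \<Longrightarrow> inv w (w x) = x"
  "w \<in> Weyl \<Longrightarrow> inv (inv w) = w"
  by (simp_all add: Weyl_bij bij_is_surj surj_f_inv_f bij_is_inj inv_inv_eq)

lemma Weyl_comp_inv [simp]: "w \<in> Weyl \<Longrightarrow> w \<circ> inv w = id" "w \<in> Weyl \<Longrightarrow> inv w \<circ> w = id"
  by auto

lemma Weyl_inv_comp: "v \<in> Weyl \<Longrightarrow> w \<in> Weyl \<Longrightarrow> inv (v \<circ> w) = inv w \<circ> inv v"
  by (simp add: Weyl_bij o_inv_distrib)

lemma inv_simple_refl: "i \<in> I \<Longrightarrow> inv (simple_refl i) = simple_refl i"
  using inv_wprod[of "[i]"] by simp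

lemma Weyl_left_cancel: "v \<in> Weyl \<Longrightarrow> v \<circ> f = v \<circ> g \<Longrightarrow> f = g"
  by (metis Weyl_comp_inv(2) comp_assoc comp_id id_comp)

lemma Weyl_lattice: "w \<in> Weyl \<Longrightarrow> y \<in> Y \<Longrightarrow> w y \<in> Y"
proof (induction arbitrary: y rule: Weyl.induct)
  case (Weyl_step i w)
  have "simple_refl i z \<in> Y" if z: "z \<in> Y" for z
  proof -
    obtain n :: int where "\<alpha> i z = of_int n"
      using root_int[OF Weyl_step(1) z] by (auto elim: Ints_cases)
    then have "simple_refl i z = z + of_int (- n) *\<^sub>R \<alpha>v i"
      by (simp add: simple_refl_def)
    then show ?thesis
      using z coroots_in_Y[OF Weyl_step(1)] lattice_add lattice_scale by metis
  qed
  then show ?case using Weyl_step by simp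
qed simp

lemma Weyl_length_wprod: "Weyl_length w = (LEAST n. \<exists>js. set js \<subseteq> I \<and> length js = n \<and> w = wprod js)"
  by (simp add: Weyl_length_def wprod_def)

lemma Weyl_length_le: "set js \<subseteq> I \<Longrightarrow> Weyl_length (wprod js) \<le> length js"
  unfolding Weyl_length_wprod by (rule Least_le) blast

lemma reduced_word:
  assumes "w \<in> Weyl"
  obtains js where "set js \<subseteq> I" "length js = Weyl_length w" "w = wprod js"
proof -
  have "\<exists>n. \<exists>js. set js \<subseteq> I \<and> length js = n \<and> w = wprod js"
    using assms Weyl_iff_wprod by auto
  then have "\<exists>js. set js \<subseteq> I \<and> length js = Weyl_length w \<and> w = wprod js"
    unfolding Weyl_length_wprod by (rule LeastI_ex)
  then show ?thesis using that by blast
qed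

lemma Weyl_length_id [simp]: "Weyl_length id = 0"
  using Weyl_length_le[of "[]"] by simp

lemma Weyl_length_0: "w \<in> Weyl \<Longrightarrow> Weyl_length w = 0 \<Longrightarrow> w = id"
  by (metis length_0_conv reduced_word wprod_simps(1))

lemma Weyl_length_inv: "w \<in> Weyl \<Longrightarrow> Weyl_length (inv w) = Weyl_length w"
proof -
  have *: "Weyl_length (inv w) \<le> Weyl_length w" if w: "w \<in> Weyl" for w
  proof -
    obtain js where "set js \<subseteq> I" "length js = Weyl_length w" "w = wprod js"
      using reduced_word[OF w] .
    then show ?thesis using Weyl_length_le[of "rev js"] inv_wprod by simp
  qed
  assume "w \<in> Weyl"
  then show ?thesis using *[of w] *[of "inv w"] Weyl_inv by simp
qed

lemma Weyl_length_wprod_comp: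
  assumes "set us \<subseteq> I" "v \<in> Weyl"
  shows "Weyl_length (wprod us \<circ> v) \<le> length us + Weyl_length v"
proof -
  obtain js where "set js \<subseteq> I" "length js = Weyl_length v" "v = wprod js"
    using reduced_word[OF assms(2)] .
  then show ?thesis using Weyl_length_le[of "us @ js"] assms(1) by (simp add: wprod_append)
qed

lemma Weyl_length_step: "i \<in> I \<Longrightarrow> w \<in> Weyl \<Longrightarrow> Weyl_length (simple_refl i \<circ> w) \<le> Suc (Weyl_length w)"
  using Weyl_length_wprod_comp[of "[i]" w] by simp

lemma simple_refl_comp_cancel: "i \<in> I \<Longrightarrow> simple_refl i \<circ> (simple_refl i \<circ> w) = w"
  by (auto simp: simple_refl_involution)

lemma Weyl_length_step': "i \<in> I \<Longrightarrow> w \<in> Weyl \<Longrightarrow> Weyl_length w \<le> Suc (Weyl_length (simple_refl i \<circ> w))"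
  using Weyl_length_step[of i "simple_refl i \<circ> w"] by (simp add: simple_refl_comp_cancel Weyl.Weyl_step)

lemma first_letter:
  assumes "w \<in> Weyl" "Weyl_length w > 0"
  obtains i v where "i \<in> I" "v \<in> Weyl" "w = simple_refl i \<circ> v" "Weyl_length w = Suc (Weyl_length v)"
proof -
  obtain js where js: "set js \<subseteq> I" "length js = Weyl_length w" "w = wprod js"
    using reduced_word[OF assms(1)] .
  then obtain i ks where ks: "js = i # ks" using assms(2) by (cases js) auto
  have "Weyl_length (wprod ks) \<le> length ks"
    using js ks Weyl_length_le by simp
  moreover have "Weyl_length w \<le> Suc (Weyl_length (wprod ks))"
    using js ks Weyl_length_step wprod_in_Weyl by simp
  ultimately have "Weyl_length w = Suc (Weyl_length (wprod ks))"
    using js ks by simp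
  then show ?thesis using that[of i "wprod ks"] js ks wprod_in_Weyl by simp
qed

subsection \<open>Real roots are positive or negative\<close>

text \<open>Fundamental coweights, one index at a time. The functional \<open>\<phi>\<close> is
  \<open>\<alpha> k\<close> corrected to vanish on the earlier \<open>e j\<close>; it is a
  nontrivial combination of independent roots, hence nonzero somewhere.\<close>

lemma dual_vectors_subset:
  assumes "finite J" "J \<subseteq> I"
  shows "\<exists>e. \<forall>i\<in>J. \<forall>j\<in>J. \<alpha> i (e j) = (if i = j then 1 else 0)"
  using assms
proof (induction J rule: finite_induct)
  case (insert k J)
  then obtain e where e: "\<And>i j. i \<in> J \<Longrightarrow> j \<in> J \<Longrightarrow> \<alpha> i (e j) = (if i = j then 1 else 0)"
    by auto
  have k: "k \<in> I" and J: "J \<subseteq> I" using insert by auto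
  define \<phi> where "\<phi> x = \<alpha> k x - (\<Sum>j\<in>J. \<alpha> k (e j) * \<alpha> j x)" for x
  have "\<exists>z. \<phi> z \<noteq> 0"
  proof (rule ccontr)
    assume "\<not> ?thesis"
    then have \<phi>0: "\<And>x. \<phi> x = 0" by simp
    define c where "c i = (if i = k then 1 else if i \<in> J then - \<alpha> k (e i) else 0)" for i
    have "(\<Sum>i\<in>I. c i * \<alpha> i x) = 0" for x
    proof -
      have "(\<Sum>i\<in>I. c i * \<alpha> i x) = (\<Sum>i\<in>insert k J. c i * \<alpha> i x)"
        using finite_I insert.prems by (intro sum.mono_neutral_right) (auto simp: c_def)
      also have "\<dots> = \<alpha> k x + (\<Sum>i\<in>J. c i * \<alpha> i x)"
        using insert.hyps by (simp add: c_def)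
      also have "(\<Sum>i\<in>J. c i * \<alpha> i x) = (\<Sum>i\<in>J. - (\<alpha> k (e i) * \<alpha> i x))"
        using insert.hyps by (intro sum.cong) (auto simp: c_def)
      finally show ?thesis using \<phi>0[of x] by (simp add: \<phi>_def sum_negf)
    qed
    then have "c k = 0" using roots_independent[of c] k by blast
    then show False by (simp add: c_def)
  qed
  then obtain z where z: "\<phi> z \<noteq> 0" by blast
  define z' where "z' = z - (\<Sum>j\<in>J. \<alpha> j z *\<^sub>R e j)"
  have lin: "\<alpha> i z' = \<alpha> i z - (\<Sum>j\<in>J. \<alpha> j z * \<alpha> i (e j))" if "i \<in> I" for i
    using linear_root[OF that]
    by (simp add: z'_def linear_diff linear_sum linear_cmul)
  have z'J: "\<alpha> i z' = 0" if i: "i \<in> J" for i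
  proof -
    have "(\<Sum>j\<in>J. \<alpha> j z * \<alpha> i (e j)) = (\<Sum>j\<in>J. if i = j then \<alpha> j z else 0)"
      using e i by (intro sum.cong) auto
    then show ?thesis using lin[of i] i J insert.hyps by (auto simp: sum.delta)
  qed
  have z'k: "\<alpha> k z' = \<phi> z"
    using lin[OF k] by (simp add: \<phi>_def mult.commute)
  define ek where "ek = (1 / \<phi> z) *\<^sub>R z'"
  define e' where "e' j = (if j = k then ek else e j - \<alpha> k (e j) *\<^sub>R ek)" for j
  have ek: "\<alpha> k ek = 1" "\<And>i. i \<in> J \<Longrightarrow> \<alpha> i ek = 0"
    using z z'k z'J k J by (auto simp: ek_def simple_root_scale subset_iff)
  have "\<alpha> i (e' j) = (if i = j then 1 else 0)" if "i \<in> insert k J" "j \<in> insert k J" for i j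
  proof -
    have "i \<in> I" using that k J by auto
    then show ?thesis
      using that ek e insert.hyps
      by (auto simp: e'_def simple_root_diff simple_root_scale)
  qed
  then show ?case by blast
qed simp

text \<open>Independence is assumed for the family of coroots, so injectivity of
  \<open>\<alpha>v\<close> is extracted from it before the set of coroots is extended to a
  basis.\<close>

lemma functional_with_values:
  "\<exists>h. linear h \<and> (\<forall>i\<in>I. h (\<alpha>v i) = (g i :: real))"
proof -
  have inj: "inj_on \<alpha>v I"
  proof (rule inj_onI, rule ccontr)
    fix i j assume ij: "i \<in> I" "j \<in> I" "\<alpha>v i = \<alpha>v j" "i \<noteq> j"
    define c :: "'i \<Rightarrow> real" where "c k = (if k = i then 1 else if k = j then - 1 else 0)" for k
    have "(\<Sum>k\<in>I. c k *\<^sub>R \<alpha>v k) = (\<Sum>k\<in>{i, j}. c k *\<^sub>R \<alpha>v k)"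
      using finite_I ij by (intro sum.mono_neutral_right) (auto simp: c_def)
    also have "\<dots> = 0" using ij by (simp add: c_def)
    finally show False using coroots_independent[of c] ij by (auto simp: c_def split: if_splits)
  qed
  have "independent (\<alpha>v ` I)"
  proof
    assume "dependent (\<alpha>v ` I)"
    then obtain u where u: "\<exists>v\<in>\<alpha>v ` I. u v \<noteq> 0" "(\<Sum>v\<in>\<alpha>v ` I. u v *\<^sub>R v) = 0"
      using dependent_finite[of "\<alpha>v ` I"] finite_I by auto
    then have "(\<Sum>i\<in>I. u (\<alpha>v i) *\<^sub>R \<alpha>v i) = 0"
      by (simp add: sum.reindex[OF inj])
    then show False using coroots_independent[of "\<lambda>i. u (\<alpha>v i)"] u(1) by auto
  qed
  then obtain h where "linear h" "\<And>v. v \<in> \<alpha>v ` I \<Longrightarrow> h v = g (inv_into I \<alpha>v v)"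
    using linear_independent_extend[of "\<alpha>v ` I" "\<lambda>v. g (inv_into I \<alpha>v v)"] by blast
  then show ?thesis using inj by (intro exI[of _ h]) auto
qed

text \<open>Being a root is left out on purpose: the rank two computations produce natural
  combinations of simple roots before anything is known about signs of roots.\<close>

definition posf :: "('a \<Rightarrow> real) \<Rightarrow> bool" where
  "posf f \<longleftrightarrow> (\<exists>c :: 'i \<Rightarrow> nat. f = (\<lambda>x. \<Sum>i\<in>I. of_nat (c i) * \<alpha> i x))"

lemma posf_add:
  assumes "posf f" "posf g"
  shows "posf (\<lambda>x. of_nat p * f x + of_nat q * g x)"
proof -
  obtain c d :: "'i \<Rightarrow> nat" where
    "f = (\<lambda>x. \<Sum>i\<in>I. of_nat (c i) * \<alpha> i x)" "g = (\<lambda>x. \<Sum>i\<in>I. of_nat (d i) * \<alpha> i x)"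
    using assms unfolding posf_def by blast
  then show ?thesis unfolding posf_def
    by (intro exI[of _ "\<lambda>i. p * c i + q * d i"])
      (simp add: sum.distrib sum_distrib_left algebra_simps)
qed

lemma posf_simple:
  assumes "i \<in> I"
  shows "posf (\<alpha> i)"
  unfolding posf_def
proof (intro exI ext)
  fix x
  have "(\<Sum>j\<in>I. of_nat (if j = i then 1 else 0) * \<alpha> j x) = (\<Sum>j\<in>I. if j = i then \<alpha> j x else 0)"
    by (intro sum.cong) auto
  then show "\<alpha> i x = (\<Sum>j\<in>I. of_nat (if j = i then 1 else 0) * \<alpha> j x)"
    using assms finite_I by simp
qed

section \<open>Alternating words in two simple reflections\<close>

primrec alternating :: "nat \<Rightarrow> 'i \<Rightarrow> 'i \<Rightarrow> 'i list" where
  "alternating 0 i j = []"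
| "alternating (Suc n) i j = j # alternating n j i"

lemma length_alternating [simp]: "length (alternating n i j) = n"
  by (induction n arbitrary: i j) auto

lemma set_alternating: "set (alternating n i j) \<subseteq> {i, j}"
  by (induction n arbitrary: i j) auto

lemma take_alternating: "m \<le> n \<Longrightarrow> take m (alternating n i j) = alternating m i j"
proof (induction m arbitrary: n i j)
  case (Suc m)
  then show ?case by (cases n) auto
qed simp

lemma alternating_snoc:
  "alternating (Suc n) i j = alternating n i j @ [if even n then j else i]"
  by (induction n arbitrary: i j) auto

lemma simple_root_refl:
  "k \<in> I \<Longrightarrow> l \<in> I \<Longrightarrow> \<alpha> k (simple_refl l y) = \<alpha> k y - of_int (A l k) * \<alpha> l y"
  unfolding simple_refl_def
  by (simp add: simple_root_diff simple_root_scale pairing mult.commute)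

lemma cartan_nonpos: "i \<in> I \<Longrightarrow> j \<in> I \<Longrightarrow> i \<noteq> j \<Longrightarrow> A i j \<le> 0"
  and cartan_zero: "i \<in> I \<Longrightarrow> j \<in> I \<Longrightarrow> A i j = 0 \<longleftrightarrow> A j i = 0"
  and cartan_diag: "i \<in> I \<Longrightarrow> A i i = 2"
  using cartan by (simp_all add: generalized_cartan_matrix_def)

text \<open>The hypothesis on \<open>(p, q)\<close> says that \<open>s\<^sub>j\<close> at least preserves the coefficient of \<open>\<alpha>\<^sub>j\<close> in
  \<open>p \<alpha>\<^sub>i + q \<alpha>\<^sub>j\<close>; it is inherited, with \<open>i\<close> and \<open>j\<close> exchanged.\<close>

lemma rank_two_infinite:
  assumes "i \<in> I" "j \<in> I" "i \<noteq> j" "A i j * A j i \<ge> 4" "2 * q \<le> nat (- A j i) * p"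
  shows "\<exists>p' q' :: nat. \<forall>x. of_nat p * \<alpha> i (wprod (alternating n i j) x) +
    of_nat q * \<alpha> j (wprod (alternating n i j) x) = of_nat p' * \<alpha> i x + of_nat q' * \<alpha> j x"
  using assms
proof (induction n arbitrary: i j p q)
  case 0
  then show ?case by auto
next
  case (Suc n)
  define a b where "a = nat (- A i j)" and "b = nat (- A j i)"
  have A: "A i j = - int a" "A j i = - int b"
    using cartan_nonpos[of i j] cartan_nonpos[of j i] Suc.prems by (auto simp: a_def b_def)
  have ab: "a * b \<ge> 4"
    using Suc.prems(4) by (simp add: A flip: of_nat_mult)
  have q: "2 * q \<le> b * p" using Suc.prems(5) by (simp add: b_def)
  define r where "r = b * p - q"
  have r: "b * p = r + q" using q by (simp add: r_def)
  have "4 * p \<le> (a * b) * p" using ab by (rule mult_right_mono) simp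
  also have "\<dots> = a * (r + q)" by (simp flip: r)
  also have "\<dots> \<le> a * (2 * r)" using q r by (intro mult_left_mono) auto
  finally have "2 * p \<le> nat (- A i j) * r" by (simp add: a_def mult.commute)
  then obtain p' q' :: nat where IH: "\<And>x. of_nat r * \<alpha> j (wprod (alternating n j i) x) +
    of_nat p * \<alpha> i (wprod (alternating n j i) x) = of_nat p' * \<alpha> j x + of_nat q' * \<alpha> i x"
    using Suc.IH[of j i p r] Suc.prems by (auto simp: mult.commute)
  have br: "real b * real p = real r + real q"
    using r by (metis of_nat_add of_nat_mult)
  have "of_nat p * \<alpha> i (simple_refl j y) + of_nat q * \<alpha> j (simple_refl j y) =
      of_nat r * \<alpha> j y + of_nat p * \<alpha> i y" for y
    using Suc.prems br
    by (simp add: simple_root_refl A cartan_diag algebra_simps) (metis distrib_left mult.commute mult.left_commute)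
  then show ?case
    by (intro exI[of _ q'] exI[of _ p']) (simp add: IH)
qed

text \<open>The product of the two entries is at most 3, which leaves the types A1 x A1, A2, B2 and
  G2 with \<open>m\<close> = 2, 3, 4, 6. The witness lists are the coefficients of the successive
  functionals. The words start with \<open>j\<close>, since a leading \<open>i\<close> would make
  \<alpha>_i negative at once.\<close>

lemma rank_two_finite:
  assumes ij: "i \<in> I" "j \<in> I" "i \<noteq> j" and small: "A i j * A j i < 4"
  shows "\<exists>m>0. wprod (alternating m i j) = wprod (alternating m j i) \<and>
    (\<forall>n<m. \<exists>p q :: nat. \<forall>x. \<alpha> i (wprod (alternating n i j) x) = of_nat p * \<alpha> i x + of_nat q * \<alpha> j x)"
proof -
  define a b where "a = nat (- A i j)" and "b = nat (- A j i)"
  have A: "A i j = - int a" "A j i = - int b"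
    using cartan_nonpos[of i j] cartan_nonpos[of j i] ij by (auto simp: a_def b_def)
  have ab: "a * b < 4" using small A by (simp flip: of_nat_mult)
  have zero: "a = 0 \<longleftrightarrow> b = 0" using cartan_zero[of i j] ij A by simp
  have root: "\<alpha> i (simple_refl i y) = - \<alpha> i y" "\<alpha> j (simple_refl j y) = - \<alpha> j y"
    "\<alpha> i (simple_refl j y) = \<alpha> i y + of_nat b * \<alpha> j y"
    "\<alpha> j (simple_refl i y) = \<alpha> j y + of_nat a * \<alpha> i y" for y
    using ij by (simp_all add: simple_root_refl A cartan_diag)
  have collect: "y + u *\<^sub>R v + z - c *\<^sub>R v = y + (u - c) *\<^sub>R v + z"
    "y + z + u *\<^sub>R v - c *\<^sub>R v = y + z + (u - c) *\<^sub>R v" for y z v :: 'a and u c :: real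
    by (simp_all add: scaleR_left_diff_distrib)
  have "\<alpha> i (y + u *\<^sub>R \<alpha>v i + v *\<^sub>R \<alpha>v j) = \<alpha> i y + 2 * u - of_nat b * v"
    "\<alpha> j (y + u *\<^sub>R \<alpha>v i + v *\<^sub>R \<alpha>v j) = \<alpha> j y + 2 * v - of_nat a * u" for y u v
    using ij by (simp_all add: simple_root_add simple_root_scale
        pairing A cartan_diag)
  \<comment> \<open>Keeping vectors in the form \<open>y\<close> plus multiples of the two coroots
    turns each braid relation into an identity between two pairs of coefficients.\<close>
  then have step: "simple_refl i (y + u *\<^sub>R \<alpha>v i + v *\<^sub>R \<alpha>v j) =
      y + (of_nat b * v - u - \<alpha> i y) *\<^sub>R \<alpha>v i + v *\<^sub>R \<alpha>v j"
    "simple_refl j (y + u *\<^sub>R \<alpha>v i + v *\<^sub>R \<alpha>v j) =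
      y + u *\<^sub>R \<alpha>v i + (of_nat a * u - v - \<alpha> j y) *\<^sub>R \<alpha>v j" for y u v
    by (simp_all add: simple_refl_def collect)
  have coeffs: "y + u *\<^sub>R \<alpha>v i + v *\<^sub>R \<alpha>v j = y + u' *\<^sub>R \<alpha>v i + v' *\<^sub>R \<alpha>v j"
    if "u = u'" "v = v'" for y u v u' v'
    using that by simp
  have braid: "wprod us y = wprod vs y"
    if "\<And>u v. wprod us (y + u *\<^sub>R \<alpha>v i + v *\<^sub>R \<alpha>v j) = wprod vs (y + u *\<^sub>R \<alpha>v i + v *\<^sub>R \<alpha>v j)"
    for us vs y
    using that[of 0 0] by simp
  have num: "2 = Suc (Suc 0)" "3 = Suc (Suc (Suc 0))" "4 = Suc (Suc (Suc (Suc 0)))"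
    "6 = Suc (Suc (Suc (Suc (Suc (Suc 0)))))"
    by simp_all
  have "a \<le> 3 \<and> b \<le> 3"
  proof (cases "a = 0 \<or> b = 0")
    case False
    then have "a * 1 \<le> a * b" "1 * b \<le> a * b" by (auto intro: mult_le_mono)
    then show ?thesis using ab by linarith
  qed (use zero in auto)
  then have "a \<in> {0, 1, 2, 3}" "b \<in> {0, 1, 2, 3}" by auto
  then consider "a = 0" "b = 0" | "a = 1" "b = 1" | "a = 1" "b = 2" | "a = 2" "b = 1"
    | "a = 1" "b = 3" | "a = 3" "b = 1"
    using ab zero by auto
  then consider (m2) "a = 0" "b = 0" | (m3) "a = 1" "b = 1"
    | (m4) "a = 1 \<and> b = 2 \<or> a = 2 \<and> b = 1" | (m6) "a = 1 \<and> b = 3 \<or> a = 3 \<and> b = 1"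
    by cases auto
  then show ?thesis
  proof cases
    case m2
    have "wprod (alternating 2 i j) y = wprod (alternating 2 j i) y" for y
      by (rule braid, simp only: num alternating.simps wprod_simps o_apply id_apply)
        (simp only: step m2, simp)
    moreover have "\<exists>p q :: nat. \<forall>x. \<alpha> i (wprod (alternating n i j) x) = of_nat p * \<alpha> i x + of_nat q * \<alpha> j x"
      if "n < 2" for n
    proof -
      have "n = 0 \<or> n = 1" using that by auto
      then show ?thesis by (intro exI[of _ 1] exI[of _ 0]) (auto simp: root m2)
    qed
    ultimately show ?thesis by (intro exI[of _ 2]) auto
  next
    case m3
    have "wprod (alternating 3 i j) y = wprod (alternating 3 j i) y" for y
      by (rule braid, simp only: num alternating.simps wprod_simps o_apply id_apply)
        (simp only: step m3, simp)
    moreover have "\<exists>p q :: nat. \<forall>x. \<alpha> i (wprod (alternating n i j) x) = of_nat p * \<alpha> i x + of_nat q * \<alpha> j x"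
      if "n < 3" for n
    proof -
      have "n = 0 \<or> n = 1 \<or> n = 2" using that by auto
      then show ?thesis
        by (intro exI[of _ "[1,1,0] ! n"] exI[of _ "[0,1,1] ! n"])
          (auto simp: root m3 eval_nat_numeral)
    qed
    ultimately show ?thesis by (intro exI[of _ 3]) auto
  next
    case m4
    have "wprod (alternating 4 i j) y = wprod (alternating 4 j i) y" for y
      by (rule braid, simp only: num alternating.simps wprod_simps o_apply id_apply)
        (simp only: step, rule coeffs; use m4 in \<open>auto simp: algebra_simps\<close>)
    moreover have "\<exists>p q :: nat. \<forall>x. \<alpha> i (wprod (alternating n i j) x) = of_nat p * \<alpha> i x + of_nat q * \<alpha> j x"
      if "n < 4" for n
    proof -
      have "n = 0 \<or> n = 1 \<or> n = 2 \<or> n = 3" using that by auto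
      then show ?thesis using m4
        by (intro exI[of _ "[1,1,1,1] ! n"] exI[of _ "[0,b,b,0] ! n"])
          (auto simp: root eval_nat_numeral)
    qed
    ultimately show ?thesis by (intro exI[of _ 4]) auto
  next
    case m6
    have "wprod (alternating 6 i j) y = wprod (alternating 6 j i) y" for y
      by (rule braid, simp only: num alternating.simps wprod_simps o_apply id_apply)
        (simp only: step, rule coeffs; use m6 in \<open>auto simp: algebra_simps\<close>)
    moreover have "\<exists>p q :: nat. \<forall>x. \<alpha> i (wprod (alternating n i j) x) = of_nat p * \<alpha> i x + of_nat q * \<alpha> j x"
      if "n < 6" for n
    proof -
      have "n = 0 \<or> n = 1 \<or> n = 2 \<or> n = 3 \<or> n = 4 \<or> n = 5" using that by auto
      then show ?thesis using m6
        by (intro exI[of _ "[1,1,2,2,1,1] ! n"] exI[of _ "[0,b,b,b,b,0] ! n"])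
          (auto simp: root eval_nat_numeral)
    qed
    ultimately show ?thesis by (intro exI[of _ 6]) auto
  qed
qed

text \<open>Write \<open>u\<close> as an alternating word in \<open>s\<^sub>i, s\<^sub>j\<close> starting with \<open>s\<^sub>j\<close>, times a rest \<open>v\<close>, with additive
  lengths and the word as long as possible. By induction \<open>v\<close> makes \<open>\<alpha>\<^sub>i\<close> and \<open>\<alpha>\<^sub>j\<close> positive, and
  the length assumption excludes words at least as long as the braid relation.\<close>

lemma posf_comp_if_length_le:
  assumes "u \<in> Weyl" "i \<in> I" "Weyl_length u \<le> Weyl_length (simple_refl i \<circ> u)"
  shows "posf (\<alpha> i \<circ> u)"
  using assms
proof (induction "Weyl_length u" arbitrary: u i rule: less_induct)
  case less
  note u = less.prems(1) and i = less.prems(2) and ui = less.prems(3)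
  show ?case
  proof (cases "Weyl_length u = 0")
    case True
    then show ?thesis using Weyl_length_0[OF u] posf_simple[OF i] by simp
  next
    case False
    then obtain j v0 where j: "j \<in> I" and v0: "v0 \<in> Weyl" "u = simple_refl j \<circ> v0"
      "Weyl_length u = Suc (Weyl_length v0)"
      using first_letter[OF u] by blast
    have ij: "i \<noteq> j"
    proof
      assume "i = j"
      then have "simple_refl i \<circ> u = v0" using v0 i simple_refl_comp_cancel by simp
      then show False using ui v0(3) by simp
    qed
    define P where "P n \<longleftrightarrow> (\<exists>v\<in>Weyl. u = wprod (alternating n i j) \<circ> v \<and> Weyl_length u = n + Weyl_length v)" for n
    have P1: "P 1" unfolding P_def using v0 by (intro bexI[of _ v0]) auto
    have Pb: "\<And>n. P n \<Longrightarrow> n \<le> Weyl_length u" unfolding P_def by auto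
    define n where "n = (GREATEST n. P n)"
    have Pn: "P n" and n_max: "\<And>k. P k \<Longrightarrow> k \<le> n"
      unfolding n_def using P1 Pb by (blast intro: GreatestI_nat Greatest_le_nat)+
    have "n \<ge> 1" using n_max P1 by blast
    then obtain m where nm: "n = Suc m" by (cases n) auto
    obtain v where v: "v \<in> Weyl" "u = wprod (alternating n i j) \<circ> v" "Weyl_length u = n + Weyl_length v"
      using Pn unfolding P_def by blast
    have setI: "set (alternating k i j) \<subseteq> I" "set (alternating k j i) \<subseteq> I" for k
      using set_alternating[of k i j] set_alternating[of k j i] i j by auto
    \<comment> \<open>These are the two letters in some order, since \<open>n\<close> and
      \<open>m\<close> differ in parity. Prolonging the word by \<open>?next\<close> is excluded by
      maximality; moving \<open>?last\<close> back into \<open>v\<close> cannot make it shorter than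
      \<open>v\<close>.\<close>
    let ?next = "if even n then j else i" and ?last = "if even m then j else i"
    have "Weyl_length v \<le> Weyl_length (simple_refl ?next \<circ> v)"
    proof (rule ccontr)
      assume less: "\<not> ?thesis"
      have I': "?next \<in> I" using i j by simp
      have "u = wprod (alternating (Suc n) i j) \<circ> (simple_refl ?next \<circ> v)"
        unfolding alternating_snoc wprod_append v(2)
        using simple_refl_comp_cancel[OF I', of v] by (simp add: comp_assoc)
      moreover have "Weyl_length v = Suc (Weyl_length (simple_refl ?next \<circ> v))"
        using less Weyl_length_step'[OF I' v(1)] by linarith
      ultimately have "P (Suc n)" unfolding P_def
        using v I' by (intro bexI[of _ "simple_refl ?next \<circ> v"]) (auto intro: Weyl.Weyl_step)
      then show False using n_max by fastforce
    qed
    moreover have "Weyl_length v \<le> Weyl_length (simple_refl ?last \<circ> v)"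
    proof -
      have I': "?last \<in> I" using i j by simp
      have "u = wprod (alternating m i j) \<circ> (simple_refl ?last \<circ> v)"
        unfolding v(2) nm alternating_snoc wprod_append by (simp add: comp_assoc)
      then have "Weyl_length u \<le> m + Weyl_length (simple_refl ?last \<circ> v)"
        using Weyl_length_wprod_comp[OF setI(1)[of m], of "simple_refl ?last \<circ> v"] v(1) I'
        by (simp add: Weyl.Weyl_step)
      then show ?thesis using v(3) nm by linarith
    qed
    ultimately have both: "Weyl_length v \<le> Weyl_length (simple_refl i \<circ> v)"
      "Weyl_length v \<le> Weyl_length (simple_refl j \<circ> v)"
      using nm by (auto split: if_splits)
    have lt: "Weyl_length v < Weyl_length u" using v(3) nm by simp
    have pos: "posf (\<alpha> i \<circ> v)" "posf (\<alpha> j \<circ> v)"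
      using less.hyps[OF lt v(1)] both i j by auto
    have "\<exists>p q :: nat. \<forall>x. \<alpha> i (wprod (alternating n i j) x) = of_nat p * \<alpha> i x + of_nat q * \<alpha> j x"
    proof (cases "A i j * A j i \<ge> 4")
      case True
      then show ?thesis
        using rank_two_infinite[OF i j ij True, of 0 1 n] by simp
    next
      case False
      then obtain m' where m': "m' > 0" "wprod (alternating m' i j) = wprod (alternating m' j i)"
        "\<And>k. k < m' \<Longrightarrow> \<exists>p q :: nat. \<forall>x. \<alpha> i (wprod (alternating k i j) x) = of_nat p * \<alpha> i x + of_nat q * \<alpha> j x"
        using rank_two_finite[OF i j ij] by auto
      \<comment> \<open>Otherwise the braid relation rewrites the word so that it begins with
        \<open>i\<close>, and then s_i cancels a letter of \<open>u\<close>, against the length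
        hypothesis.\<close>
      have "n < m'"
      proof (rule ccontr)
        assume "\<not> n < m'"
        then have mn: "m' \<le> n" by simp
        obtain k where k: "m' = Suc k" using m'(1) by (cases m') auto
        let ?rest = "drop m' (alternating n i j)"
        have "alternating n i j = alternating m' i j @ ?rest"
          using take_alternating[OF mn, of i j] by (metis append_take_drop_id)
        then have "u = wprod (alternating m' j i) \<circ> wprod ?rest \<circ> v"
          using v(2) m'(2) by (metis wprod_append)
        then have "simple_refl i \<circ> u = (simple_refl i \<circ> (simple_refl i \<circ> wprod (alternating k i j))) \<circ> wprod ?rest \<circ> v"
          by (simp add: k comp_assoc)
        then have "simple_refl i \<circ> u = wprod (alternating k i j @ ?rest) \<circ> v"
          by (simp add: simple_refl_comp_cancel[OF i] wprod_append comp_assoc)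
        moreover have "set (alternating k i j @ ?rest) \<subseteq> I"
          using setI(1)[of k] setI(1)[of n] set_drop_subset by fastforce
        ultimately have "Weyl_length (simple_refl i \<circ> u) \<le> k + (n - m') + Weyl_length v"
          using Weyl_length_wprod_comp[of "alternating k i j @ ?rest" v] v(1) by simp
        then show False using ui v(3) k mn by linarith
      qed
      then show ?thesis using m'(3) by blast
    qed
    then obtain p q :: nat where pq: "\<And>x. \<alpha> i (wprod (alternating n i j) x) = of_nat p * \<alpha> i x + of_nat q * \<alpha> j x"
      by blast
    have "\<alpha> i \<circ> u = (\<lambda>x. of_nat p * (\<alpha> i \<circ> v) x + of_nat q * (\<alpha> j \<circ> v) x)"
      unfolding v(2) by (simp add: fun_eq_iff pq)
    then show ?thesis using posf_add[OF pos] by simp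
  qed
qed

subsection \<open>Roots, coroots and the exchange condition\<close>

lemma real_roots_iff: "\<beta> \<in> real_roots \<longleftrightarrow> (\<exists>u\<in>Weyl. \<exists>i\<in>I. \<beta> = \<alpha> i \<circ> u)"
proof
  assume "\<beta> \<in> real_roots"
  then obtain w i where "w \<in> Weyl" "i \<in> I" "\<beta> = \<alpha> i \<circ> inv w"
    unfolding real_roots_def dual_act_def by blast
  then show "\<exists>u\<in>Weyl. \<exists>i\<in>I. \<beta> = \<alpha> i \<circ> u" using Weyl_inv by blast
next
  assume "\<exists>u\<in>Weyl. \<exists>i\<in>I. \<beta> = \<alpha> i \<circ> u"
  then obtain u i where u: "u \<in> Weyl" "i \<in> I" "\<beta> = \<alpha> i \<circ> u" by blast
  then have "\<beta> = dual_act (inv u) (\<alpha> i)" by (simp add: dual_act_def)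
  then show "\<beta> \<in> real_roots" unfolding real_roots_def using u Weyl_inv by blast
qed

lemma simple_in_real_roots: "i \<in> I \<Longrightarrow> \<alpha> i \<in> real_roots"
  unfolding real_roots_iff by (metis Weyl_id comp_id)

lemma root_comp: "\<beta> \<in> real_roots \<Longrightarrow> w \<in> Weyl \<Longrightarrow> \<beta> \<circ> w \<in> real_roots"
  unfolding real_roots_iff by (force simp: comp_assoc intro: Weyl_comp)

lemma real_root_linear: "\<beta> \<in> real_roots \<Longrightarrow> linear \<beta>"
  unfolding real_roots_iff by (auto intro: linear_compose Weyl_linear linear_root)

lemmas real_root_add = linear_add[OF real_root_linear]
lemmas real_root_diff = linear_diff[OF real_root_linear]
lemmas real_root_scale = linear_cmul[OF real_root_linear]
lemmas real_root_neg = linear_neg[OF real_root_linear]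
lemmas real_root_zero = linear_0[OF real_root_linear]
lemma real_root_int: "\<beta> \<in> real_roots \<Longrightarrow> y \<in> Y \<Longrightarrow> \<beta> y \<in> \<int>"
  unfolding real_roots_iff by (metis comp_apply root_int Weyl_lattice)

lemma simple_root_refl_self: "i \<in> I \<Longrightarrow> \<alpha> i (simple_refl i y) = - \<alpha> i y"
  by (simp add: simple_root_refl cartan_diag)

lemma root_uminus: "\<beta> \<in> real_roots \<Longrightarrow> (\<lambda>x. - \<beta> x) \<in> real_roots"
proof -
  assume "\<beta> \<in> real_roots"
  then obtain u i where u: "u \<in> Weyl" "i \<in> I" "\<beta> = \<alpha> i \<circ> u" unfolding real_roots_iff by blast
  then have "(\<lambda>x. - \<beta> x) = \<alpha> i \<circ> (simple_refl i \<circ> u)"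
    by (auto simp: simple_root_refl_self)
  then show ?thesis unfolding real_roots_iff using u Weyl.Weyl_step by blast
qed

text \<open>If \<open>u\<close> is longer than s_i u, the length criterion applies to s_i u instead,
  where the root appears with the opposite sign.\<close>

lemma posf_or_posf_uminus: "\<beta> \<in> real_roots \<Longrightarrow> posf \<beta> \<or> posf (\<lambda>x. - \<beta> x)"
proof -
  assume "\<beta> \<in> real_roots"
  then obtain u i where u: "u \<in> Weyl" "i \<in> I" "\<beta> = \<alpha> i \<circ> u" unfolding real_roots_iff by blast
  let ?v = "simple_refl i \<circ> u"
  show ?thesis
  proof (cases "Weyl_length u \<le> Weyl_length ?v")
    case True
    then show ?thesis using posf_comp_if_length_le u by simp
  next
    case False
    then have "posf (\<alpha> i \<circ> ?v)"
      using u simple_refl_comp_cancel[of i u] by (intro posf_comp_if_length_le Weyl.Weyl_step) auto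
    moreover have "\<alpha> i \<circ> ?v = (\<lambda>x. - \<beta> x)" using u by (auto simp: simple_root_refl_self)
    ultimately show ?thesis by simp
  qed
qed

lemma pos_roots_iff: "\<beta> \<in> pos_roots \<longleftrightarrow> \<beta> \<in> real_roots \<and> posf \<beta>"
  unfolding pos_roots_def posf_def by simp

lemma neg_roots_iff: "\<beta> \<in> neg_roots \<longleftrightarrow> (\<lambda>x. - \<beta> x) \<in> pos_roots"
proof -
  have "\<beta> = (\<lambda>x. - g x) \<longleftrightarrow> (\<lambda>x. - \<beta> x) = g" for g :: "'a \<Rightarrow> real"
    by (auto simp: fun_eq_iff) (metis minus_minus)
  moreover have "(\<lambda>x. - \<beta> x) \<in> real_roots \<longleftrightarrow> \<beta> \<in> real_roots"
    using root_uminus[of \<beta>] root_uminus[of "\<lambda>x. - \<beta> x"] by auto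
  ultimately show ?thesis unfolding neg_roots_def pos_roots_iff posf_def by simp
qed

definition dominant :: "'a set" where
  "dominant = {x. \<forall>i\<in>I. \<alpha> i x \<ge> 0}"

lemma fund_chamber_dominant: "x \<in> fund_chamber \<Longrightarrow> x \<in> dominant"
  unfolding fund_chamber_def dominant_def by (auto intro: less_imp_le)

lemma posf_nonneg: "posf f \<Longrightarrow> x \<in> dominant \<Longrightarrow> f x \<ge> 0"
  unfolding posf_def dominant_def by (auto intro!: sum_nonneg)

lemma fund_chamber_nonempty: "\<exists>x. x \<in> fund_chamber"
proof -
  obtain e where e: "\<And>i j. i \<in> I \<Longrightarrow> j \<in> I \<Longrightarrow> \<alpha> i (e j) = (if i = j then 1 else 0)"
    using dual_vectors_subset[OF finite_I subset_refl] by blast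
  have "\<alpha> i (\<Sum>j\<in>I. e j) = 1" if "i \<in> I" for i
    using that e finite_I by (simp add: linear_sum[OF linear_root])
  then have "(\<Sum>j\<in>I. e j) \<in> fund_chamber" unfolding fund_chamber_def by simp
  then show ?thesis by blast
qed

lemma root_nonzero: "\<beta> \<in> real_roots \<Longrightarrow> \<exists>x. \<beta> x \<noteq> 0"
proof -
  assume "\<beta> \<in> real_roots"
  then obtain u i where u: "u \<in> Weyl" "i \<in> I" "\<beta> = \<alpha> i \<circ> u" unfolding real_roots_iff by blast
  then have "\<beta> (inv u (\<alpha>v i)) = 2" using root_diag by simp
  then show ?thesis by (metis zero_neq_numeral)
qed

lemma pos_root_fund_chamber:
  assumes "\<beta> \<in> pos_roots" "x \<in> fund_chamber"
  shows "\<beta> x > 0"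
proof -
  obtain c :: "'i \<Rightarrow> nat" where c: "\<beta> = (\<lambda>x. \<Sum>i\<in>I. of_nat (c i) * \<alpha> i x)"
    using assms(1) unfolding pos_roots_iff posf_def by blast
  have "\<exists>i\<in>I. c i \<noteq> 0"
  proof (rule ccontr)
    assume "\<not> ?thesis"
    then have "\<beta> y = 0" for y unfolding c by simp
    then show False using root_nonzero assms(1) unfolding pos_roots_iff by blast
  qed
  then obtain i where i: "i \<in> I" "c i \<noteq> 0" by blast
  have "\<And>j. j \<in> I \<Longrightarrow> of_nat (c j) * \<alpha> j x \<ge> 0" "of_nat (c i) * \<alpha> i x > 0"
    using assms(2) i unfolding fund_chamber_def by (auto intro: less_imp_le)
  then show ?thesis unfolding c using i finite_I by (intro sum_pos2) auto
qed

lemma neg_root_fund_chamber: "\<beta> \<in> neg_roots \<Longrightarrow> x \<in> fund_chamber \<Longrightarrow> \<beta> x < 0"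
  using pos_root_fund_chamber[of "\<lambda>x. - \<beta> x" x] unfolding neg_roots_iff by simp

lemma pos_root_dominant: "\<beta> \<in> pos_roots \<Longrightarrow> x \<in> dominant \<Longrightarrow> \<beta> x \<ge> 0"
  using posf_nonneg unfolding pos_roots_iff by blast

lemma neg_root_dominant: "\<beta> \<in> neg_roots \<Longrightarrow> x \<in> dominant \<Longrightarrow> \<beta> x \<le> 0"
  using pos_root_dominant[of "\<lambda>x. - \<beta> x" x] unfolding neg_roots_iff by simp

lemma root_pos_or_neg: "\<beta> \<in> real_roots \<Longrightarrow> \<beta> \<in> pos_roots \<or> \<beta> \<in> neg_roots"
  using posf_or_posf_uminus root_uminus unfolding neg_roots_iff pos_roots_iff by blast

lemma pos_root_iff_fund_chamber:
  "\<beta> \<in> real_roots \<Longrightarrow> x \<in> fund_chamber \<Longrightarrow> \<beta> \<in> pos_roots \<longleftrightarrow> \<beta> x > 0"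
  using root_pos_or_neg[of \<beta>] pos_root_fund_chamber[of \<beta> x] neg_root_fund_chamber[of \<beta> x] by auto

lemma neg_root_iff_fund_chamber:
  "\<beta> \<in> real_roots \<Longrightarrow> x \<in> fund_chamber \<Longrightarrow> \<beta> \<in> neg_roots \<longleftrightarrow> \<beta> x < 0"
  using root_pos_or_neg[of \<beta>] pos_root_fund_chamber[of \<beta> x] neg_root_fund_chamber[of \<beta> x] by auto

lemma root_fund_chamber_nonzero: "\<beta> \<in> real_roots \<Longrightarrow> x \<in> fund_chamber \<Longrightarrow> \<beta> x \<noteq> 0"
  using root_pos_or_neg[of \<beta>] pos_root_fund_chamber[of \<beta> x] neg_root_fund_chamber[of \<beta> x] by auto

lemma pos_root_is_root: "\<beta> \<in> pos_roots \<Longrightarrow> \<beta> \<in> real_roots"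
  by (simp add: pos_roots_iff)

lemma simple_in_pos_roots: "i \<in> I \<Longrightarrow> \<alpha> i \<in> pos_roots"
  using simple_in_real_roots posf_simple by (simp add: pos_roots_iff)

text \<open>The root system is reduced. Write \<beta> as \<alpha>_j composed with \<open>u\<close>.
  The root \<open>\<alpha> i \<circ> inv u\<close> is an integral combination of simple roots, so it
  has an integer value \<open>z\<close> at the coweight \<open>e j\<close>; evaluating \<beta> at
  \<open>inv u (e j)\<close> gives \<open>c * z = 1\<close>.\<close>

lemma pos_root_multiple_of_simple:
  assumes \<beta>: "\<beta> \<in> real_roots" and i: "i \<in> I" and c: "\<beta> = (\<lambda>x. of_nat c * \<alpha> i x)"
  shows "\<beta> = \<alpha> i"
proof -
  obtain u j where u: "u \<in> Weyl" "j \<in> I" "\<beta> = \<alpha> j \<circ> u" using \<beta> unfolding real_roots_iff by blast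
  obtain e where e: "\<And>i j. i \<in> I \<Longrightarrow> j \<in> I \<Longrightarrow> \<alpha> i (e j) = (if i = j then 1 else 0)"
    using dual_vectors_subset[OF finite_I subset_refl] by blast
  have int: "f (e j) \<in> \<int>" if f: "posf f" for f
  proof -
    obtain d :: "'i \<Rightarrow> nat" where "f = (\<lambda>x. \<Sum>k\<in>I. of_nat (d k) * \<alpha> k x)"
      using f unfolding posf_def by blast
    then have "f (e j) = (\<Sum>k\<in>I. if k = j then of_nat (d k) else 0)"
      using e u(2) by (auto intro!: sum.cong)
    then show ?thesis using u(2) finite_I by simp
  qed
  have "\<alpha> i \<circ> inv u \<in> real_roots"
    using simple_in_real_roots[OF i] root_comp Weyl_inv[OF u(1)] by blast
  then have "(\<alpha> i \<circ> inv u) (e j) \<in> \<int>"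
    using posf_or_posf_uminus int by (metis Ints_minus minus_minus)
  then obtain z :: int where z: "\<alpha> i (inv u (e j)) = of_int z" by (auto elim: Ints_cases)
  have "1 = \<beta> (inv u (e j))" using u e by simp
  also have "\<dots> = of_nat c * of_int z" by (simp add: c z)
  finally have "int c * z = 1" by (metis of_int_eq_1_iff of_int_mult of_int_of_nat_eq)
  then have "c = 1" by (auto simp: zmult_eq_1_iff)
  then show ?thesis using c by simp
qed

text \<open>Some simple root other than \<alpha>_i occurs in \<beta> by reducedness. Its coweight is
  fixed by s_i, so the reflected root is still positive there and cannot be a negative root.\<close>

lemma simple_refl_permutes_pos:
  assumes \<beta>: "\<beta> \<in> pos_roots" and i: "i \<in> I" and ne: "\<beta> \<noteq> \<alpha> i"
  shows "\<beta> \<circ> simple_refl i \<in> pos_roots"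
proof -
  obtain c :: "'i \<Rightarrow> nat" where c: "\<beta> = (\<lambda>x. \<Sum>i\<in>I. of_nat (c i) * \<alpha> i x)"
    using \<beta> unfolding pos_roots_iff posf_def by blast
  have \<beta>R: "\<beta> \<in> real_roots" using \<beta> by (rule pos_root_is_root)
  obtain e where e: "\<And>i j. i \<in> I \<Longrightarrow> j \<in> I \<Longrightarrow> \<alpha> i (e j) = (if i = j then 1 else 0)"
    using dual_vectors_subset[OF finite_I subset_refl] by blast
  have "\<exists>k\<in>I. k \<noteq> i \<and> c k \<noteq> 0"
  proof (rule ccontr)
    assume "\<not> ?thesis"
    then have z: "\<And>k. k \<in> I \<Longrightarrow> k \<noteq> i \<Longrightarrow> c k = 0" by blast
    have "\<beta> x = of_nat (c i) * \<alpha> i x" for x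
    proof -
      have "(\<Sum>k\<in>I. of_nat (c k) * \<alpha> k x) = (\<Sum>k\<in>{i}. of_nat (c k) * \<alpha> k x)"
        using z i finite_I by (intro sum.mono_neutral_right) auto
      then show ?thesis unfolding c by simp
    qed
    then show False using pos_root_multiple_of_simple[OF \<beta>R i, of "c i"] ne by blast
  qed
  then obtain k where k: "k \<in> I" "k \<noteq> i" "c k \<noteq> 0" by blast
  have dom: "e k \<in> dominant" unfolding dominant_def using e k by auto
  have "\<beta> (e k) = (\<Sum>l\<in>I. if l = k then of_nat (c l) else 0)"
    unfolding c using e k by (intro sum.cong) auto
  then have "\<beta> (e k) > 0" using k finite_I by simp
  then have "(\<beta> \<circ> simple_refl i) (e k) > 0"
    using e i k by (simp add: simple_refl_def)
  then have "\<beta> \<circ> simple_refl i \<notin> neg_roots"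
    using neg_root_dominant[OF _ dom] by fastforce
  then show ?thesis using root_pos_or_neg[OF root_comp[OF \<beta>R simple_refl_in_Weyl[OF i]]] by blast
qed

lemma pos_root_if_length_less:
  assumes "i \<in> I" "v \<in> Weyl" "Weyl_length (simple_refl i \<circ> v) = Suc (Weyl_length v)"
  shows "\<alpha> i \<circ> v \<in> pos_roots"
  using posf_comp_if_length_le[of v i] root_comp[OF simple_in_real_roots] assms
  by (simp add: pos_roots_iff)

lemma length_less_if_neg_root:
  assumes "i \<in> I" "v \<in> Weyl" "\<alpha> i \<circ> v \<in> neg_roots"
  shows "Weyl_length v = Suc (Weyl_length (simple_refl i \<circ> v))"
proof -
  obtain \<xi> where \<xi>: "\<xi> \<in> fund_chamber" using fund_chamber_nonempty by blast
  have "Weyl_length (simple_refl i \<circ> v) < Weyl_length v"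
  proof (rule ccontr)
    assume "\<not> ?thesis"
    then have "posf (\<alpha> i \<circ> v)" using posf_comp_if_length_le assms by simp
    then have "(\<alpha> i \<circ> v) \<xi> \<ge> 0" using posf_nonneg fund_chamber_dominant \<xi> by blast
    then show False using neg_root_fund_chamber[OF assms(3) \<xi>] by simp
  qed
  then show ?thesis using Weyl_length_step'[OF assms(1,2)] by simp
qed

text \<open>A further letter s_i contributes at most the inversion \<alpha>_i, because s_i permutes
  the other positive roots.\<close>

lemma finite_inversions:
  assumes "w \<in> Weyl"
  shows "finite {\<beta> \<in> pos_roots. \<beta> \<circ> w \<in> neg_roots}"
  using assms
proof (induction rule: Weyl.induct)
  case Weyl_id
  obtain \<xi> where \<xi>: "\<xi> \<in> fund_chamber" using fund_chamber_nonempty by blast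
  have "{\<beta> \<in> pos_roots. \<beta> \<circ> id \<in> neg_roots} = {}"
    using pos_root_fund_chamber[OF _ \<xi>] neg_root_fund_chamber[OF _ \<xi>] by force
  then show ?case by (simp only: finite.emptyI)
next
  case (Weyl_step i w)
  have "{\<beta> \<in> pos_roots. \<beta> \<circ> (simple_refl i \<circ> w) \<in> neg_roots} \<subseteq>
      insert (\<alpha> i) ((\<lambda>\<beta>. \<beta> \<circ> simple_refl i) ` {\<beta> \<in> pos_roots. \<beta> \<circ> w \<in> neg_roots})"
  proof
    fix \<beta> assume "\<beta> \<in> {\<beta> \<in> pos_roots. \<beta> \<circ> (simple_refl i \<circ> w) \<in> neg_roots}"
    then have \<beta>: "\<beta> \<in> pos_roots" "(\<beta> \<circ> simple_refl i) \<circ> w \<in> neg_roots"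
      by (auto simp: comp_assoc)
    have "\<beta> = (\<beta> \<circ> simple_refl i) \<circ> simple_refl i"
      using simple_refl_comp_self[OF Weyl_step(1)] by (simp add: comp_assoc)
    then show "\<beta> \<in> insert (\<alpha> i) ((\<lambda>\<beta>. \<beta> \<circ> simple_refl i) ` {\<beta> \<in> pos_roots. \<beta> \<circ> w \<in> neg_roots})"
      using \<beta> simple_refl_permutes_pos[OF \<beta>(1) Weyl_step(1)] by blast
  qed
  then show ?case using Weyl_step.IH finite_subset by blast
qed

text \<open>Along a reduced word each letter subtracts a nonnegative multiple of a simple coroot.
  Positivity of coroots is derived from this estimate rather than from a second root system.\<close>

lemma functional_le_on_orbit:
  assumes \<phi>: "linear \<phi>" "\<And>i. i \<in> I \<Longrightarrow> \<phi> (\<alpha>v i) \<ge> (0::real)"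
    and "d \<in> dominant" "w \<in> Weyl"
  shows "\<phi> (w d) \<le> \<phi> d"
  using assms(4)
proof (induction "Weyl_length w" arbitrary: w)
  case 0
  then show ?case using Weyl_length_0[of w] by simp
next
  case (Suc n)
  then have "w \<in> Weyl" "Weyl_length w > 0" by simp_all
  then obtain i v where v: "i \<in> I" "v \<in> Weyl" "w = simple_refl i \<circ> v" "Weyl_length w = Suc (Weyl_length v)"
    by (rule first_letter)
  have "\<alpha> i \<circ> v \<in> pos_roots" using pos_root_if_length_less v by simp
  then have "\<alpha> i (v d) \<ge> 0" using pos_root_dominant[OF _ assms(3)] by fastforce
  then have "\<alpha> i (v d) * \<phi> (\<alpha>v i) \<ge> 0" using \<phi>(2) v(1) by simp
  then have "\<phi> (w d) \<le> \<phi> (v d)"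
    by (simp add: v(3) simple_refl_def linear_diff[OF \<phi>(1)] linear_cmul[OF \<phi>(1)])
  also have "\<dots> \<le> \<phi> d" using Suc v by simp
  finally show ?case .
qed

lemma Weyl_coroot_int:
  assumes "w \<in> Weyl" "i \<in> I"
  shows "\<exists>z :: 'i \<Rightarrow> int. w (\<alpha>v i) = (\<Sum>k\<in>I. of_int (z k) *\<^sub>R \<alpha>v k)"
  using assms(1)
proof (induction rule: Weyl.induct)
  case Weyl_id
  have "(\<Sum>k\<in>I. of_int (if k = i then 1 else 0) *\<^sub>R \<alpha>v k) = (\<Sum>k\<in>I. if k = i then \<alpha>v k else 0)"
    by (intro sum.cong) auto
  then show ?case using assms(2) finite_I by (intro exI[of _ "\<lambda>k. if k = i then 1 else 0"]) simp
next
  case (Weyl_step j w)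
  then obtain z :: "'i \<Rightarrow> int" where z: "w (\<alpha>v i) = (\<Sum>k\<in>I. of_int (z k) *\<^sub>R \<alpha>v k)" by blast
  define m where "m = (\<Sum>k\<in>I. z k * A k j)"
  have m: "\<alpha> j (w (\<alpha>v i)) = of_int m"
    using Weyl_step(1) unfolding z m_def
    by (simp add: linear_sum[OF linear_root] simple_root_scale pairing)
  have "(\<Sum>k\<in>I. of_int (if k = j then z k - m else z k) *\<^sub>R \<alpha>v k) =
     (\<Sum>k\<in>I. of_int (z k) *\<^sub>R \<alpha>v k - (if k = j then of_int m *\<^sub>R \<alpha>v k else 0))"
    by (intro sum.cong) (auto simp: scaleR_left_diff_distrib)
  also have "\<dots> = (simple_refl j \<circ> w) (\<alpha>v i)"
    using Weyl_step(1) finite_I by (simp add: sum_subtractf simple_refl_def m z[symmetric])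
  finally show ?case by (intro exI[of _ "\<lambda>k. if k = j then z k - m else z k"]) simp
qed

section \<open>Coroots and reflections of arbitrary real roots\<close>

lemma root_pres:
  assumes "\<beta> \<in> real_roots"
  obtains w i where "w \<in> Weyl" "i \<in> I" "\<beta> = \<alpha> i \<circ> inv w" "coroot \<beta> = w (\<alpha>v i)"
    "root_refl \<beta> = w \<circ> simple_refl i \<circ> inv w"
proof -
  have "\<exists>p. case p of (w, i) \<Rightarrow> w \<in> Weyl \<and> i \<in> I \<and> \<beta> = dual_act w (\<alpha> i)"
    using assms unfolding real_roots_def by auto
  then have "case root_pres \<beta> of (w, i) \<Rightarrow> w \<in> Weyl \<and> i \<in> I \<and> \<beta> = dual_act w (\<alpha> i)"
    unfolding root_pres_def by (rule someI_ex)
  then obtain w i where "root_pres \<beta> = (w, i)" "w \<in> Weyl" "i \<in> I" "\<beta> = dual_act w (\<alpha> i)"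
    by (cases "root_pres \<beta>") auto
  then show ?thesis
    using that[of w i] unfolding coroot_def root_refl_def dual_act_def by simp
qed

lemma conjugate_refl:
  assumes "w \<in> Weyl" "i \<in> I"
  shows "(w \<circ> simple_refl i \<circ> inv w) y = y - \<alpha> i (inv w y) *\<^sub>R w (\<alpha>v i)"
  using assms
  by (simp add: simple_refl_def Weyl_diff Weyl_scale)

lemma
  assumes "\<beta> \<in> real_roots"
  shows root_refl_apply: "root_refl \<beta> y = y - \<beta> y *\<^sub>R coroot \<beta>"
    and root_refl_in_Weyl: "root_refl \<beta> \<in> Weyl"
    and root_coroot: "\<beta> (coroot \<beta>) = 2"
    and coroot_in_lattice: "coroot \<beta> \<in> Y"
    and coroot_int: "\<exists>z :: 'i \<Rightarrow> int. coroot \<beta> = (\<Sum>k\<in>I. of_int (z k) *\<^sub>R \<alpha>v k)"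
proof -
  obtain w i where w: "w \<in> Weyl" "i \<in> I" and \<beta>: "\<beta> = \<alpha> i \<circ> inv w"
    and c: "coroot \<beta> = w (\<alpha>v i)" and r: "root_refl \<beta> = w \<circ> simple_refl i \<circ> inv w"
    using assms by (rule root_pres)
  show "root_refl \<beta> y = y - \<beta> y *\<^sub>R coroot \<beta>"
    unfolding r c conjugate_refl[OF w] by (simp add: \<beta>)
  show "root_refl \<beta> \<in> Weyl"
    unfolding r using w Weyl_comp Weyl_inv simple_refl_in_Weyl by blast
  show "\<beta> (coroot \<beta>) = 2"
    unfolding c using w root_diag by (simp add: \<beta>)
  show "coroot \<beta> \<in> Y"
    unfolding c using w Weyl_lattice coroots_in_Y by blast
  show "\<exists>z :: 'i \<Rightarrow> int. coroot \<beta> = (\<Sum>k\<in>I. of_int (z k) *\<^sub>R \<alpha>v k)"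
    unfolding c using w Weyl_coroot_int by blast
qed

text \<open>A functional dual to the simple coroots reads off one coefficient; this turns estimates
  on functionals into statements about integers.\<close>

lemma coroot_combination_nonneg:
  fixes z :: "'i \<Rightarrow> int"
  assumes z: "v = (\<Sum>k\<in>I. of_int (z k) *\<^sub>R \<alpha>v k)"
    and v: "\<And>\<phi>. linear \<phi> \<Longrightarrow> (\<And>i. i \<in> I \<Longrightarrow> \<phi> (\<alpha>v i) \<ge> 0) \<Longrightarrow> \<phi> v \<ge> (0::real)"
    and k: "k \<in> I"
  shows "z k \<ge> 0"
proof -
  obtain h where h: "linear h" "\<And>i. i \<in> I \<Longrightarrow> h (\<alpha>v i) = (if i = k then 1 else 0 :: real)"
    using functional_with_values[of "\<lambda>i. if i = k then 1 else 0"] by blast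
  have "h v = (\<Sum>i\<in>I. if i = k then of_int (z i) else 0)"
    unfolding z linear_sum[OF h(1)] linear_cmul[OF h(1)] using h(2) by (intro sum.cong) auto
  then have "h v = of_int (z k)" using k finite_I by simp
  moreover have "h v \<ge> 0" by (rule v[OF h(1)]) (simp add: h(2))
  ultimately show ?thesis by simp
qed

text \<open>\<open>coroot\<close> rests on an arbitrary presentation. Two candidates give two
  reflections with the same root \<beta>, whose products in the two orders move a chamber point
  \<xi> by opposite multiples of the difference of the candidates. The orbit estimate forbids an
  increase in either direction, so no nonnegative functional sees the difference.\<close>

lemma coroot_unique:
  assumes w: "w \<in> Weyl" and i: "i \<in> I"
  shows "coroot (\<alpha> i \<circ> inv w) = w (\<alpha>v i)"
proof -
  define \<beta> where "\<beta> = \<alpha> i \<circ> inv w"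
  have \<beta>: "\<beta> \<in> real_roots"
    unfolding \<beta>_def using root_comp simple_in_real_roots[OF i] Weyl_inv[OF w] by blast
  define r where "r = w \<circ> simple_refl i \<circ> inv w"
  define c where "c = w (\<alpha>v i)"
  have rW: "r \<in> Weyl" unfolding r_def using w i Weyl_comp Weyl_inv simple_refl_in_Weyl by blast
  have r: "r y = y - \<beta> y *\<^sub>R c" for y
    unfolding r_def c_def \<beta>_def using conjugate_refl[OF w i] by simp
  have \<beta>c: "\<beta> c = 2" unfolding \<beta>_def c_def using w root_diag[OF i] by simp
  obtain \<xi> where \<xi>: "\<xi> \<in> fund_chamber" using fund_chamber_nonempty by blast
  have \<beta>\<xi>: "\<beta> \<xi> \<noteq> 0" using root_fund_chamber_nonzero \<beta> \<xi> by blast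
  have "(root_refl \<beta> \<circ> r) \<xi> = \<xi> + \<beta> \<xi> *\<^sub>R (coroot \<beta> - c)"
    "(r \<circ> root_refl \<beta>) \<xi> = \<xi> + \<beta> \<xi> *\<^sub>R (c - coroot \<beta>)"
    using two_reflections[OF real_root_linear[OF \<beta>] \<beta>c, of \<xi> \<beta>]
      two_reflections[OF real_root_linear[OF \<beta>] root_coroot[OF \<beta>], of \<xi> \<beta>]
    by (simp_all add: r root_refl_apply[OF \<beta>] scaleR_right_diff_distrib)
  moreover have "root_refl \<beta> \<circ> r \<in> Weyl" "r \<circ> root_refl \<beta> \<in> Weyl"
    using rW root_refl_in_Weyl[OF \<beta>] Weyl_comp by auto
  ultimately have le: "\<phi> (\<xi> + \<beta> \<xi> *\<^sub>R (coroot \<beta> - c)) \<le> \<phi> \<xi>" "\<phi> (\<xi> + \<beta> \<xi> *\<^sub>R (c - coroot \<beta>)) \<le> \<phi> \<xi>"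
    if "linear \<phi>" "\<And>i. i \<in> I \<Longrightarrow> \<phi> (\<alpha>v i) \<ge> (0::real)" for \<phi>
    using functional_le_on_orbit[OF that fund_chamber_dominant[OF \<xi>]] by metis+
  have eq: "\<phi> c = \<phi> (coroot \<beta>)" if \<phi>: "linear \<phi>" "\<And>i. i \<in> I \<Longrightarrow> \<phi> (\<alpha>v i) \<ge> (0::real)" for \<phi>
  proof -
    have "\<beta> \<xi> * (\<phi> c - \<phi> (coroot \<beta>)) = 0"
      using le[OF \<phi>] by (simp add: linear_add[OF \<phi>(1)] linear_diff[OF \<phi>(1)] linear_cmul[OF \<phi>(1)] algebra_simps)
    then show ?thesis using \<beta>\<xi> by simp
  qed
  obtain z z' :: "'i \<Rightarrow> int" where z: "c = (\<Sum>k\<in>I. of_int (z k) *\<^sub>R \<alpha>v k)"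
    and z': "coroot \<beta> = (\<Sum>k\<in>I. of_int (z' k) *\<^sub>R \<alpha>v k)"
    using Weyl_coroot_int[OF w i] coroot_int[OF \<beta>] unfolding c_def by blast
  have d: "c - coroot \<beta> = (\<Sum>k\<in>I. of_int (z k - z' k) *\<^sub>R \<alpha>v k)"
    "coroot \<beta> - c = (\<Sum>k\<in>I. of_int (z' k - z k) *\<^sub>R \<alpha>v k)"
    unfolding z z' by (simp_all add: sum_subtractf scaleR_left_diff_distrib)
  have ge: "\<phi> (c - coroot \<beta>) \<ge> 0" "\<phi> (coroot \<beta> - c) \<ge> 0"
    if \<phi>: "linear \<phi>" "\<And>i. i \<in> I \<Longrightarrow> \<phi> (\<alpha>v i) \<ge> (0::real)" for \<phi>
    using eq[OF \<phi>] by (simp_all add: linear_diff[OF \<phi>(1)])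
  have "z k = z' k" if k: "k \<in> I" for k
  proof -
    have "z k - z' k \<ge> 0"
    proof (rule coroot_combination_nonneg[OF d(1) _ k])
      fix \<phi> :: "'a \<Rightarrow> real" assume "linear \<phi>" "\<And>i. i \<in> I \<Longrightarrow> 0 \<le> \<phi> (\<alpha>v i)"
      then show "0 \<le> \<phi> (c - coroot \<beta>)" by (rule ge(1))
    qed
    moreover have "z' k - z k \<ge> 0"
    proof (rule coroot_combination_nonneg[OF d(2) _ k])
      fix \<phi> :: "'a \<Rightarrow> real" assume "linear \<phi>" "\<And>i. i \<in> I \<Longrightarrow> 0 \<le> \<phi> (\<alpha>v i)"
      then show "0 \<le> \<phi> (coroot \<beta> - c)" by (rule ge(2))
    qed
    ultimately show ?thesis by simp
  qed
  then have "c = coroot \<beta>" unfolding z z' by (intro sum.cong) auto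
  then show ?thesis unfolding c_def \<beta>_def by simp
qed

lemma coroot_comp:
  assumes \<beta>: "\<beta> \<in> real_roots" and w: "w \<in> Weyl"
  shows "coroot (\<beta> \<circ> inv w) = w (coroot \<beta>)"
proof -
  obtain v i where v: "v \<in> Weyl" "i \<in> I" "\<beta> = \<alpha> i \<circ> inv v" "coroot \<beta> = v (\<alpha>v i)"
    "root_refl \<beta> = v \<circ> simple_refl i \<circ> inv v"
    using \<beta> by (rule root_pres)
  have "\<beta> \<circ> inv w = \<alpha> i \<circ> inv (w \<circ> v)"
    using v w by (simp add: Weyl_inv_comp comp_assoc)
  then show ?thesis using coroot_unique[OF Weyl_comp[OF w v(1)] v(2)] v(4) by simp
qed

lemma root_refl_comp:
  assumes \<beta>: "\<beta> \<in> real_roots" and w: "w \<in> Weyl"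
  shows "root_refl (\<beta> \<circ> inv w) = w \<circ> root_refl \<beta> \<circ> inv w"
  using coroot_comp[OF \<beta> w] w
  by (simp add: fun_eq_iff root_refl_apply[OF root_comp[OF \<beta> Weyl_inv[OF w]]] root_refl_apply[OF \<beta>]
      Weyl_diff Weyl_scale)

lemma coroot_uminus:
  assumes \<beta>: "\<beta> \<in> real_roots"
  shows "coroot (\<lambda>x. - \<beta> x) = - coroot \<beta>"
proof -
  obtain v i where v: "v \<in> Weyl" "i \<in> I" "\<beta> = \<alpha> i \<circ> inv v" "coroot \<beta> = v (\<alpha>v i)"
    "root_refl \<beta> = v \<circ> simple_refl i \<circ> inv v"
    using \<beta> by (rule root_pres)
  have "(\<lambda>x. - \<beta> x) = \<alpha> i \<circ> inv (v \<circ> simple_refl i)"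
    using v by (auto simp: Weyl_inv_comp simple_refl_in_Weyl inv_simple_refl simple_root_refl_self)
  then have "coroot (\<lambda>x. - \<beta> x) = v (simple_refl i (\<alpha>v i))"
    using coroot_unique[OF Weyl_comp[OF v(1) simple_refl_in_Weyl[OF v(2)]] v(2)] by simp
  also have "simple_refl i (\<alpha>v i) = - \<alpha>v i"
    using root_diag[OF v(2)] by (simp add: simple_refl_def scaleR_2)
  finally show ?thesis using v by (simp add: Weyl_neg)
qed

lemma root_refl_uminus: "\<beta> \<in> real_roots \<Longrightarrow> root_refl (\<lambda>x. - \<beta> x) = root_refl \<beta>"
  by (simp add: fun_eq_iff root_refl_apply root_uminus coroot_uminus)

lemma root_refl_simple: "i \<in> I \<Longrightarrow> root_refl (\<alpha> i) = simple_refl i"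
  using coroot_unique[OF Weyl_id, of i]
  by (simp add: fun_eq_iff root_refl_apply simple_in_real_roots simple_refl_def)

lemma root_refl_involution: "\<beta> \<in> real_roots \<Longrightarrow> root_refl \<beta> (root_refl \<beta> y) = y"
  using two_reflections[OF real_root_linear[of \<beta>] root_coroot[of \<beta>],
      where f = \<beta> and y = y and c' = "coroot \<beta>"] by (simp add: root_refl_apply)

section \<open>Positivity and height of coroots\<close>

lemma pos_coroot_nat:
  assumes "\<beta> \<in> pos_roots"
  shows "\<exists>n :: 'i \<Rightarrow> nat. coroot \<beta> = (\<Sum>k\<in>I. of_nat (n k) *\<^sub>R \<alpha>v k)"
proof -
  note \<beta> = pos_root_is_root[OF assms]
  obtain z :: "'i \<Rightarrow> int" where z: "coroot \<beta> = (\<Sum>k\<in>I. of_int (z k) *\<^sub>R \<alpha>v k)"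
    using coroot_int[OF \<beta>] by blast
  obtain \<xi> where \<xi>: "\<xi> \<in> fund_chamber" using fund_chamber_nonempty by blast
  have "z k \<ge> 0" if "k \<in> I" for k
  proof (rule coroot_combination_nonneg[OF z _ that])
    fix \<phi> :: "'a \<Rightarrow> real" assume \<phi>: "linear \<phi>" "\<And>i. i \<in> I \<Longrightarrow> \<phi> (\<alpha>v i) \<ge> 0"
    \<comment> \<open>Since \<beta> is positive at \<xi>, the reflection subtracts a positive
      multiple of the coroot, and the orbit estimate gives the sign of \<phi> on it.\<close>
    have "\<phi> (root_refl \<beta> \<xi>) \<le> \<phi> \<xi>"
      using functional_le_on_orbit[OF \<phi> fund_chamber_dominant[OF \<xi>] root_refl_in_Weyl[OF \<beta>]] .
    then have "\<beta> \<xi> * \<phi> (coroot \<beta>) \<ge> 0"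
      by (simp add: root_refl_apply[OF \<beta>] linear_diff[OF \<phi>(1)] linear_cmul[OF \<phi>(1)])
    then show "\<phi> (coroot \<beta>) \<ge> 0"
      using pos_root_fund_chamber[OF assms \<xi>] by (simp add: zero_le_mult_iff)
  qed
  then show ?thesis
    unfolding z by (intro exI[of _ "\<lambda>k. nat (z k)"] sum.cong) auto
qed

text \<open>Only the values on simple coroots are prescribed. The extension to the whole space is
  arbitrary but fixed once; differences along coroots do not depend on it.\<close>

definition ht :: "'a \<Rightarrow> real" where
  "ht = (SOME h. linear h \<and> (\<forall>i\<in>I. h (\<alpha>v i) = 1))"

lemma linear_ht: "linear ht" and ht_simple: "i \<in> I \<Longrightarrow> ht (\<alpha>v i) = 1"
proof -
  have "linear ht \<and> (\<forall>i\<in>I. ht (\<alpha>v i) = 1)"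
    using someI_ex[OF functional_with_values[of "\<lambda>_. 1"]] unfolding ht_def .
  then show "linear ht" "i \<in> I \<Longrightarrow> ht (\<alpha>v i) = 1" by auto
qed

lemmas ht_add = linear_add[OF linear_ht]
lemmas ht_diff = linear_diff[OF linear_ht]
lemmas ht_scale = linear_cmul[OF linear_ht]
lemmas ht_zero = linear_0[OF linear_ht]

lemma ht_sum: "ht (\<Sum>k\<in>I. of_nat (n k) *\<^sub>R \<alpha>v k) = (\<Sum>k\<in>I. of_nat (n k))"
  by (simp add: linear_sum[OF linear_ht] ht_scale ht_simple)

lemma ht_pos_coroot:
  assumes "\<beta> \<in> pos_roots"
  shows "ht (coroot \<beta>) \<ge> 1"
proof -
  obtain n :: "'i \<Rightarrow> nat" where n: "coroot \<beta> = (\<Sum>k\<in>I. of_nat (n k) *\<^sub>R \<alpha>v k)"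
    using pos_coroot_nat[OF assms] by blast
  have "coroot \<beta> \<noteq> 0"
    using root_coroot[OF pos_root_is_root[OF assms]] real_root_zero[OF pos_root_is_root[OF assms]]
    by auto
  moreover have "coroot \<beta> = 0" if "\<forall>k\<in>I. n k = 0"
    unfolding n using that by simp
  ultimately have "\<not> (\<forall>k\<in>I. n k = 0)" by blast
  then obtain k where k: "k \<in> I" "n k \<noteq> 0" by blast
  have "n k \<le> (\<Sum>k\<in>I. n k)" using k finite_I by (intro member_le_sum) auto
  then have "1 \<le> (\<Sum>k\<in>I. n k)" using k by linarith
  then have "1 \<le> real (\<Sum>k\<in>I. n k)" by linarith
  then show ?thesis unfolding n ht_sum by simp
qed

lemma vanish_on_fund_chamber:
  fixes f :: "'a \<Rightarrow> real"
  assumes f: "linear f" and f0: "\<And>x. x \<in> fund_chamber \<Longrightarrow> f x = 0"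
  shows "f z = 0"
proof -
  obtain \<xi> where \<xi>: "\<xi> \<in> fund_chamber" using fund_chamber_nonempty by blast
  \<comment> \<open>Chosen so that \<open>K * \<alpha> i \<xi>\<close> exceeds the absolute value of
    \<open>\<alpha> i z\<close> for every \<open>i\<close>, which pushes \<open>z\<close> into the
    open chamber.\<close>
  define K where "K = Max (insert 1 ((\<lambda>i. (1 + \<bar>\<alpha> i z\<bar>) / \<alpha> i \<xi>) ` I))"
  have K: "(1 + \<bar>\<alpha> i z\<bar>) / \<alpha> i \<xi> \<le> K" if "i \<in> I" for i
    unfolding K_def using that finite_I by (intro Max_ge) auto
  have "K *\<^sub>R \<xi> + z \<in> fund_chamber"
    unfolding fund_chamber_def
  proof clarify
    fix i assume i: "i \<in> I"
    then have "\<alpha> i \<xi> > 0" using \<xi> unfolding fund_chamber_def by blast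
    then have "1 + \<bar>\<alpha> i z\<bar> \<le> K * \<alpha> i \<xi>" using K[OF i] by (simp add: divide_le_eq)
    then show "\<alpha> i (K *\<^sub>R \<xi> + z) > 0"
      by (simp add: simple_root_add[OF i] simple_root_scale[OF i])
  qed
  then have "f (K *\<^sub>R \<xi> + z) = 0" by (rule f0)
  then show ?thesis using f0[OF \<xi>] by (simp add: linear_add[OF f] linear_cmul[OF f])
qed

text \<open>The products of the two reflections in the two orders shift a chamber point by opposite
  multiples of the common coroot. Neither may raise the height, so the roots agree on the open
  chamber and hence everywhere.\<close>

lemma coroot_inj:
  assumes \<beta>: "\<beta> \<in> pos_roots" and \<gamma>: "\<gamma> \<in> pos_roots" and eq: "coroot \<beta> = coroot \<gamma>"
  shows "\<beta> = \<gamma>"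
proof -
  note \<beta>R = pos_root_is_root[OF \<beta>] and \<gamma>R = pos_root_is_root[OF \<gamma>]
  have lin: "linear (\<lambda>y. \<beta> y - \<gamma> y)"
    using real_root_linear[OF \<beta>R] real_root_linear[OF \<gamma>R] by (rule linear_compose_sub)
  have two: "\<beta> (coroot \<gamma>) = 2" "\<gamma> (coroot \<gamma>) = 2" using root_coroot \<beta>R \<gamma>R eq by metis+
  have "\<beta> \<xi> - \<gamma> \<xi> = 0" if \<xi>: "\<xi> \<in> fund_chamber" for \<xi>
  proof -
    have "(root_refl \<beta> \<circ> root_refl \<gamma>) \<xi> = \<xi> - (\<beta> \<xi> - \<gamma> \<xi>) *\<^sub>R coroot \<gamma>"
      using two_reflections[OF real_root_linear[OF \<beta>R] two(1), of \<xi> \<gamma> "coroot \<gamma>"]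
      by (simp add: root_refl_apply[OF \<beta>R] root_refl_apply[OF \<gamma>R] eq)
    moreover have "(root_refl \<gamma> \<circ> root_refl \<beta>) \<xi> = \<xi> + (\<beta> \<xi> - \<gamma> \<xi>) *\<^sub>R coroot \<gamma>"
      using two_reflections[OF real_root_linear[OF \<gamma>R] two(2), of \<xi> \<beta> "coroot \<gamma>"]
      by (simp add: root_refl_apply[OF \<beta>R] root_refl_apply[OF \<gamma>R] eq scaleR_left_diff_distrib)
    moreover have "root_refl \<beta> \<circ> root_refl \<gamma> \<in> Weyl" "root_refl \<gamma> \<circ> root_refl \<beta> \<in> Weyl"
      using root_refl_in_Weyl \<beta>R \<gamma>R Weyl_comp by auto
    ultimately have "ht (\<xi> - (\<beta> \<xi> - \<gamma> \<xi>) *\<^sub>R coroot \<gamma>) \<le> ht \<xi>" "ht (\<xi> + (\<beta> \<xi> - \<gamma> \<xi>) *\<^sub>R coroot \<gamma>) \<le> ht \<xi>"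
      using functional_le_on_orbit[OF linear_ht _ fund_chamber_dominant[OF \<xi>]] ht_simple
      by (metis zero_le_one)+
    then have "(\<beta> \<xi> - \<gamma> \<xi>) * ht (coroot \<gamma>) = 0"
      by (simp add: ht_add ht_diff ht_scale)
    then show ?thesis using ht_pos_coroot[OF \<gamma>] by auto
  qed
  then have "\<beta> z - \<gamma> z = 0" for z using vanish_on_fund_chamber[OF lin] by blast
  then show ?thesis by (simp add: fun_eq_iff)
qed

text \<open>Coefficients of positive coroots are natural numbers with sum equal to the height;
  injectivity of \<open>coroot\<close> carries the count over to roots.\<close>

lemma finite_pos_roots_bounded: "finite {\<beta> \<in> pos_roots. ht (coroot \<beta>) \<le> H}"
proof -
  let ?S = "{\<beta> \<in> pos_roots. ht (coroot \<beta>) \<le> H}"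
  let ?N = "nat \<lfloor>H\<rfloor>"
  have "coroot ` ?S \<subseteq> (\<lambda>n. \<Sum>k\<in>I. of_nat (n k) *\<^sub>R \<alpha>v k) ` (I \<rightarrow>\<^sub>E {..?N})"
  proof
    fix v assume "v \<in> coroot ` ?S"
    then obtain \<beta> where \<beta>: "\<beta> \<in> pos_roots" "ht (coroot \<beta>) \<le> H" "v = coroot \<beta>" by blast
    obtain n :: "'i \<Rightarrow> nat" where n: "coroot \<beta> = (\<Sum>k\<in>I. of_nat (n k) *\<^sub>R \<alpha>v k)"
      using pos_coroot_nat[OF \<beta>(1)] by blast
    have "n k \<le> ?N" if k: "k \<in> I" for k
    proof -
      have "n k \<le> (\<Sum>k\<in>I. n k)" using k finite_I by (intro member_le_sum) auto
      then have "real (n k) \<le> real (\<Sum>k\<in>I. n k)" by (rule of_nat_mono)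
      also have "\<dots> \<le> H" using \<beta>(2) unfolding n ht_sum by simp
      finally show ?thesis by (simp add: le_nat_floor)
    qed
    then have "restrict n I \<in> I \<rightarrow>\<^sub>E {..?N}" by auto
    moreover have "v = (\<Sum>k\<in>I. of_nat (restrict n I k) *\<^sub>R \<alpha>v k)" unfolding \<beta>(3) n by simp
    ultimately show "v \<in> (\<lambda>n. \<Sum>k\<in>I. of_nat (n k) *\<^sub>R \<alpha>v k) ` (I \<rightarrow>\<^sub>E {..?N})" by blast
  qed
  moreover have "finite (I \<rightarrow>\<^sub>E {..?N})" using finite_I by (intro finite_PiE) auto
  ultimately have "finite (coroot ` ?S)" by (meson finite_imageI finite_subset)
  moreover have "inj_on coroot ?S" using coroot_inj by (intro inj_onI) auto
  ultimately show ?thesis using finite_imageD by blast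
qed

text \<open>Peel off the first letter s_i of a reduced word. If \<beta> is \<alpha>_i, the
  reflection deletes it; otherwise \<beta> composed with s_i is still positive, and conjugation by
  s_i reduces to the shorter element.\<close>

lemma strong_exchange:
  assumes "w \<in> Weyl" "\<beta> \<in> pos_roots" "\<beta> \<circ> w \<in> neg_roots"
  shows "Weyl_length (root_refl \<beta> \<circ> w) < Weyl_length w"
  using assms
proof (induction "Weyl_length w" arbitrary: w \<beta>)
  case 0
  obtain \<xi> where \<xi>: "\<xi> \<in> fund_chamber" using fund_chamber_nonempty by blast
  have "w = id" using 0 Weyl_length_0 by simp
  then show ?case
    using pos_root_fund_chamber[OF 0(3) \<xi>] neg_root_fund_chamber[OF 0(4) \<xi>] by simp
next
  case (Suc n)
  then have "w \<in> Weyl" "Weyl_length w > 0" by simp_all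
  then obtain i v where v: "i \<in> I" "v \<in> Weyl" "w = simple_refl i \<circ> v" "Weyl_length w = Suc (Weyl_length v)"
    by (rule first_letter)
  show ?case
  proof (cases "\<beta> = \<alpha> i")
    case True
    then have "root_refl \<beta> \<circ> w = v"
      using v simple_refl_comp_cancel[OF v(1)] root_refl_simple[OF v(1)] by simp
    then show ?thesis using v(4) by simp
  next
    case False
    have R: "\<beta> \<in> real_roots" using Suc.prems(2) by (rule pos_root_is_root)
    let ?\<gamma> = "\<beta> \<circ> simple_refl i"
    have \<gamma>: "?\<gamma> \<in> pos_roots" using simple_refl_permutes_pos Suc.prems(2) v(1) False by blast
    have "?\<gamma> \<circ> v \<in> neg_roots" using Suc.prems(3) v(3) by (simp add: comp_assoc)
    then have less: "Weyl_length (root_refl ?\<gamma> \<circ> v) < Weyl_length v"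
      using Suc.hyps(1)[OF _ v(2) \<gamma>] Suc.hyps(2) v(4) by simp
    have "root_refl ?\<gamma> = simple_refl i \<circ> root_refl \<beta> \<circ> simple_refl i"
      using root_refl_comp[OF R simple_refl_in_Weyl[OF v(1)]] inv_simple_refl[OF v(1)] by simp
    then have "root_refl \<beta> \<circ> w = simple_refl i \<circ> (root_refl ?\<gamma> \<circ> v)"
      by (simp add: v(3) comp_assoc simple_refl_comp_cancel[OF v(1)])
    then have "Weyl_length (root_refl \<beta> \<circ> w) \<le> Suc (Weyl_length (root_refl ?\<gamma> \<circ> v))"
      using Weyl_length_step[OF v(1) Weyl_comp[OF root_refl_in_Weyl[OF pos_root_is_root[OF \<gamma>]] v(2)]] by simp
    then show ?thesis using less v(4) by simp
  qed
qed

text \<open>Simple transitivity on chambers: the first letter of a reduced word would make its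
  simple root negative at \<open>u \<xi>\<close>.\<close>

lemma Weyl_eq_id:
  assumes u: "u \<in> Weyl" and "\<xi> \<in> fund_chamber" "u \<xi> \<in> dominant"
  shows "u = id"
proof (rule ccontr)
  assume "u \<noteq> id"
  then have "Weyl_length u > 0" using Weyl_length_0[OF u] by auto
  then obtain i v where v: "i \<in> I" "v \<in> Weyl" "u = simple_refl i \<circ> v" "Weyl_length u = Suc (Weyl_length v)"
    by (rule first_letter[OF u])
  have "\<alpha> i \<circ> v \<in> pos_roots" using pos_root_if_length_less v by simp
  then have "\<alpha> i (v \<xi>) > 0" using pos_root_fund_chamber assms(2) by fastforce
  then have "\<alpha> i (u \<xi>) < 0" using v by (simp add: simple_root_refl_self)
  then show False using assms(3) v(1) unfolding dominant_def by auto
qed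

text \<open>The hypothesis makes \<open>w0\<close> send positive roots to negative ones, so a first
  letter that lengthens an element \<open>u\<close> shortens \<open>u \<circ> w0\<close> by
  one.\<close>

lemma longest_element_length:
  assumes w0: "w0 \<in> Weyl" and \<xi>: "\<xi> \<in> fund_chamber" "- w0 \<xi> \<in> dominant" and "v \<in> Weyl"
  shows "Weyl_length v + Weyl_length (v \<circ> w0) = Weyl_length w0"
  using assms(4)
proof (induction "Weyl_length v" arbitrary: v)
  case 0
  then have "v = id" using Weyl_length_0[of v] by simp
  show ?case unfolding \<open>v = id\<close> id_comp Weyl_length_id by (rule add_0)
next
  case (Suc n)
  then have "v \<in> Weyl" "Weyl_length v > 0" by simp_all
  then obtain i u where u: "i \<in> I" "u \<in> Weyl" "v = simple_refl i \<circ> u" "Weyl_length v = Suc (Weyl_length u)"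
    by (rule first_letter)
  have pos: "\<alpha> i \<circ> u \<in> pos_roots" using pos_root_if_length_less u by simp
  have R: "\<alpha> i \<circ> u \<circ> w0 \<in> real_roots" using pos_root_is_root[OF pos] root_comp w0 by blast
  have "(\<alpha> i \<circ> u) (- w0 \<xi>) \<ge> 0" using pos_root_dominant[OF pos \<xi>(2)] .
  then have "(\<alpha> i \<circ> u \<circ> w0) \<xi> \<le> 0"
    using real_root_neg[OF pos_root_is_root[OF pos]] by simp
  then have "\<alpha> i \<circ> (u \<circ> w0) \<in> neg_roots"
    using neg_root_iff_fund_chamber[OF R \<xi>(1)] root_fund_chamber_nonzero[OF R \<xi>(1)] by (simp add: comp_assoc)
  then have "Weyl_length (u \<circ> w0) = Suc (Weyl_length (v \<circ> w0))"
    using length_less_if_neg_root[OF u(1) Weyl_comp[OF u(2) w0]] u(3) by (simp add: comp_assoc)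
  moreover have "Weyl_length u + Weyl_length (u \<circ> w0) = Weyl_length w0"
    using Suc.hyps u by simp
  ultimately show ?case using u(4) by simp
qed

lemma longest_element:
  assumes "w0 \<in> Weyl" "\<xi> \<in> fund_chamber" "- w0 \<xi> \<in> dominant" and w: "w \<in> Weyl"
  shows "Weyl_length w \<le> Weyl_length w0" "Weyl_length w = Weyl_length w0 \<Longrightarrow> w = w0"
proof -
  have *: "Weyl_length w + Weyl_length (inv w \<circ> w0) = Weyl_length w0"
    using longest_element_length[OF assms(1-3) Weyl_inv[OF w]] Weyl_length_inv[OF w] by simp
  then show "Weyl_length w \<le> Weyl_length w0" by simp
  assume "Weyl_length w = Weyl_length w0"
  then have "inv w \<circ> w0 = id" using * Weyl_length_0 Weyl_comp Weyl_inv w assms(1) by simp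
  then show "w = w0" using w by (metis Weyl_comp_inv(1) comp_assoc comp_id id_comp)
qed

subsection \<open>The Tits cone\<close>

lemma mem_closure_chamber:
  assumes w: "w \<in> Weyl"
  shows "x \<in> closure (chamber w) \<longleftrightarrow> inv w x \<in> dominant"
proof
  have lin: "linear (\<alpha> i \<circ> inv w)" if "i \<in> I" for i
    using that w linear_compose linear_root Weyl_linear Weyl_inv by blast
  have "closed (\<Inter>i\<in>I. {x. 0 \<le> (\<alpha> i \<circ> inv w) x})"
    by (intro closed_INT ballI closed_Collect_le continuous_on_const functional_continuous lin)
  moreover have "chamber w \<subseteq> (\<Inter>i\<in>I. {x. 0 \<le> (\<alpha> i \<circ> inv w) x})"
    using w unfolding chamber_def fund_chamber_def by (auto intro: less_imp_le)
  ultimately have "closure (chamber w) \<subseteq> (\<Inter>i\<in>I. {x. 0 \<le> (\<alpha> i \<circ> inv w) x})"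
    by (rule closure_minimal[rotated])
  then show "x \<in> closure (chamber w) \<Longrightarrow> inv w x \<in> dominant"
    unfolding dominant_def by auto
next
  assume x: "inv w x \<in> dominant"
  obtain \<xi> where \<xi>: "\<xi> \<in> fund_chamber" using fund_chamber_nonempty by blast
  \<comment> \<open>Approach \<open>x\<close> from inside the chamber: a positive multiple of
    \<open>w \<xi>\<close> makes all inequalities strict.\<close>
  define f where "f n = x + inverse (real (Suc n)) *\<^sub>R w \<xi>" for n
  have "f n \<in> chamber w" for n
  proof -
    have "f n = w (inv w x + inverse (real (Suc n)) *\<^sub>R \<xi>)"
      using w by (simp add: f_def Weyl_add Weyl_scale)
    moreover have "inv w x + inverse (real (Suc n)) *\<^sub>R \<xi> \<in> fund_chamber"
      using x \<xi> unfolding fund_chamber_def dominant_def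
      by (auto simp: simple_root_add simple_root_scale intro!: add_nonneg_pos)
    ultimately show ?thesis unfolding chamber_def by blast
  qed
  moreover have "f \<longlonglongrightarrow> x + 0 *\<^sub>R w \<xi>"
    unfolding f_def by (intro tendsto_intros LIMSEQ_inverse_real_of_nat)
  ultimately show "x \<in> closure (chamber w)"
    unfolding closure_sequential by (intro exI[of _ f]) simp
qed

lemma Tits_cone_iff_orbit: "x \<in> Tits_cone \<longleftrightarrow> (\<exists>w\<in>Weyl. \<exists>d\<in>dominant. x = w d)"
proof
  assume "x \<in> Tits_cone"
  then obtain w where w: "w \<in> Weyl" "inv w x \<in> dominant"
    unfolding Tits_cone_def using mem_closure_chamber by auto
  then show "\<exists>w\<in>Weyl. \<exists>d\<in>dominant. x = w d"
    by (intro bexI[of _ w] bexI[of _ "inv w x"]) simp_all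
next
  assume "\<exists>w\<in>Weyl. \<exists>d\<in>dominant. x = w d"
  then obtain w d where w: "w \<in> Weyl" "d \<in> dominant" "x = w d" by blast
  then have "inv w x \<in> dominant" by simp
  then show "x \<in> Tits_cone"
    unfolding Tits_cone_def using mem_closure_chamber w(1) by blast
qed

lemma Weyl_Tits_cone: "v \<in> Weyl \<Longrightarrow> x \<in> Tits_cone \<Longrightarrow> v x \<in> Tits_cone"
  unfolding Tits_cone_iff_orbit by (metis Weyl_comp comp_apply)

lemma dominant_Tits_cone: "d \<in> dominant \<Longrightarrow> d \<in> Tits_cone"
  unfolding Tits_cone_iff_orbit by (intro bexI[of _ id] bexI[of _ d] Weyl_id) simp_all

text \<open>If \<alpha>_i is negative at \<open>x\<close>, then s_i removes it from the set of
  negative values and permutes the rest, so finitely many reflections reach the dominant cone. The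
  criterion yields convexity and supplies the finite sets of exceptional roots.\<close>

lemma Tits_cone_iff_finite: "x \<in> Tits_cone \<longleftrightarrow> finite {\<beta> \<in> pos_roots. \<beta> x < 0}"
proof
  assume "x \<in> Tits_cone"
  then obtain w d where w: "w \<in> Weyl" "d \<in> dominant" "x = w d" unfolding Tits_cone_iff_orbit by blast
  have "{\<beta> \<in> pos_roots. \<beta> x < 0} \<subseteq> {\<beta> \<in> pos_roots. \<beta> \<circ> w \<in> neg_roots}"
  proof clarify
    fix \<beta> assume \<beta>: "\<beta> \<in> pos_roots" "\<beta> x < 0"
    then have "\<beta> \<circ> w \<notin> pos_roots" using pos_root_dominant[of "\<beta> \<circ> w" d] w by auto
    then show "\<beta> \<circ> w \<in> neg_roots"
      using root_pos_or_neg[OF root_comp[OF pos_root_is_root[OF \<beta>(1)] w(1)]] by blast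
  qed
  then show "finite {\<beta> \<in> pos_roots. \<beta> x < 0}" using finite_inversions[OF w(1)] finite_subset by blast
next
  assume "finite {\<beta> \<in> pos_roots. \<beta> x < 0}"
  then show "x \<in> Tits_cone"
  proof (induction "card {\<beta> \<in> pos_roots. \<beta> x < 0}" arbitrary: x rule: less_induct)
    case less
    show ?case
    proof (cases "x \<in> dominant")
      case True
      then show ?thesis by (rule dominant_Tits_cone)
    next
      case False
      then obtain i where i: "i \<in> I" "\<alpha> i x < 0" unfolding dominant_def by (auto simp: not_le)
      let ?s = "simple_refl i"
      let ?S = "{\<beta> \<in> pos_roots. \<beta> x < 0}" and ?T = "{\<beta> \<in> pos_roots. \<beta> (?s x) < 0}"
      have inj: "inj_on (\<lambda>\<beta>. \<beta> \<circ> ?s) ?T"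
        by (rule inj_on_inverseI[where g = "\<lambda>\<beta>. \<beta> \<circ> ?s"])
          (simp add: comp_assoc simple_refl_comp_self[OF i(1)])
      have sub: "(\<lambda>\<beta>. \<beta> \<circ> ?s) ` ?T \<subseteq> ?S - {\<alpha> i}"
      proof clarify
        fix \<beta> assume \<beta>: "\<beta> \<in> pos_roots" "\<beta> (?s x) < 0"
        have "\<alpha> i (?s x) > 0" using i by (simp add: simple_root_refl_self)
        then have ne: "\<beta> \<noteq> \<alpha> i" using \<beta>(2) by auto
        have "\<beta> \<circ> ?s \<noteq> \<alpha> i"
        proof
          assume eq: "\<beta> \<circ> ?s = \<alpha> i"
          obtain \<xi> where \<xi>: "\<xi> \<in> fund_chamber" using fund_chamber_nonempty by blast
          have "\<beta> \<xi> = (\<beta> \<circ> ?s) (?s \<xi>)" using i simple_refl_involution by simp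
          also have "\<dots> = - \<alpha> i \<xi>" unfolding eq using i simple_root_refl_self by simp
          finally show False
            using pos_root_fund_chamber[OF \<beta>(1) \<xi>] \<xi> i unfolding fund_chamber_def by fastforce
        qed
        then show "\<beta> \<circ> ?s \<in> ?S - {\<alpha> i}"
          using simple_refl_permutes_pos[OF \<beta>(1) i(1) ne] \<beta>(2) by simp
      qed
      have fin: "finite (?S - {\<alpha> i})" using less.prems by simp
      have \<alpha>S: "\<alpha> i \<in> ?S" using i simple_in_pos_roots by simp
      have "card ?T \<le> card (?S - {\<alpha> i})" using card_inj_on_le[OF inj sub fin] .
      also have "\<dots> < card ?S" using less.prems \<alpha>S by (rule card_Diff1_less)
      finally have "?s x \<in> Tits_cone"
        using less.hyps[of "?s x"] finite_imageD[OF finite_subset[OF sub fin] inj] by blast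
      then have "?s (?s x) \<in> Tits_cone" using Weyl_Tits_cone simple_refl_in_Weyl i by blast
      then show ?thesis using i simple_refl_involution by simp
    qed
  qed
qed

text \<open>A positive root that is negative at the combination is negative at one of the two
  points.\<close>

lemma Tits_cone_combination:
  assumes "x \<in> Tits_cone" "y \<in> Tits_cone" "a \<ge> 0" "b \<ge> 0"
  shows "a *\<^sub>R x + b *\<^sub>R y \<in> Tits_cone"
proof -
  have "{\<beta> \<in> pos_roots. \<beta> (a *\<^sub>R x + b *\<^sub>R y) < 0} \<subseteq> {\<beta> \<in> pos_roots. \<beta> x < 0} \<union> {\<beta> \<in> pos_roots. \<beta> y < 0}"
  proof clarify
    fix \<beta> assume \<beta>: "\<beta> \<in> pos_roots" "\<beta> (a *\<^sub>R x + b *\<^sub>R y) < 0" "\<not> \<beta> y < 0"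
    then have "a * \<beta> x + b * \<beta> y < 0"
      by (simp add: real_root_add real_root_scale pos_root_is_root)
    then show "\<beta> x < 0"
      using \<beta>(3) assms(3,4) by (smt (verit) mult_nonneg_nonneg)
  qed
  then show ?thesis using assms(1,2) unfolding Tits_cone_iff_finite by (meson finite_UnI finite_subset)
qed

section \<open>The height of the dominant representative of an orbit\<close>

definition orbit_ht :: "'a \<Rightarrow> real" where
  "orbit_ht \<mu> = ht (SOME d. d \<in> dominant \<and> (\<exists>w\<in>Weyl. \<mu> = w d))"

lemma ht_le_on_orbit: "d \<in> dominant \<Longrightarrow> w \<in> Weyl \<Longrightarrow> ht (w d) \<le> ht d"
  by (rule functional_le_on_orbit[OF linear_ht]) (simp_all add: ht_simple)

text \<open>Two dominant representatives lie in each other's orbit, so each height bounds the other;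
  comparing heights suffices to make the choice in \<open>orbit_ht\<close> harmless.\<close>

lemma orbit_ht_dominant:
  assumes d: "d \<in> dominant" and w: "w \<in> Weyl"
  shows "orbit_ht (w d) = ht d"
proof -
  define d' where "d' = (SOME d'. d' \<in> dominant \<and> (\<exists>w'\<in>Weyl. w d = w' d'))"
  have "d' \<in> dominant \<and> (\<exists>w'\<in>Weyl. w d = w' d')"
    unfolding d'_def by (rule someI[of _ d]) (use d w in blast)
  then obtain w' where w': "d' \<in> dominant" "w' \<in> Weyl" "w d = w' d'" by blast
  have "d = (inv w \<circ> w') d'" using w w'(3)[symmetric] by simp
  then have "ht d \<le> ht d'" using ht_le_on_orbit[OF w'(1)] Weyl_comp Weyl_inv w w'(2) by metis
  moreover have "d' = (inv w' \<circ> w) d" using w' by simp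
  then have "ht d' \<le> ht d" using ht_le_on_orbit[OF d] Weyl_comp Weyl_inv w w'(2) by metis
  ultimately show ?thesis unfolding orbit_ht_def d'_def[symmetric] by simp
qed

lemma orbit_ht_Weyl:
  assumes "\<mu> \<in> Tits_cone" and v: "v \<in> Weyl"
  shows "orbit_ht (v \<mu>) = orbit_ht \<mu>"
proof -
  obtain w d where w: "w \<in> Weyl" "d \<in> dominant" "\<mu> = w d"
    using assms(1) unfolding Tits_cone_iff_orbit by blast
  then show ?thesis using orbit_ht_dominant[OF w(2,1)] orbit_ht_dominant[OF w(2) Weyl_comp[OF v w(1)]] by simp
qed

lemma ht_le_orbit_ht: "\<mu> \<in> Tits_cone \<Longrightarrow> ht \<mu> \<le> orbit_ht \<mu>"
  unfolding Tits_cone_iff_orbit using ht_le_on_orbit orbit_ht_dominant by auto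

text \<open>The condition on \<open>k\<close> says that the new point is outside the segment from
  \<open>d\<close> to its reflection \<open>d - m \<gamma>\<close>-coroot. If \<open>k > 0\<close>,
  its own height is large enough; if \<open>k < - m\<close>, the height of its reflection is, with
  gain \<open>- (k + m)\<close> coroots. The minimum covers both.\<close>

lemma orbit_ht_increase_dominant:
  fixes k m :: int
  assumes \<gamma>: "\<gamma> \<in> pos_roots" and d: "d \<in> dominant" and m: "\<gamma> d = of_int m" and km: "k * (k + m) > 0"
    and T: "d + of_int k *\<^sub>R coroot \<gamma> \<in> Tits_cone"
  shows "orbit_ht (d + of_int k *\<^sub>R coroot \<gamma>) \<ge> ht d + of_int (min \<bar>k\<bar> \<bar>k + m\<bar>) * ht (coroot \<gamma>)"
proof -
  note R = pos_root_is_root[OF \<gamma>]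
  have h: "ht (coroot \<gamma>) \<ge> 0" using ht_pos_coroot[OF \<gamma>] by simp
  have m0: "m \<ge> 0" using pos_root_dominant[OF \<gamma> d] m by simp
  show ?thesis
  proof (cases "k > 0")
    case True
    have "of_int (min \<bar>k\<bar> \<bar>k + m\<bar>) * ht (coroot \<gamma>) \<le> of_int k * ht (coroot \<gamma>)"
      using True h by (intro mult_right_mono) auto
    then show ?thesis
      using ht_le_orbit_ht[OF T] by (simp add: ht_add ht_scale)
  next
    case False
    then have k: "k < 0" "k + m < 0" using km by (auto simp: zero_less_mult_iff)
    have refl: "root_refl \<gamma> (d + of_int k *\<^sub>R coroot \<gamma>) = d + of_int k *\<^sub>R coroot \<gamma> - (of_int m + of_int k * 2) *\<^sub>R coroot \<gamma>"
      using m root_coroot[OF R]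
      by (simp add: root_refl_apply[OF R] real_root_add[OF R] real_root_scale[OF R])
    have "ht (root_refl \<gamma> (d + of_int k *\<^sub>R coroot \<gamma>)) = ht d - of_int (k + m) * ht (coroot \<gamma>)"
      unfolding refl by (simp add: ht_add ht_diff ht_scale algebra_simps)
    moreover have "orbit_ht (root_refl \<gamma> (d + of_int k *\<^sub>R coroot \<gamma>)) = orbit_ht (d + of_int k *\<^sub>R coroot \<gamma>)"
      using orbit_ht_Weyl[OF T root_refl_in_Weyl[OF R]] .
    ultimately have "ht d - of_int (k + m) * ht (coroot \<gamma>) \<le> orbit_ht (d + of_int k *\<^sub>R coroot \<gamma>)"
      using ht_le_orbit_ht[OF Weyl_Tits_cone[OF root_refl_in_Weyl[OF R] T]] by simp
    moreover have "of_int (min \<bar>k\<bar> \<bar>k + m\<bar>) * ht (coroot \<gamma>) \<le> of_int (- (k + m)) * ht (coroot \<gamma>)"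
      using k h by (intro mult_right_mono) linarith+
    ultimately show ?thesis unfolding of_int_minus mult_minus_left by linarith
  qed
qed

text \<open>Applying the inverse of \<open>v\<close> reduces to a dominant base point. If \<beta>
  composed with \<open>v\<close> is negative, its negative is used with \<open>- k\<close> and
  \<open>- m\<close>, which changes neither the product nor the minimum.\<close>

lemma orbit_ht_increase:
  fixes k m :: int
  assumes v: "v \<in> Weyl" and d: "d \<in> dominant" and \<beta>: "\<beta> \<in> real_roots"
    and m: "\<beta> (v d) = of_int m" and km: "k * (k + m) > 0"
    and T: "v d + of_int k *\<^sub>R coroot \<beta> \<in> Tits_cone"
  shows "\<exists>\<gamma>\<in>pos_roots. (\<beta> = \<gamma> \<circ> inv v \<or> \<beta> = (\<lambda>x. - \<gamma> (inv v x))) \<and>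
    orbit_ht (v d + of_int k *\<^sub>R coroot \<beta>) \<ge> ht d + of_int (min \<bar>k\<bar> \<bar>k + m\<bar>) * ht (coroot \<gamma>)"
proof -
  note v' = Weyl_inv[OF v]
  let ?\<delta> = "\<beta> \<circ> v" and ?\<mu> = "v d + of_int k *\<^sub>R coroot \<beta>"
  have R: "?\<delta> \<in> real_roots" using \<beta> v root_comp by blast
  have "coroot ?\<delta> = inv v (coroot \<beta>)" using coroot_comp[OF \<beta> v'] v by simp
  then have eq: "inv v ?\<mu> = d + of_int k *\<^sub>R coroot ?\<delta>"
    using v by (simp add: Weyl_add[OF v'] Weyl_scale[OF v'])
  have T': "inv v ?\<mu> \<in> Tits_cone" using Weyl_Tits_cone[OF v' T] .
  have oh: "orbit_ht (inv v ?\<mu>) = orbit_ht ?\<mu>" using orbit_ht_Weyl[OF T v'] .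
  have \<beta>\<delta>: "\<beta> = ?\<delta> \<circ> inv v" using v by (simp add: comp_assoc)
  show ?thesis
  proof (cases "?\<delta> \<in> pos_roots")
    case True
    then show ?thesis
      using orbit_ht_increase_dominant[OF True d _ km, unfolded eq[symmetric], OF _ T'] m oh \<beta>\<delta>
      by (intro bexI[of _ ?\<delta>]) auto
  next
    case False
    let ?\<gamma> = "\<lambda>x. - ?\<delta> x"
    have \<gamma>: "?\<gamma> \<in> pos_roots" using root_pos_or_neg[OF R] False unfolding neg_roots_iff by blast
    have eq': "d + of_int (- k) *\<^sub>R coroot ?\<gamma> = inv v ?\<mu>"
      unfolding eq coroot_uminus[OF R] by simp
    have "- k * (- k + - m) > 0" using km by (simp add: algebra_simps)
    then have "ht d + of_int (min \<bar>- k\<bar> \<bar>- k + - m\<bar>) * ht (coroot ?\<gamma>) \<le> orbit_ht (inv v ?\<mu>)"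
      using orbit_ht_increase_dominant[OF \<gamma> d, of "- m" "- k"] m T' unfolding eq' by simp
    moreover have "\<bar>- k + - m\<bar> = \<bar>k + m\<bar>" by linarith
    moreover have "\<beta> = (\<lambda>x. - ?\<gamma> (inv v x))" using v by (simp add: fun_eq_iff)
    ultimately show ?thesis using \<gamma> oh by (intro bexI[of _ ?\<gamma>]) auto
  qed
qed

text \<open>The pairs \<open>(\<beta>, k)\<close> for which \<open>\<mu> + k \<beta>\<^sup>\<or>\<close> is the translation part of an element of
  \<open>W\<^sup>+\<close> that lies above one with translation part \<open>\<mu>\<close>; the two alternatives come from \<open>n \<noteq> 0\<close>
  and \<open>n = 0\<close>, where \<open>n = k + \<langle>\<mu>, \<beta>\<rangle>\<close>.\<close>

definition ascents :: "real \<Rightarrow> 'a \<Rightarrow> (('a \<Rightarrow> real) \<times> int) set" where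
  "ascents H \<mu> = {(\<beta>, k). \<beta> \<in> pos_roots \<and>
     (\<exists>m::int. \<beta> \<mu> = of_int m \<and> (k * (k + m) > 0 \<or> k = - m \<and> m < 0)) \<and>
     \<mu> + of_int k *\<^sub>R coroot \<beta> \<in> Tits_cone \<and> orbit_ht (\<mu> + of_int k *\<^sub>R coroot \<beta>) \<le> H}"

text \<open>For a positive product the gain in orbit height is an integer times the height of a
  coroot, both at least 1, so the ceiling \<open>H\<close> bounds each of them. The other
  alternative concerns only the finitely many positive roots that are negative at \<mu>.\<close>

lemma finite_ascents:
  assumes "\<mu> \<in> Tits_cone"
  shows "finite (ascents H \<mu>)"
proof -
  obtain v d where v: "v \<in> Weyl" "d \<in> dominant" "\<mu> = v d"
    using assms unfolding Tits_cone_iff_orbit by blast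
  define G where "G = {\<gamma> \<in> pos_roots. ht (coroot \<gamma>) \<le> H - ht d}"
  define B where "B = (\<lambda>\<gamma>. \<gamma> \<circ> inv v) ` G \<union> (\<lambda>\<gamma> x. - \<gamma> (inv v x)) ` G \<union> {\<beta> \<in> pos_roots. \<beta> \<mu> < 0}"
  define N where "N = \<lfloor>H - ht d\<rfloor>"
  \<comment> \<open>A bound \<open>N\<close> on the smaller of the absolute values of
    \<open>k\<close> and \<open>k + m\<close> bounds \<open>k\<close> itself only up to the size of
    \<open>m\<close>, which is the floor of the integer \<beta> \<mu>.\<close>
  define K where "K \<beta> = {- (\<bar>N\<bar> + \<bar>\<lfloor>\<beta> \<mu>\<rfloor>\<bar>)..\<bar>N\<bar> + \<bar>\<lfloor>\<beta> \<mu>\<rfloor>\<bar>}" for \<beta> :: "'a \<Rightarrow> real"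
  have "finite B"
    using finite_pos_roots_bounded assms unfolding B_def G_def Tits_cone_iff_finite by auto
  then have "finite (Sigma B K)" unfolding K_def by (intro finite_SigmaI) auto
  moreover have "ascents H \<mu> \<subseteq> Sigma B K"
  proof
    fix p assume "p \<in> ascents H \<mu>"
    then obtain \<beta> k and m :: int where p: "p = (\<beta>, k)" and \<beta>: "\<beta> \<in> pos_roots" and m: "\<beta> \<mu> = of_int m"
      and km: "k * (k + m) > 0 \<or> k = - m \<and> m < 0"
      and T: "\<mu> + of_int k *\<^sub>R coroot \<beta> \<in> Tits_cone" and H: "orbit_ht (\<mu> + of_int k *\<^sub>R coroot \<beta>) \<le> H"
      unfolding ascents_def by blast
    show "p \<in> Sigma B K"
    proof (cases "k * (k + m) > 0")
      case False
      then have "k = - m" "m < 0" using km by auto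
      then show ?thesis using \<beta> m unfolding p B_def K_def by auto
    next
      case True
      obtain \<gamma> where \<gamma>: "\<gamma> \<in> pos_roots" "\<beta> = \<gamma> \<circ> inv v \<or> \<beta> = (\<lambda>x. - \<gamma> (inv v x))"
        and le: "ht d + of_int (min \<bar>k\<bar> \<bar>k + m\<bar>) * ht (coroot \<gamma>) \<le> orbit_ht (\<mu> + of_int k *\<^sub>R coroot \<beta>)"
        using orbit_ht_increase[OF v(1,2) pos_root_is_root[OF \<beta>] _ True] m T v(3) by blast
      let ?p = "of_int (min \<bar>k\<bar> \<bar>k + m\<bar>) :: real"
      have "min \<bar>k\<bar> \<bar>k + m\<bar> \<ge> 1" using True by (auto simp: zero_less_mult_iff)
      then have p1: "?p \<ge> 1" by linarith
      have pH: "?p * ht (coroot \<gamma>) \<le> H - ht d" using le H by simp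
      have h: "ht (coroot \<gamma>) \<ge> 1" using ht_pos_coroot[OF \<gamma>(1)] .
      have "1 * ht (coroot \<gamma>) \<le> ?p * ht (coroot \<gamma>)" using p1 h by (intro mult_right_mono) auto
      then have "\<gamma> \<in> G" using pH \<gamma>(1) unfolding G_def by simp
      then have "\<beta> \<in> B" using \<gamma>(2) unfolding B_def by auto
      moreover have "?p * 1 \<le> ?p * ht (coroot \<gamma>)" using p1 h by (intro mult_left_mono) auto
      then have "?p \<le> H - ht d" using pH by simp
      then have "min \<bar>k\<bar> \<bar>k + m\<bar> \<le> N" unfolding N_def by linarith
      then have "k \<in> K \<beta>" unfolding K_def m by auto
      ultimately show ?thesis unfolding p by blast
    qed
  qed
  ultimately show ?thesis by (rule finite_subset[rotated])
qed

text \<open>Integrality makes every gain at least a full unit: both the factor of the coroot and the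
  height of a positive coroot are at least 1.\<close>

lemma ascent_measure:
  assumes \<mu>: "\<mu> \<in> Tits_cone" and a: "(\<beta>, k) \<in> ascents H \<mu>"
  defines "\<nu> \<equiv> \<mu> + of_int k *\<^sub>R coroot \<beta>"
  shows "orbit_ht \<mu> + 1 \<le> orbit_ht \<nu> \<or> orbit_ht \<mu> = orbit_ht \<nu> \<and> ht \<mu> + 1 \<le> ht \<nu>"
proof -
  obtain m :: int where \<beta>: "\<beta> \<in> pos_roots" and m: "\<beta> \<mu> = of_int m"
    and km: "k * (k + m) > 0 \<or> k = - m \<and> m < 0" and T: "\<nu> \<in> Tits_cone"
    using a unfolding ascents_def \<nu>_def by blast
  note R = pos_root_is_root[OF \<beta>]
  obtain v d where v: "v \<in> Weyl" "d \<in> dominant" "\<mu> = v d"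
    using \<mu> unfolding Tits_cone_iff_orbit by blast
  show ?thesis
  proof (cases "k * (k + m) > 0")
    case True
    obtain \<gamma> where \<gamma>: "\<gamma> \<in> pos_roots"
      and le: "ht d + of_int (min \<bar>k\<bar> \<bar>k + m\<bar>) * ht (coroot \<gamma>) \<le> orbit_ht \<nu>"
      using orbit_ht_increase[OF v(1,2) R _ True] m T v(3) unfolding \<nu>_def by blast
    have "min \<bar>k\<bar> \<bar>k + m\<bar> \<ge> 1" using True by (auto simp: zero_less_mult_iff)
    then have "1 * 1 \<le> of_int (min \<bar>k\<bar> \<bar>k + m\<bar>) * ht (coroot \<gamma>)"
      using ht_pos_coroot[OF \<gamma>] by (intro mult_mono) auto
    then show ?thesis using le orbit_ht_dominant[OF v(2,1)] v(3) by simp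
  next
    case False
    then have k: "k = - m" "m < 0" using km by auto
    have "\<nu> = root_refl \<beta> \<mu>" unfolding \<nu>_def root_refl_apply[OF R] m k by simp
    then have "orbit_ht \<nu> = orbit_ht \<mu>" using orbit_ht_Weyl[OF \<mu> root_refl_in_Weyl[OF R]] by simp
    moreover have "ht \<nu> = ht \<mu> + of_int k * ht (coroot \<beta>)"
      unfolding \<nu>_def by (simp add: ht_add ht_scale)
    moreover have "1 * 1 \<le> of_int k * ht (coroot \<beta>)"
      using ht_pos_coroot[OF \<beta>] k by (intro mult_mono) auto
    ultimately show ?thesis by simp
  qed
qed

lemma finite_ascending:
  "finite {\<nu>. (\<lambda>\<mu> \<nu>. \<mu> \<in> Tits_cone \<and> (\<exists>(\<beta>, k)\<in>ascents H \<mu>. \<nu> = \<mu> + of_int k *\<^sub>R coroot \<beta>))\<^sup>*\<^sup>* \<mu> \<nu>}"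
proof (rule finite_reachable)
  let ?R = "\<lambda>\<mu> \<nu>. \<mu> \<in> Tits_cone \<and> (\<exists>(\<beta>, k)\<in>ascents H \<mu>. \<nu> = \<mu> + of_int k *\<^sub>R coroot \<beta>)"
  show "wf {(\<nu>, \<mu>). ?R \<mu> \<nu>}"
  proof (rule wf_subset)
    \<comment> \<open>Both heights of a point that has been reached are at most \<open>H\<close>, so
      the distances to \<open>H\<close> are nonnegative there and drop lexicographically.\<close>
    show "wf (inv_image (less_than <*lex*> less_than) (\<lambda>\<mu>. (nat \<lceil>H - orbit_ht \<mu>\<rceil>, nat \<lceil>H - ht \<mu>\<rceil>)))"
      by (intro wf_inv_image wf_lex_prod wf_less_than)
    show "{(\<nu>, \<mu>). ?R \<mu> \<nu>} \<subseteq> inv_image (less_than <*lex*> less_than) (\<lambda>\<mu>. (nat \<lceil>H - orbit_ht \<mu>\<rceil>, nat \<lceil>H - ht \<mu>\<rceil>))"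
    proof clarify
      fix \<mu> \<beta> k assume \<mu>: "\<mu> \<in> Tits_cone" and a: "(\<beta>, k) \<in> ascents H \<mu>"
      let ?\<nu> = "\<mu> + of_int k *\<^sub>R coroot \<beta>"
      have "?\<nu> \<in> Tits_cone" "orbit_ht ?\<nu> \<le> H" using a unfolding ascents_def by auto
      moreover have "ht ?\<nu> \<le> orbit_ht ?\<nu>" using ht_le_orbit_ht calculation(1) .
      ultimately have "nat \<lceil>H - orbit_ht ?\<nu>\<rceil> < nat \<lceil>H - orbit_ht \<mu>\<rceil> \<or>
          orbit_ht ?\<nu> = orbit_ht \<mu> \<and> nat \<lceil>H - ht ?\<nu>\<rceil> < nat \<lceil>H - ht \<mu>\<rceil>"
        using ascent_measure[OF \<mu> a] nat_ceiling_less[of "H - orbit_ht ?\<nu>" "H - orbit_ht \<mu>"]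
          nat_ceiling_less[of "H - ht ?\<nu>" "H - ht \<mu>"] by auto
      then show "(?\<nu>, \<mu>) \<in> inv_image (less_than <*lex*> less_than) (\<lambda>\<mu>. (nat \<lceil>H - orbit_ht \<mu>\<rceil>, nat \<lceil>H - ht \<mu>\<rceil>))"
        by auto
    qed
  qed
next
  fix \<mu>
  show "finite {\<nu>. \<mu> \<in> Tits_cone \<and> (\<exists>(\<beta>, k)\<in>ascents H \<mu>. \<nu> = \<mu> + of_int k *\<^sub>R coroot \<beta>)}"
  proof (cases "\<mu> \<in> Tits_cone")
    case True
    have "{\<nu>. \<mu> \<in> Tits_cone \<and> (\<exists>(\<beta>, k)\<in>ascents H \<mu>. \<nu> = \<mu> + of_int k *\<^sub>R coroot \<beta>)} =
      (\<lambda>(\<beta>, k). \<mu> + of_int k *\<^sub>R coroot \<beta>) ` ascents H \<mu>"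
      using True by auto
    then show ?thesis using finite_ascents[OF True] by simp
  qed simp
qed

subsection \<open>Finiteness of Bruhat intervals\<close>

lemma Wplus_iff: "(\<mu>, w) \<in> Wplus \<longleftrightarrow> \<mu> \<in> Y \<and> \<mu> \<in> Tits_cone \<and> w \<in> Weyl"
  unfolding Wplus_def Yplus_def by auto

lemma aff_mult_aff_refl:
  assumes "\<beta> \<in> real_roots" "\<beta> \<mu> = of_int m"
  shows "aff_mult (aff_refl \<beta> n) (\<mu>, w) = (\<mu> - of_int (m - n) *\<^sub>R coroot \<beta>, root_refl \<beta> \<circ> w)"
  using assms by (simp add: aff_mult_def aff_refl_def root_refl_apply scaleR_left_diff_distrib)

text \<open>The condition places \<open>n\<close> between 0 and \<open>m\<close>, so the new
  translation part lies on the segment from the reflection of \<mu> (\<open>n = 0\<close>) to \<mu>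
  (\<open>n = m\<close>); convexity of the Tits cone applies.\<close>

lemma aff_bruhat_step_segment:
  assumes \<mu>: "\<mu> \<in> Tits_cone" and \<beta>: "\<beta> \<in> real_roots" and m: "\<beta> \<mu> = of_int m"
    and n: "of_int \<bar>n\<bar> \<le> sgn_int n * of_int m"
  shows "\<mu> - of_int (m - n) *\<^sub>R coroot \<beta> \<in> Tits_cone"
proof (cases "m = 0")
  case True
  then show ?thesis using \<mu> n by simp
next
  case False
  define t where "t = of_int (m - n) / (of_int m :: real)"
  have "(n \<ge> 0 \<and> n \<le> m) \<or> (n < 0 \<and> m \<le> n)"
    using n by (auto simp: sgn_int_def split: if_splits)
  then have t: "0 \<le> t" "0 \<le> 1 - t"
    using False by (auto simp: t_def field_simps)
  have "(1 - t) *\<^sub>R \<mu> + t *\<^sub>R root_refl \<beta> \<mu> \<in> Tits_cone"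
    using \<mu> Weyl_Tits_cone[OF root_refl_in_Weyl[OF \<beta>] \<mu>] t by (intro Tits_cone_combination) auto
  also have "(1 - t) *\<^sub>R \<mu> + t *\<^sub>R root_refl \<beta> \<mu> = \<mu> - (t * of_int m) *\<^sub>R coroot \<beta>"
    by (simp add: root_refl_apply[OF \<beta>] m algebra_simps)
  also have "t * of_int m = of_int (m - n)" using False by (simp add: t_def)
  finally show ?thesis .
qed

text \<open>Reads a step from below, as \<open>ascents\<close> does. The integer \<open>k\<close> is
  the multiple of the coroot leading back from \<mu>' to \<mu>, and \<open>m\<close>, the value of
  \<beta> at \<mu>', satisfies \<open>k + m = n\<close>; only \<open>k = 0\<close> leaves the
  translation part unchanged.\<close>

lemma aff_bruhat_step_cases:
  assumes "aff_bruhat_step z' z"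
  obtains \<mu> w \<beta> \<mu>' where "z = (\<mu>, w)" "z' = (\<mu>', root_refl \<beta> \<circ> w)" "\<beta> \<in> pos_roots"
    "z \<in> Wplus" "z' \<in> Wplus"
    "(\<exists>k m :: int. \<beta> \<mu>' = of_int m \<and> \<mu> = \<mu>' + of_int k *\<^sub>R coroot \<beta> \<and> (k * (k + m) > 0 \<or> k = - m \<and> m < 0)) \<or>
     \<mu>' = \<mu> \<and> (\<beta> \<mu> \<ge> 0 \<and> \<beta> \<circ> w \<in> neg_roots \<or> \<beta> \<mu> < 0 \<and> \<beta> \<circ> w \<in> pos_roots)"
  using assms
proof cases
  case (1 \<mu> w \<beta> n)
  have \<mu>: "\<mu> \<in> Y" "\<mu> \<in> Tits_cone" and w: "w \<in> Weyl" using 1(3) Wplus_iff by auto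
  note \<beta> = pos_root_is_root[OF 1(4)]
  obtain m0 :: int where m0: "\<beta> \<mu> = of_int m0"
    using real_root_int[OF \<beta> \<mu>(1)] by (auto elim: Ints_cases)
  define k where "k = m0 - n"
  define m where "m = 2 * n - m0"
  let ?\<mu>' = "\<mu> - of_int k *\<^sub>R coroot \<beta>"
  have z': "z' = (?\<mu>', root_refl \<beta> \<circ> w)"
    unfolding 1(1) k_def by (rule aff_mult_aff_refl[OF \<beta> m0])
  have le: "of_int \<bar>n\<bar> \<le> sgn_int n * (of_int m0 :: real)" using 1(5) m0 by auto
  have T: "?\<mu>' \<in> Tits_cone"
    using aff_bruhat_step_segment[OF \<mu>(2) \<beta> m0 le] by (simp add: k_def)
  have "\<mu> + of_int (- k) *\<^sub>R coroot \<beta> \<in> Y"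
    using \<mu>(1) coroot_in_lattice[OF \<beta>] by (intro lattice_add lattice_scale)
  then have Y': "?\<mu>' \<in> Y" by simp
  have z'W: "z' \<in> Wplus"
    unfolding z' Wplus_iff using T Y' Weyl_comp root_refl_in_Weyl[OF \<beta>] w by blast
  have m: "\<beta> ?\<mu>' = of_int m"
    by (simp add: real_root_diff[OF \<beta>] real_root_scale[OF \<beta>]
        root_coroot[OF \<beta>] m0 m_def k_def)
  have kn: "k + m = n" by (simp add: k_def m_def)
  have act: "dual_act (inv w) \<beta> = \<beta> \<circ> w" using w by (simp add: dual_act_def)
  have "(k * (k + m) > 0 \<or> k = - m \<and> m < 0) \<or> k = 0 \<and> (\<beta> \<mu> \<ge> 0 \<and> \<beta> \<circ> w \<in> neg_roots \<or> \<beta> \<mu> < 0 \<and> \<beta> \<circ> w \<in> pos_roots)"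
  proof (cases "k = 0")
    case True
    then have "m0 = n" by (simp add: k_def)
    then have eq: "(\<lambda>x. sgn_int n * (\<beta> \<circ> w) x) \<in> neg_roots"
      using 1(5) m0 unfolding act by (auto simp: sgn_int_def split: if_splits)
    show ?thesis
    proof (cases "n \<ge> 0")
      case True
      then show ?thesis using eq \<open>k = 0\<close> m0 \<open>m0 = n\<close> by (simp add: sgn_int_def comp_def)
    next
      case False
      then have "\<beta> \<circ> w \<in> pos_roots" using eq by (simp add: sgn_int_def neg_roots_iff comp_def)
      then show ?thesis using False \<open>k = 0\<close> m0 \<open>m0 = n\<close> by simp
    qed
  next
    case False
    consider "n > 0" | "n = 0" | "n < 0" by linarith
    then show ?thesis
    proof cases
      case 1
      then have "k > 0" using le False by (auto simp: sgn_int_def k_def)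
      then show ?thesis using 1 kn by simp
    next
      case 2
      then show ?thesis using le False by (auto simp: sgn_int_def k_def m_def)
    next
      case 3
      then have "k < 0" using le False by (auto simp: sgn_int_def k_def)
      then show ?thesis using 3 kn by (simp add: mult_neg_neg)
    qed
  qed
  then show ?thesis
  proof (elim disjE[where P = "k * (k + m) > 0 \<or> k = - m \<and> m < 0"])
    assume a: "k * (k + m) > 0 \<or> k = - m \<and> m < 0"
    show ?thesis
    proof (rule that[OF 1(2) z' 1(4)])
      show "z \<in> Wplus" "z' \<in> Wplus" using 1(2,3) z'W by auto
    qed (rule disjI1, intro exI[of _ k] exI[of _ m], use a m in simp)
  next
    assume a: "k = 0 \<and> (\<beta> \<mu> \<ge> 0 \<and> \<beta> \<circ> w \<in> neg_roots \<or> \<beta> \<mu> < 0 \<and> \<beta> \<circ> w \<in> pos_roots)"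
    show ?thesis
    proof (rule that[OF 1(2) z' 1(4)])
      show "z \<in> Wplus" "z' \<in> Wplus" using 1(2,3) z'W by auto
    qed (rule disjI2, use a in simp)
  qed
qed

section \<open>Steps that change only the Weyl group part\<close>

definition dom_elt :: "'a \<Rightarrow> 'a \<Rightarrow> 'a" where
  "dom_elt \<mu> = arg_min Weyl_length (\<lambda>v. v \<in> Weyl \<and> inv v \<mu> \<in> dominant)"

lemma dom_elt:
  assumes "\<mu> \<in> Tits_cone"
  shows "dom_elt \<mu> \<in> Weyl" "inv (dom_elt \<mu>) \<mu> \<in> dominant"
    and "\<And>v. v \<in> Weyl \<Longrightarrow> inv v \<mu> \<in> dominant \<Longrightarrow> Weyl_length (dom_elt \<mu>) \<le> Weyl_length v"
proof -
  obtain v d where v: "v \<in> Weyl" "d \<in> dominant" "\<mu> = v d"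
    using assms unfolding Tits_cone_iff_orbit by blast
  then have P: "v \<in> Weyl \<and> inv v \<mu> \<in> dominant" by simp
  show "dom_elt \<mu> \<in> Weyl" "inv (dom_elt \<mu>) \<mu> \<in> dominant"
    using arg_min_natI[of "\<lambda>v. v \<in> Weyl \<and> inv v \<mu> \<in> dominant", OF P] unfolding dom_elt_def by auto
  show "Weyl_length (dom_elt \<mu>) \<le> Weyl_length v" if "v \<in> Weyl" "inv v \<mu> \<in> dominant" for v
    using arg_min_nat_le[of "\<lambda>v. v \<in> Weyl \<and> inv v \<mu> \<in> dominant" v Weyl_length] that
    unfolding dom_elt_def by simp
qed

lemma inv_root_refl: "\<beta> \<in> real_roots \<Longrightarrow> inv (root_refl \<beta>) = root_refl \<beta>"
  by (rule inv_unique_comp) (auto simp: root_refl_involution)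

text \<open>Let \<beta>' be \<beta> or its negative, whichever is nonnegative at \<mu>; then
  \<beta>' composed with \<open>w\<close> is negative in both cases. The root \<gamma> obtained by
  composing \<beta>' with \<open>v\<close> is positive: if it vanishes at the dominant
  representative, this is where minimality of \<open>v\<close> enters, since a negative \<gamma>
  would make s_\<beta> v a shorter choice. Strong exchange for \<gamma> gives the drop.\<close>

lemma same_translation_length:
  assumes \<mu>: "\<mu> \<in> Tits_cone" and \<beta>: "\<beta> \<in> pos_roots" and w: "w \<in> Weyl"
    and sgn: "\<beta> \<mu> \<ge> 0 \<and> \<beta> \<circ> w \<in> neg_roots \<or> \<beta> \<mu> < 0 \<and> \<beta> \<circ> w \<in> pos_roots"
  shows "Weyl_length (inv (dom_elt \<mu>) \<circ> (root_refl \<beta> \<circ> w)) < Weyl_length (inv (dom_elt \<mu>) \<circ> w)"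
proof -
  define v where "v = dom_elt \<mu>"
  note R = pos_root_is_root[OF \<beta>]
  have v: "v \<in> Weyl" "inv v \<mu> \<in> dominant" and v_min: "\<And>u. u \<in> Weyl \<Longrightarrow> inv u \<mu> \<in> dominant \<Longrightarrow> Weyl_length v \<le> Weyl_length u"
    using dom_elt[OF \<mu>] unfolding v_def by auto
  define \<beta>' where "\<beta>' = (if \<beta> \<mu> \<ge> 0 then \<beta> else (\<lambda>x. - \<beta> x))"
  have R': "\<beta>' \<in> real_roots" using R root_uminus by (simp add: \<beta>'_def)
  have refl: "root_refl \<beta>' = root_refl \<beta>" using R by (simp add: \<beta>'_def root_refl_uminus)
  have neg: "\<beta>' \<circ> w \<in> neg_roots"
    using sgn by (auto simp: \<beta>'_def neg_roots_iff comp_def)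
  have ge: "\<beta>' \<mu> \<ge> 0" by (simp add: \<beta>'_def)
  define \<gamma> where "\<gamma> = \<beta>' \<circ> v"
  have R\<gamma>: "\<gamma> \<in> real_roots" using R' v root_comp unfolding \<gamma>_def by blast
  have \<gamma>\<mu>: "\<gamma> (inv v \<mu>) = \<beta>' \<mu>" using v by (simp add: \<gamma>_def)
  have "\<gamma> \<notin> neg_roots"
  proof
    assume n: "\<gamma> \<in> neg_roots"
    then have "\<beta>' \<mu> = 0" using neg_root_dominant[OF n v(2)] \<gamma>\<mu> ge by simp
    then have b: "\<beta>' = \<beta>" "\<beta> \<mu> = 0" by (auto simp: \<beta>'_def split: if_splits)
    have "Weyl_length (root_refl \<beta> \<circ> v) < Weyl_length v"
      using strong_exchange[OF v(1) \<beta>] n b unfolding \<gamma>_def by simp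
    moreover have "inv (root_refl \<beta> \<circ> v) \<mu> = inv v \<mu>"
      using b by (simp add: Weyl_inv_comp[OF root_refl_in_Weyl[OF R] v(1)] inv_root_refl[OF R] root_refl_apply[OF R])
    ultimately show False
      using v_min[OF Weyl_comp[OF root_refl_in_Weyl[OF R] v(1)]] v(2) by simp
  qed
  then have \<gamma>: "\<gamma> \<in> pos_roots" using root_pos_or_neg[OF R\<gamma>] by blast
  have "\<gamma> \<circ> (inv v \<circ> w) = \<beta>' \<circ> w" using v(1) by (simp add: \<gamma>_def fun_eq_iff)
  then have "Weyl_length (root_refl \<gamma> \<circ> (inv v \<circ> w)) < Weyl_length (inv v \<circ> w)"
    using strong_exchange[OF Weyl_comp[OF Weyl_inv[OF v(1)] w] \<gamma>] neg by simp
  moreover have "root_refl \<gamma> = inv v \<circ> root_refl \<beta> \<circ> v"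
    using root_refl_comp[OF R' Weyl_inv[OF v(1)]] v(1) by (simp add: \<gamma>_def refl)
  then have "root_refl \<gamma> \<circ> (inv v \<circ> w) = inv v \<circ> (root_refl \<beta> \<circ> w)"
    using v(1) by (simp add: fun_eq_iff)
  ultimately show ?thesis unfolding v_def by simp
qed

lemma aff_bruhat_step_orbit_ht:
  assumes "aff_bruhat_step z' z"
  shows "fst z' = fst z \<or> (\<exists>(\<beta>, k)\<in>ascents (orbit_ht (fst z)) (fst z'). fst z = fst z' + of_int k *\<^sub>R coroot \<beta>)"
  using assms
proof (cases rule: aff_bruhat_step_cases)
  case (1 \<mu> w \<beta> \<mu>')
  then show ?thesis unfolding ascents_def by (auto simp: Wplus_iff)
qed

lemma ascents_mono: "H \<le> H' \<Longrightarrow> ascents H \<mu> \<subseteq> ascents H' \<mu>"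
  unfolding ascents_def by auto

lemma aff_bruhat_step_orbit_ht_le:
  assumes "aff_bruhat_step z' z"
  shows "orbit_ht (fst z') \<le> orbit_ht (fst z)"
proof -
  have T: "fst z' \<in> Tits_cone" using assms by (rule aff_bruhat_step_cases) (auto simp: Wplus_iff)
  show ?thesis
    using aff_bruhat_step_orbit_ht[OF assms]
  proof
    assume "\<exists>(\<beta>, k)\<in>ascents (orbit_ht (fst z)) (fst z'). fst z = fst z' + of_int k *\<^sub>R coroot \<beta>"
    then obtain \<beta> k where "(\<beta>, k) \<in> ascents (orbit_ht (fst z)) (fst z')" "fst z = fst z' + of_int k *\<^sub>R coroot \<beta>"
      by blast
    then show ?thesis using ascent_measure[OF T] by fastforce
  qed simp
qed

lemma aff_bruhat_steps_Wplus: "aff_bruhat_step\<^sup>*\<^sup>* z' z \<Longrightarrow> z \<in> Wplus \<Longrightarrow> z' \<in> Wplus"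
  by (induction rule: converse_rtranclp_induct) (auto elim: aff_bruhat_step_cases)

lemma aff_bruhat_steps_orbit_ht_le: "aff_bruhat_step\<^sup>*\<^sup>* z' z \<Longrightarrow> orbit_ht (fst z') \<le> orbit_ht (fst z)"
  by (induction rule: rtranclp_induct) (auto dest: aff_bruhat_step_orbit_ht_le)

definition bruhat_interval :: "'a \<times> ('a \<Rightarrow> 'a) \<Rightarrow> 'a \<times> ('a \<Rightarrow> 'a) \<Rightarrow> ('a \<times> ('a \<Rightarrow> 'a)) set" where
  "bruhat_interval y x = {z. aff_bruhat_step\<^sup>*\<^sup>* y z \<and> aff_bruhat_step\<^sup>*\<^sup>* z x}"

lemma finite_interval_translations:
  assumes x: "x \<in> Wplus"
  shows "finite (fst ` bruhat_interval y x)"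
proof -
  define H where "H = orbit_ht (fst x)"
  let ?R = "\<lambda>\<mu> \<nu>. \<mu> \<in> Tits_cone \<and> (\<exists>(\<beta>, k)\<in>ascents H \<mu>. \<nu> = \<mu> + of_int k *\<^sub>R coroot \<beta>)"
  have "?R\<^sup>*\<^sup>* (fst y) (fst z)" if "aff_bruhat_step\<^sup>*\<^sup>* y z" "aff_bruhat_step\<^sup>*\<^sup>* z x" for z
    using that
  proof (induction rule: rtranclp_induct)
    case (step z1 z2)
    have z1x: "aff_bruhat_step\<^sup>*\<^sup>* z1 x" using step by (meson converse_rtranclp_into_rtranclp)
    have T: "fst z1 \<in> Tits_cone" using aff_bruhat_steps_Wplus[OF z1x x] by (cases z1) (simp add: Wplus_iff)
    \<comment> \<open>Everything in the interval lies below \<open>x\<close>, so one ceiling serves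
      all steps of the climb.\<close>
    have "ascents (orbit_ht (fst z2)) (fst z1) \<subseteq> ascents H (fst z1)"
      using aff_bruhat_steps_orbit_ht_le[OF step.prems] unfolding H_def by (rule ascents_mono)
    then have "fst z1 = fst z2 \<or> ?R (fst z1) (fst z2)"
      using aff_bruhat_step_orbit_ht[OF step.hyps(2)] T by blast
    then show ?case
    proof
      assume "fst z1 = fst z2"
      then show ?case using step.IH[OF z1x] by simp
    next
      assume "?R (fst z1) (fst z2)"
      with step.IH[OF z1x] show ?case by (rule rtranclp.rtrancl_into_rtrancl)
    qed
  qed simp
  then have "fst ` bruhat_interval y x \<subseteq> {\<nu>. ?R\<^sup>*\<^sup>* (fst y) \<nu>}"
    unfolding bruhat_interval_def by auto
  then show ?thesis using finite_ascending finite_subset by blast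
qed

lemma finite_bruhat_interval:
  assumes x: "x \<in> Wplus"
  shows "finite (bruhat_interval y x)"
proof -
  define S where "S = bruhat_interval y x"
  define F where "F = fst ` S"
  define H where "H = orbit_ht (fst x)"
  have F: "finite F" unfolding F_def S_def by (rule finite_interval_translations[OF x])
  have SW: "z \<in> Wplus" if "z \<in> S" for z
    using that aff_bruhat_steps_Wplus x unfolding S_def bruhat_interval_def by blast
  have FT: "\<mu> \<in> Tits_cone" if "\<mu> \<in> F" for \<mu>
    using that SW unfolding F_def by (auto simp: Wplus_iff)
  let ?R = "\<lambda>z z'. aff_bruhat_step z' z \<and> z \<in> S \<and> z' \<in> S"
  \<comment> \<open>Floors for the two heights on the interval; they exist because its translation
    parts are already known to be finitely many.\<close>
  define c0 where "c0 = Min (orbit_ht ` F)"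
  define c1 where "c1 = Min (ht ` F)"
  let ?f = "\<lambda>z :: 'a \<times> ('a \<Rightarrow> 'a). (nat \<lceil>orbit_ht (fst z) - c0\<rceil>, nat \<lceil>ht (fst z) - c1\<rceil>,
     Weyl_length (inv (dom_elt (fst z)) \<circ> snd z))"
  have "wf {(z', z). ?R z z'}"
  proof (rule wf_subset)
    show "wf (inv_image (less_than <*lex*> less_than <*lex*> less_than) ?f)"
      by (intro wf_inv_image wf_lex_prod wf_less_than)
    show "{(z', z). ?R z z'} \<subseteq> inv_image (less_than <*lex*> less_than <*lex*> less_than) ?f"
    proof
      fix p assume "p \<in> {(z', z). ?R z z'}"
      then obtain z z' where p: "p = (z', z)" and step: "aff_bruhat_step z' z" and S: "z \<in> S" "z' \<in> S" by blast
      have z'F: "fst z' \<in> F" using S(2) unfolding F_def by blast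
      have c: "c0 \<le> orbit_ht (fst z')" "c1 \<le> ht (fst z')"
        using z'F F unfolding c0_def c1_def by auto
      have T: "fst z' \<in> Tits_cone" using FT z'F .
      show "p \<in> inv_image (less_than <*lex*> less_than <*lex*> less_than) ?f"
      proof (cases "fst z' = fst z")
        case False
        then obtain \<beta> k where bk: "(\<beta>, k) \<in> ascents (orbit_ht (fst z)) (fst z')" "fst z = fst z' + of_int k *\<^sub>R coroot \<beta>"
          using aff_bruhat_step_orbit_ht[OF step] by blast
        have "orbit_ht (fst z') + 1 \<le> orbit_ht (fst z) \<or> orbit_ht (fst z') = orbit_ht (fst z) \<and> ht (fst z') + 1 \<le> ht (fst z)"
          using ascent_measure[OF T bk(1)] bk(2) by simp
        then show ?thesis
          using c nat_ceiling_less[of "orbit_ht (fst z') - c0" "orbit_ht (fst z) - c0"]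
            nat_ceiling_less[of "ht (fst z') - c1" "ht (fst z) - c1"] unfolding p by auto
      next
        case True
        from step have "Weyl_length (inv (dom_elt (fst z')) \<circ> snd z') < Weyl_length (inv (dom_elt (fst z)) \<circ> snd z)"
        proof (cases rule: aff_bruhat_step_cases)
          case (1 \<mu> w \<beta> \<mu>')
          have eq: "\<mu>' = \<mu>" using True 1(1,2) by simp
          \<comment> \<open>A coroot is nonzero, so equal translation parts exclude the first
            alternative of the case rule, which forces \<open>k\<close> to be nonzero.\<close>
          have "\<mu> = \<mu>' + of_int k *\<^sub>R coroot \<beta> \<Longrightarrow> k = 0" for k :: int
            using eq ht_pos_coroot[OF 1(3)] ht_zero by auto
          then have "\<beta> \<mu> \<ge> 0 \<and> \<beta> \<circ> w \<in> neg_roots \<or> \<beta> \<mu> < 0 \<and> \<beta> \<circ> w \<in> pos_roots"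
            using 1(6) by fastforce
          then show ?thesis
            using same_translation_length[of \<mu> \<beta> w] 1(1-4) eq by (simp add: Wplus_iff)
        qed
        then show ?thesis using True unfolding p by simp
      qed
    qed
  qed
  moreover have "finite {z'. ?R z z'}" for z
  proof (cases "z \<in> S")
    case True
    obtain \<mu> w where z: "z = (\<mu>, w)" by (cases z)
    have W: "\<mu> \<in> Tits_cone" "w \<in> Weyl" using SW[OF True] unfolding z Wplus_iff by auto
    \<comment> \<open>The roots a descent from \<open>z\<close> can use: those of an ascent from
      some translation part in \<open>F\<close> back to \<mu>, or, with the translation part fixed,
      inversions of \<open>w\<close> and positive roots negative at \<mu>.\<close>
    define B where "B = (\<Union>\<mu>'\<in>F. fst ` ascents (orbit_ht \<mu>) \<mu>') \<union> {\<beta> \<in> pos_roots. \<beta> \<circ> w \<in> neg_roots} \<union> {\<beta> \<in> pos_roots. \<beta> \<mu> < 0}"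
    have "finite B"
      using F FT finite_ascents finite_inversions[OF W(2)] W(1) unfolding B_def Tits_cone_iff_finite by auto
    then have "finite ((\<lambda>(\<mu>', \<beta>). (\<mu>', root_refl \<beta> \<circ> w)) ` (F \<times> B))" using F by blast
    moreover have "{z'. ?R z z'} \<subseteq> (\<lambda>(\<mu>', \<beta>). (\<mu>', root_refl \<beta> \<circ> w)) ` (F \<times> B)"
    proof
      fix z' assume "z' \<in> {z'. ?R z z'}"
      then have step: "aff_bruhat_step z' z" and S: "z' \<in> S" by auto
      from step show "z' \<in> (\<lambda>(\<mu>', \<beta>). (\<mu>', root_refl \<beta> \<circ> w)) ` (F \<times> B)"
      proof (cases rule: aff_bruhat_step_cases)
        case (1 \<mu>1 w1 \<beta> \<mu>')
        then have eq: "\<mu>1 = \<mu>" "w1 = w" using z by auto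
        have \<mu>'F: "\<mu>' \<in> F" using S 1(2) unfolding F_def by force
        have "\<beta> \<in> B"
          using 1(6) unfolding eq
        proof
          assume "\<exists>k m :: int. \<beta> \<mu>' = of_int m \<and> \<mu> = \<mu>' + of_int k *\<^sub>R coroot \<beta> \<and> (k * (k + m) > 0 \<or> k = - m \<and> m < 0)"
          then obtain k m :: int where "\<beta> \<mu>' = of_int m" "\<mu> = \<mu>' + of_int k *\<^sub>R coroot \<beta>" "k * (k + m) > 0 \<or> k = - m \<and> m < 0"
            by blast
          then have "(\<beta>, k) \<in> ascents (orbit_ht \<mu>) \<mu>'"
            using 1(3) W(1) unfolding ascents_def by auto
          then show ?thesis using \<mu>'F unfolding B_def by force
        next
          assume "\<mu>' = \<mu> \<and> (\<beta> \<mu> \<ge> 0 \<and> \<beta> \<circ> w \<in> neg_roots \<or> \<beta> \<mu> < 0 \<and> \<beta> \<circ> w \<in> pos_roots)"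
          then show ?thesis using 1(3) unfolding B_def by auto
        qed
        then show ?thesis using \<mu>'F 1(2) eq by auto
      qed
    qed
    ultimately show ?thesis by (rule finite_subset[rotated])
  qed simp
  ultimately have "finite {z. ?R\<^sup>*\<^sup>* x z}" by (rule finite_reachable)
  moreover have "?R\<^sup>*\<^sup>* x z" if "aff_bruhat_step\<^sup>*\<^sup>* y z" "aff_bruhat_step\<^sup>*\<^sup>* z x" for z
    using that(2,1)
  proof (induction rule: converse_rtranclp_induct)
    case (step z1 z2)
    have y2: "aff_bruhat_step\<^sup>*\<^sup>* y z2" using step.prems step.hyps(1) by simp
    have "z1 \<in> S" "z2 \<in> S"
      using step.prems y2 step.hyps unfolding S_def bruhat_interval_def by auto
    then have "?R z2 z1" using step.hyps(1) by simp
    then show ?case using step.IH[OF y2] by (rule rtranclp.rtrancl_into_rtrancl[rotated])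
  qed simp
  then have "bruhat_interval y x \<subseteq> {z. ?R\<^sup>*\<^sup>* x z}" unfolding bruhat_interval_def by blast
  ultimately show ?thesis by (rule finite_subset[rotated])
qed

subsection \<open>Alcoves\<close>

lemma Weyl_bounded: "w \<in> Weyl \<Longrightarrow> \<exists>K>0. \<forall>x. norm (w x) \<le> K * norm x"
  using linear_bounded_finite_dimensional[OF _ _ _ Weyl_linear] finite_basis by blast

lemma dominant_0: "0 \<in> dominant"
  unfolding dominant_def by (auto simp: simple_root_zero)

lemma dominant_scale: "c \<in> dominant \<Longrightarrow> s \<ge> 0 \<Longrightarrow> s *\<^sub>R c \<in> dominant"
  unfolding dominant_def by (auto simp: simple_root_scale)

lemma dominant_scale_iff: "s > 0 \<Longrightarrow> s *\<^sub>R c \<in> dominant \<longleftrightarrow> c \<in> dominant"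
  unfolding dominant_def by (auto simp: simple_root_scale zero_le_mult_iff)

lemma sval_square: "sval \<epsilon> * sval \<epsilon> = 1"
  by (cases \<epsilon>) auto

lemma mem_closed_direction:
  assumes "w \<in> Weyl"
  shows "v \<in> closed_direction \<epsilon> w \<longleftrightarrow> inv w (sval \<epsilon> *\<^sub>R v) \<in> dominant"
proof -
  have "v \<in> closed_direction \<epsilon> w \<longleftrightarrow> sval \<epsilon> *\<^sub>R v \<in> closure (chamber w)"
    unfolding closed_direction_def by (cases \<epsilon>) (auto intro: image_eqI[of _ _ "- v"])
  then show ?thesis using mem_closure_chamber[OF assms] by simp
qed

lemma mem_sector:
  assumes "w \<in> Weyl"
  shows "z \<in> sector x \<epsilon> w \<longleftrightarrow> inv w (sval \<epsilon> *\<^sub>R (z - x)) \<in> dominant"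
proof -
  have "z \<in> sector x \<epsilon> w \<longleftrightarrow> z - x \<in> closed_direction \<epsilon> w"
    unfolding sector_def by (auto intro: image_eqI[of _ _ "z - x"])
  then show ?thesis using mem_closed_direction[OF assms] by simp
qed

lemma eventually_alcove_sector:
  "eventually P (alcove x \<epsilon> w) \<longleftrightarrow> (\<exists>r>0. \<forall>z\<in>sector x \<epsilon> w \<inter> ball x r. P z)"
proof -
  have "eventually P (alcove x \<epsilon> w) \<longleftrightarrow> (\<exists>r\<in>{0<..}. eventually P (principal (sector x \<epsilon> w \<inter> ball x r)))"
    unfolding alcove_def
  proof (rule eventually_INF_base)
    fix a b :: real assume "a \<in> {0<..}" "b \<in> {0<..}"
    then show "\<exists>r\<in>{0<..}. principal (sector x \<epsilon> w \<inter> ball x r) \<le>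
        inf (principal (sector x \<epsilon> w \<inter> ball x a)) (principal (sector x \<epsilon> w \<inter> ball x b))"
      by (intro bexI[of _ "min a b"]) auto
  qed auto
  then show ?thesis unfolding eventually_principal by auto
qed

lemma eventually_alcove:
  assumes w: "w \<in> Weyl"
  shows "eventually P (alcove x \<epsilon> w) \<longleftrightarrow> (\<exists>r>0. \<forall>c\<in>dominant. norm (w c) < r \<longrightarrow> P (x + sval \<epsilon> *\<^sub>R w c))"
proof -
  have "(\<forall>z\<in>sector x \<epsilon> w \<inter> ball x r. P z) \<longleftrightarrow> (\<forall>c\<in>dominant. norm (w c) < r \<longrightarrow> P (x + sval \<epsilon> *\<^sub>R w c))" for r
  proof (intro iffI ballI impI)
    fix c assume P: "\<forall>z\<in>sector x \<epsilon> w \<inter> ball x r. P z" and c: "c \<in> dominant" "norm (w c) < r"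
    have "x + sval \<epsilon> *\<^sub>R w c \<in> sector x \<epsilon> w"
      unfolding mem_sector[OF w] using c w by (simp add: sval_square)
    moreover have "x + sval \<epsilon> *\<^sub>R w c \<in> ball x r"
      using c by (cases \<epsilon>) (auto simp: dist_norm)
    ultimately show "P (x + sval \<epsilon> *\<^sub>R w c)" using P by blast
  next
    fix z assume P: "\<forall>c\<in>dominant. norm (w c) < r \<longrightarrow> P (x + sval \<epsilon> *\<^sub>R w c)" and z: "z \<in> sector x \<epsilon> w \<inter> ball x r"
    define c where "c = inv w (sval \<epsilon> *\<^sub>R (z - x))"
    have wc: "w c = sval \<epsilon> *\<^sub>R (z - x)" using w by (simp add: c_def)
    have "c \<in> dominant" using z mem_sector[OF w] unfolding c_def by blast
    moreover have "norm (w c) < r" unfolding wc using z by (cases \<epsilon>) (auto simp: dist_norm norm_minus_commute)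
    ultimately have "P (x + sval \<epsilon> *\<^sub>R w c)" using P by blast
    then show "P z" unfolding wc by (simp add: sval_square)
  qed
  then show ?thesis unfolding eventually_alcove_sector by simp
qed

lemma eventually_alcove_base_point: "w \<in> Weyl \<Longrightarrow> eventually P (alcove x \<epsilon> w) \<Longrightarrow> P x"
  unfolding eventually_alcove using dominant_0 Weyl_zero by fastforce

text \<open>The norm is not invariant under the Weyl group, so the balls on the two sides are
  compared through operator bounds for \<open>w\<close> and its inverse.\<close>

lemma alcove_of_eq_alcove:
  assumes w: "w \<in> Weyl"
  shows "alcove_of (\<mu>, w) = alcove (- \<mu>) Pos w"
proof -
  obtain K where K: "K > 0" "\<And>x. norm (w x) \<le> K * norm x" using Weyl_bounded[OF w] by blast
  obtain L where L: "L > 0" "\<And>x. norm (inv w x) \<le> L * norm x" using Weyl_bounded[OF Weyl_inv[OF w]] by blast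
  have "eventually P (alcove_of (\<mu>, w)) \<longleftrightarrow> eventually P (alcove (- \<mu>) Pos w)" for P
  proof -
    have "eventually P (alcove_of (\<mu>, w)) \<longleftrightarrow> (\<exists>r>0. \<forall>c\<in>dominant. norm c < r \<longrightarrow> P (- \<mu> + w c))"
      unfolding alcove_of_def alcove_act_def base_alcove_def eventually_filtermap eventually_alcove[OF Weyl_id]
      by (simp add: aff_act_def)
    also have "\<dots> \<longleftrightarrow> (\<exists>r>0. \<forall>c\<in>dominant. norm (w c) < r \<longrightarrow> P (- \<mu> + w c))"
    proof
      assume "\<exists>r>0. \<forall>c\<in>dominant. norm c < r \<longrightarrow> P (- \<mu> + w c)"
      then obtain r where r: "r > 0" "\<And>c. c \<in> dominant \<Longrightarrow> norm c < r \<Longrightarrow> P (- \<mu> + w c)" by blast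
      have "norm c < r" if "norm (w c) < r / L" for c
      proof -
        have "norm c \<le> L * norm (w c)" using L(2)[of "w c"] w by simp
        also have "\<dots> < r" using that L(1) by (simp add: field_simps)
        finally show ?thesis .
      qed
      then show "\<exists>r>0. \<forall>c\<in>dominant. norm (w c) < r \<longrightarrow> P (- \<mu> + w c)"
        using r L(1) by (intro exI[of _ "r / L"]) auto
    next
      assume "\<exists>r>0. \<forall>c\<in>dominant. norm (w c) < r \<longrightarrow> P (- \<mu> + w c)"
      then obtain r where r: "r > 0" "\<And>c. c \<in> dominant \<Longrightarrow> norm (w c) < r \<Longrightarrow> P (- \<mu> + w c)" by blast
      have "norm (w c) < r" if "norm c < r / K" for c
      proof -
        have "norm (w c) \<le> K * norm c" using K(2) .
        also have "\<dots> < r" using that K(1) by (simp add: field_simps)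
        finally show ?thesis .
      qed
      then show "\<exists>r>0. \<forall>c\<in>dominant. norm c < r \<longrightarrow> P (- \<mu> + w c)"
        using r K(1) by (intro exI[of _ "r / K"]) auto
    qed
    also have "\<dots> \<longleftrightarrow> eventually P (alcove (- \<mu>) Pos w)"
      unfolding eventually_alcove[OF w] by simp
    finally show ?thesis .
  qed
  then show ?thesis by (simp add: filter_eq_iff)
qed

lemma alcove_le_sector_dominant:
  assumes w: "w \<in> Weyl" and u: "u \<in> Weyl" and \<xi>: "\<xi> \<in> dominant"
    and le: "alcove x \<epsilon> w \<le> principal (sector x \<epsilon>' u)"
  shows "(sval \<epsilon> * sval \<epsilon>') *\<^sub>R inv u (w \<xi>) \<in> dominant"
proof -
  obtain r where r: "r > 0" "\<And>c. c \<in> dominant \<Longrightarrow> norm (w c) < r \<Longrightarrow> x + sval \<epsilon> *\<^sub>R w c \<in> sector x \<epsilon>' u"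
    using le unfolding le_principal eventually_alcove[OF w] by blast
  obtain s where s: "s > 0" "\<And>s'. 0 < s' \<Longrightarrow> s' \<le> s \<Longrightarrow> s' * norm (w \<xi>) < r"
    using scale_below[OF norm_ge_zero r(1)] by blast
  have "norm (w (s *\<^sub>R \<xi>)) < r" using s by (simp add: Weyl_scale[OF w])
  then have "x + sval \<epsilon> *\<^sub>R w (s *\<^sub>R \<xi>) \<in> sector x \<epsilon>' u"
    using r(2) dominant_scale[OF \<xi>] s(1) by simp
  then have "s *\<^sub>R ((sval \<epsilon> * sval \<epsilon>') *\<^sub>R inv u (w \<xi>)) \<in> dominant"
    unfolding mem_sector[OF u]
    by (simp add: Weyl_scale[OF w] Weyl_scale[OF Weyl_inv[OF u]] mult_ac)
  then show ?thesis using dominant_scale_iff[OF s(1)] by blast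
qed

lemma alcove_le_own_sector: "w \<in> Weyl \<Longrightarrow> alcove x \<epsilon> w \<le> principal (sector x \<epsilon> w)"
  unfolding le_principal eventually_alcove_sector by (intro exI[of _ 1]) auto

lemma alcove_base_point_unique:
  assumes "w \<in> Weyl" "w' \<in> Weyl" "alcove x \<epsilon> w = alcove x' \<epsilon>' w'"
  shows "x = x'"
proof (rule ccontr)
  assume "x \<noteq> x'"
  have "eventually (\<lambda>z. z \<in> ball x' (dist x x')) (alcove x' \<epsilon>' w')"
    unfolding eventually_alcove_sector using \<open>x \<noteq> x'\<close> by (intro exI[of _ "dist x x'"]) auto
  then have "x \<in> ball x' (dist x x')"
    using eventually_alcove_base_point[OF assms(1), of "\<lambda>z. z \<in> ball x' (dist x x')" x \<epsilon>] assms(3) by simp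
  then show False by (simp add: dist_commute)
qed

lemma alcove_direction_unique:
  assumes w: "w \<in> Weyl" and w': "w' \<in> Weyl" and eq: "alcove x \<epsilon> w = alcove x' \<epsilon> w'"
  shows "w = w'"
proof -
  obtain \<xi> where \<xi>: "\<xi> \<in> fund_chamber" using fund_chamber_nonempty by blast
  have "x = x'" using alcove_base_point_unique[OF w w' eq] .
  then have "alcove x \<epsilon> w \<le> principal (sector x \<epsilon> w')" using alcove_le_own_sector[OF w'] eq by simp
  then have "(inv w' \<circ> w) \<xi> \<in> dominant"
    using alcove_le_sector_dominant[OF w w' fund_chamber_dominant[OF \<xi>], of x \<epsilon> \<epsilon>] by (simp add: sval_square)
  then have "inv w' \<circ> w = id" using Weyl_eq_id[OF Weyl_comp[OF Weyl_inv[OF w'] w] \<xi>] by simp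
  then show ?thesis using w' by (metis Weyl_comp_inv(1) comp_assoc comp_id id_comp)
qed

lemma alcove_dist_eq:
  assumes "w1 \<in> Weyl" "w2 \<in> Weyl"
  shows "alcove_dist \<epsilon> (alcove x \<epsilon> w1) (alcove x \<epsilon> w2) = inv w1 \<circ> w2"
  unfolding alcove_dist_def
proof (rule the_equality)
  show "\<exists>x'. \<exists>w1'\<in>Weyl. \<exists>w2'\<in>Weyl. alcove x \<epsilon> w1 = alcove x' \<epsilon> w1' \<and> alcove x \<epsilon> w2 = alcove x' \<epsilon> w2' \<and>
      inv w1 \<circ> w2 = inv w1' \<circ> w2'"
    using assms by blast
qed (use assms alcove_direction_unique in blast)

lemma alcove_codist_eq:
  assumes "w1 \<in> Weyl" "w2 \<in> Weyl"
  shows "alcove_codist \<epsilon> (alcove x \<epsilon> w1) (alcove x (opp \<epsilon>) w2) = inv w1 \<circ> w2"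
  unfolding alcove_codist_def
proof (rule the_equality)
  show "\<exists>x'. \<exists>w1'\<in>Weyl. \<exists>w2'\<in>Weyl. alcove x \<epsilon> w1 = alcove x' \<epsilon> w1' \<and>
      alcove x (opp \<epsilon>) w2 = alcove x' (opp \<epsilon>) w2' \<and> inv w1 \<circ> w2 = inv w1' \<circ> w2'"
    using assms by blast
qed (use assms alcove_direction_unique in blast)

section \<open>Alcoves that carry both signs\<close>

lemma opposite_chamber_image:
  assumes w0: "w0 \<in> Weyl" and \<xi>: "\<xi> \<in> fund_chamber" "- w0 \<xi> \<in> dominant"
  shows "- w0 \<xi> \<in> fund_chamber" and "c \<in> dominant \<Longrightarrow> - w0 c \<in> dominant"
proof -
  have neg: "\<alpha> i \<circ> w0 \<in> neg_roots" if i: "i \<in> I" for i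
  proof -
    have R: "\<alpha> i \<circ> w0 \<in> real_roots" using root_comp[OF simple_in_real_roots[OF i] w0] .
    have "\<alpha> i (w0 \<xi>) \<le> 0" using \<xi>(2) i unfolding dominant_def by (auto simp: simple_root_neg)
    then show ?thesis
      using neg_root_iff_fund_chamber[OF R \<xi>(1)] root_fund_chamber_nonzero[OF R \<xi>(1)] by simp
  qed
  show "- w0 \<xi> \<in> fund_chamber"
    using neg_root_fund_chamber[OF neg \<xi>(1)] unfolding fund_chamber_def by (auto simp: simple_root_neg)
  show "- w0 c \<in> dominant" if "c \<in> dominant"
    using neg_root_dominant[OF neg that] unfolding dominant_def by (auto simp: simple_root_neg)
qed

lemma opposite_chamber_inv:
  assumes w0: "w0 \<in> Weyl" and \<xi>: "\<xi> \<in> fund_chamber" "- w0 \<xi> \<in> dominant"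
  shows "- inv w0 (- w0 \<xi>) \<in> dominant"
  using w0 fund_chamber_dominant[OF \<xi>(1)] by (simp add: Weyl_neg[OF Weyl_inv])

lemma opposite_chamber:
  assumes w0: "w0 \<in> Weyl" and \<xi>: "\<xi> \<in> fund_chamber" "- w0 \<xi> \<in> dominant"
  shows "- w0 c \<in> dominant \<longleftrightarrow> c \<in> dominant"
proof
  show "c \<in> dominant \<Longrightarrow> - w0 c \<in> dominant" using opposite_chamber_image(2)[OF assms] .
  assume "- w0 c \<in> dominant"
  then have "- inv w0 (- w0 c) \<in> dominant"
    using opposite_chamber_image(2)[OF Weyl_inv[OF w0] opposite_chamber_image(1)[OF assms] opposite_chamber_inv[OF assms]] by blast
  then show "c \<in> dominant" using w0 by (simp add: Weyl_neg[OF Weyl_inv])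
qed

text \<open>The hypothesis makes \<open>inv u' \<circ> u\<close> the longest element of a finite
  Weyl group; its negative preserves the dominant cone, so the two sectors are the same set.\<close>

lemma opposite_alcove_eq:
  assumes u: "u \<in> Weyl" and u': "u' \<in> Weyl" and \<xi>: "\<xi> \<in> fund_chamber" "- inv u' (u \<xi>) \<in> dominant"
  shows "alcove x Neg u = alcove x Pos u'"
proof -
  have W: "inv u' \<circ> u \<in> Weyl" using u u' Weyl_comp Weyl_inv by blast
  have "z \<in> sector x Neg u \<longleftrightarrow> z \<in> sector x Pos u'" for z
  proof -
    have "z \<in> sector x Pos u' \<longleftrightarrow> - (inv u' \<circ> u) (inv u (- (z - x))) \<in> dominant"
      unfolding mem_sector[OF u'] o_apply Weyl_inv_cancel(1)[OF u]
        Weyl_neg[OF Weyl_inv[OF u']] by simp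
    also have "\<dots> \<longleftrightarrow> inv u (- (z - x)) \<in> dominant"
      using opposite_chamber[OF W \<xi>(1)] \<xi>(2) by simp
    also have "\<dots> \<longleftrightarrow> z \<in> sector x Neg u" unfolding mem_sector[OF u] by simp
    finally show ?thesis by blast
  qed
  then have "sector x Neg u = sector x Pos u'" by blast
  then show ?thesis unfolding alcove_def by simp
qed

lemma opposite_alcove_dominant:
  assumes u: "u \<in> Weyl" and u': "u' \<in> Weyl" and eq: "alcove x Neg u = alcove x Pos u'" and \<xi>: "\<xi> \<in> dominant"
  shows "- (inv u' \<circ> u) \<xi> \<in> dominant"
  using alcove_le_sector_dominant[OF u u' \<xi>, of x Neg Pos] alcove_le_own_sector[OF u', of x Pos] eq by simp

section \<open>Signs of roots and chambers near a spherical vector\<close>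

lemma linear_functional_sign_near:
  fixes f :: "'a \<Rightarrow> real"
  assumes "linear f" "f \<nu> \<noteq> 0"
  shows "\<exists>r>0. \<forall>x. norm x < r \<longrightarrow> f (\<nu> - x) * f \<nu> > 0"
proof -
  obtain K where K: "K > 0" "\<And>x. \<bar>f x\<bar> \<le> K * norm x" using functional_bounded[OF assms(1)] by blast
  have "f (\<nu> - x) * f \<nu> > 0" if "norm x < \<bar>f \<nu>\<bar> / K" for x
  proof -
    have "\<bar>f x\<bar> < \<bar>f \<nu>\<bar>" using K(2)[of x] that K(1) by (simp add: field_simps)
    then show ?thesis by (auto simp: linear_diff[OF assms(1)] zero_less_mult_iff)
  qed
  then show ?thesis using K(1) assms(2) by (intro exI[of _ "\<bar>f \<nu>\<bar> / K"]) auto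
qed

text \<open>The positive roots that are nonnegative at the vertices of a cross-polytope around \<open>\<nu>\<close>
  inside the Tits cone are positive near \<open>\<nu>\<close>, uniformly; only finitely many roots are left.\<close>

lemma pos_roots_near_spherical:
  assumes "spherical \<nu>"
  shows "\<exists>E r. finite E \<and> r > 0 \<and> (\<forall>\<beta>\<in>pos_roots - E. \<forall>x. norm x < r \<longrightarrow> \<beta> (\<nu> - x) > 0)"
proof -
  obtain r0 where r0: "r0 > 0" "ball \<nu> r0 \<subseteq> Tits_cone"
    using assms unfolding spherical_def mem_interior by blast
  obtain B :: "'a set" where B: "finite B" "independent B" "span B = UNIV" using finite_basis by blast
  obtain m where m: "m > 0" "\<And>c. m * (\<Sum>b\<in>B. \<bar>c b\<bar>) \<le> norm (\<Sum>b\<in>B. c b *\<^sub>R b)"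
    using independent_coefficients_bounded[OF B(1,2)] by blast
  obtain \<eta> where \<eta>: "\<eta> > 0" "\<And>b. b \<in> B \<Longrightarrow> \<eta> * norm b < r0"
  proof -
    obtain s where s: "s > 0" "\<And>s'. 0 < s' \<Longrightarrow> s' \<le> s \<Longrightarrow> s' * (\<Sum>b\<in>B. norm b) < r0"
      using scale_below[OF sum_nonneg r0(1), of B norm] by auto
    have "s * norm b < r0" if "b \<in> B" for b
    proof -
      have "norm b \<le> (\<Sum>b\<in>B. norm b)" using that B(1) by (intro member_le_sum) auto
      then have "s * norm b \<le> s * (\<Sum>b\<in>B. norm b)" using s(1) by simp
      then show ?thesis using s(1) s(2)[of s] by linarith
    qed
    then show ?thesis using that s(1) by blast
  qed
  define E where "E = (\<Union>b\<in>B. {\<beta> \<in> pos_roots. \<beta> (\<nu> + \<eta> *\<^sub>R b) < 0} \<union> {\<beta> \<in> pos_roots. \<beta> (\<nu> - \<eta> *\<^sub>R b) < 0})"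
  have "\<nu> + \<eta> *\<^sub>R b \<in> Tits_cone" "\<nu> - \<eta> *\<^sub>R b \<in> Tits_cone" if "b \<in> B" for b
    using \<eta> that r0(2) by (auto simp: dist_norm subset_iff)
  then have finE: "finite E" unfolding E_def using B(1) Tits_cone_iff_finite by auto
  \<comment> \<open>The radius \<open>m * \<eta>\<close> keeps the absolute coefficients of
    \<open>x\<close> below \<eta> in total, while \<beta> is at most
    \<open>\<beta> \<nu> / \<eta>\<close> in absolute value on each basis vector.\<close>
  have "\<beta> (\<nu> - x) > 0" if \<beta>: "\<beta> \<in> pos_roots - E" and x: "norm x < m * \<eta>" for \<beta> x
  proof -
    have R: "\<beta> \<in> real_roots" using \<beta> pos_root_is_root by blast
    note lin = real_root_linear[OF R]
    have b: "\<bar>\<beta> b\<bar> \<le> \<beta> \<nu> / \<eta>" if "b \<in> B" for b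
    proof -
      have "\<beta> (\<nu> + \<eta> *\<^sub>R b) \<ge> 0" "\<beta> (\<nu> - \<eta> *\<^sub>R b) \<ge> 0"
        using \<beta> that unfolding E_def by (auto simp: not_less)
      then have "\<eta> * \<bar>\<beta> b\<bar> \<le> \<beta> \<nu>"
        using \<eta>(1) by (cases "\<beta> b \<ge> 0") (simp_all add: linear_add[OF lin] linear_diff[OF lin] linear_cmul[OF lin])
      then show ?thesis using \<eta>(1) by (simp add: field_simps)
    qed
    have span: "\<exists>c. y = (\<Sum>b\<in>B. c b *\<^sub>R b)" for y
      using span_finite[OF B(1)] B(3) by blast
    have bound: "\<bar>\<beta> (\<Sum>b\<in>B. c b *\<^sub>R b)\<bar> \<le> (\<Sum>b\<in>B. \<bar>c b\<bar>) * (\<beta> \<nu> / \<eta>)" for c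
    proof -
      have "\<bar>\<beta> (\<Sum>b\<in>B. c b *\<^sub>R b)\<bar> \<le> (\<Sum>b\<in>B. \<bar>c b * \<beta> b\<bar>)"
        unfolding linear_sum[OF lin] linear_cmul[OF lin] real_scaleR_def by (rule sum_abs)
      also have "\<dots> \<le> (\<Sum>b\<in>B. \<bar>c b\<bar> * (\<beta> \<nu> / \<eta>))"
        unfolding abs_mult by (intro sum_mono mult_left_mono b) auto
      finally show ?thesis by (simp only: sum_distrib_right)
    qed
    have \<nu>pos: "\<beta> \<nu> > 0"
    proof (rule ccontr)
      assume np: "\<not> \<beta> \<nu> > 0"
      have "\<beta> y = 0" for y
      proof -
        obtain c where c: "y = (\<Sum>b\<in>B. c b *\<^sub>R b)" using span by blast
        have "(\<Sum>b\<in>B. \<bar>c b\<bar>) * (\<beta> \<nu> / \<eta>) \<le> 0"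
          using np \<eta>(1) by (intro mult_nonneg_nonpos sum_nonneg) (auto simp: divide_le_0_iff)
        then show ?thesis using bound[of c] unfolding c by linarith
      qed
      then show False using root_nonzero[OF R] by blast
    qed
    obtain c where c: "x = (\<Sum>b\<in>B. c b *\<^sub>R b)" using span by blast
    have "m * (\<Sum>b\<in>B. \<bar>c b\<bar>) < m * \<eta>" using m(2)[of c] x unfolding c by linarith
    then have "(\<Sum>b\<in>B. \<bar>c b\<bar>) < \<eta>" using m(1) by simp
    then have "(\<Sum>b\<in>B. \<bar>c b\<bar>) * (\<beta> \<nu> / \<eta>) < \<eta> * (\<beta> \<nu> / \<eta>)"
      using \<nu>pos \<eta>(1) by (intro mult_strict_right_mono) auto
    then have "\<bar>\<beta> x\<bar> < \<beta> \<nu>" using bound[of c] \<eta>(1) unfolding c by simp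
    then show ?thesis by (simp add: linear_diff[OF lin])
  qed
  then show ?thesis using finE m(1) \<eta>(1) by (intro exI[of _ E] exI[of _ "m * \<eta>"]) auto
qed

text \<open>Roots nonzero at \<nu> keep their sign nearby, uniformly because all but finitely many
  are positive there anyway. A root vanishing at \<nu> has on \<open>\<nu> - w c\<close> the sign
  opposite to that of its composite with \<open>w\<close> on dominant vectors, whichever
  \<open>c\<close> is taken. No root separates these points, so one closed chamber holds them
  all.\<close>

lemma chamber_behind_spherical:
  assumes sph: "spherical \<nu>" and w: "w \<in> Weyl"
  shows "\<exists>u\<in>Weyl. \<exists>r>0. \<forall>c\<in>dominant. norm (w c) < r \<longrightarrow> inv u (\<nu> - w c) \<in> dominant"
proof -
  obtain E r1 where E: "finite E" "r1 > 0"
    "\<And>\<beta> x. \<beta> \<in> pos_roots \<Longrightarrow> \<beta> \<notin> E \<Longrightarrow> norm x < r1 \<Longrightarrow> \<beta> (\<nu> - x) > 0"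
    using pos_roots_near_spherical[OF sph] by blast
  have "\<forall>\<beta>\<in>{\<beta> \<in> E \<inter> pos_roots. \<beta> \<nu> \<noteq> 0}. \<exists>r>0. \<forall>x. norm x < r \<longrightarrow> \<beta> (\<nu> - x) * \<beta> \<nu> > 0"
    using linear_functional_sign_near real_root_linear pos_root_is_root by blast
  then obtain \<rho> where \<rho>: "\<And>\<beta>. \<beta> \<in> E \<inter> pos_roots \<Longrightarrow> \<beta> \<nu> \<noteq> 0 \<Longrightarrow> \<rho> \<beta> > 0 \<and> (\<forall>x. norm x < \<rho> \<beta> \<longrightarrow> \<beta> (\<nu> - x) * \<beta> \<nu> > 0)"
    by (metis (mono_tags, lifting) mem_Collect_eq)
  obtain r0 where r0: "r0 > 0" "ball \<nu> r0 \<subseteq> Tits_cone"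
    using sph unfolding spherical_def mem_interior by blast
  define M where "M = insert r0 (insert r1 (\<rho> ` {\<beta> \<in> E \<inter> pos_roots. \<beta> \<nu> \<noteq> 0}))"
  define r where "r = Min M"
  have M: "finite M" "M \<noteq> {}" using E(1) by (simp_all add: M_def)
  have r: "r > 0" "r \<le> r0" "r \<le> r1" "\<And>\<beta>. \<beta> \<in> E \<Longrightarrow> \<beta> \<in> pos_roots \<Longrightarrow> \<beta> \<nu> \<noteq> 0 \<Longrightarrow> r \<le> \<rho> \<beta>"
  proof -
    show "r > 0" unfolding r_def Min_gr_iff[OF M] using r0(1) E(2) \<rho> by (auto simp: M_def)
    show "r \<le> r0" "r \<le> r1" unfolding r_def by (intro Min_le M(1), simp add: M_def)+
    show "r \<le> \<rho> \<beta>" if "\<beta> \<in> E" "\<beta> \<in> pos_roots" "\<beta> \<nu> \<noteq> 0" for \<beta>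
      unfolding r_def by (intro Min_le M(1)) (use that in \<open>simp add: M_def\<close>)
  qed
  obtain \<xi> where \<xi>: "\<xi> \<in> fund_chamber" using fund_chamber_nonempty by blast
  obtain s where s: "s > 0" "\<And>s'. 0 < s' \<Longrightarrow> s' \<le> s \<Longrightarrow> s' * norm (w \<xi>) < r"
    using scale_below[OF norm_ge_zero r(1)] by blast
  \<comment> \<open>A sample point that selects the chamber: \<xi> is in the open chamber, so every
    root vanishing at \<nu> has a strict sign at \<open>p\<close>.\<close>
  define p where "p = \<nu> - s *\<^sub>R w \<xi>"
  have psmall: "norm (s *\<^sub>R w \<xi>) < r" using s by simp
  have "p \<in> ball \<nu> r0" using psmall r(2) by (simp add: p_def dist_norm)
  then have "p \<in> Tits_cone" using r0(2) by blast
  then obtain u d where u: "u \<in> Weyl" "d \<in> dominant" "p = u d" unfolding Tits_cone_iff_orbit by blast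
  have "inv u (\<nu> - w c) \<in> dominant" if c: "c \<in> dominant" "norm (w c) < r" for c
  proof -
    have sign: "(\<beta> p \<ge> 0 \<longrightarrow> \<beta> (\<nu> - w c) \<ge> 0) \<and> (\<beta> p \<le> 0 \<longrightarrow> \<beta> (\<nu> - w c) \<le> 0)" if \<beta>: "\<beta> \<in> pos_roots" for \<beta>
    proof -
      note R = pos_root_is_root[OF \<beta>]
      note lin = real_root_linear[OF R]
      consider "\<beta> \<notin> E" | "\<beta> \<in> E" "\<beta> \<nu> \<noteq> 0" | "\<beta> \<nu> = 0" by blast
      then show ?thesis
      proof cases
        case 1
        then have "\<beta> p > 0" "\<beta> (\<nu> - w c) > 0"
          using E(3)[OF \<beta>] psmall c(2) r(3) unfolding p_def by auto
        then show ?thesis by simp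
      next
        case 2
        then have "r \<le> \<rho> \<beta>" "\<And>x. norm x < \<rho> \<beta> \<Longrightarrow> \<beta> (\<nu> - x) * \<beta> \<nu> > 0"
          using r(4) \<rho> \<beta> by auto
        then have "\<beta> p * \<beta> \<nu> > 0" "\<beta> (\<nu> - w c) * \<beta> \<nu> > 0"
          using psmall c(2) unfolding p_def by auto
        then show ?thesis by (auto simp: zero_less_mult_iff)
      next
        case 3
        have v: "\<beta> p = - (s * (\<beta> \<circ> w) \<xi>)" "\<beta> (\<nu> - w c) = - (\<beta> \<circ> w) c"
          by (simp_all add: p_def linear_diff[OF lin] linear_cmul[OF lin] 3)
        show ?thesis
          using root_pos_or_neg[OF root_comp[OF R w]]
        proof
          assume n: "\<beta> \<circ> w \<in> pos_roots"
          then show ?thesis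
            unfolding v using pos_root_fund_chamber[OF n \<xi>] pos_root_dominant[OF n c(1)] s(1)
            by (simp add: mult_le_0_iff)
        next
          assume n: "\<beta> \<circ> w \<in> neg_roots"
          then show ?thesis
            unfolding v using neg_root_fund_chamber[OF n \<xi>] neg_root_dominant[OF n c(1)] s(1)
            by (simp add: zero_le_mult_iff)
        qed
      qed
    qed
    have "\<alpha> i (inv u (\<nu> - w c)) \<ge> 0" if i: "i \<in> I" for i
    proof -
      let ?\<delta> = "\<alpha> i \<circ> inv u"
      have R: "?\<delta> \<in> real_roots" using root_comp simple_in_real_roots[OF i] Weyl_inv[OF u(1)] by blast
      have "?\<delta> p \<ge> 0" using u i unfolding dominant_def by simp
      then have "?\<delta> (\<nu> - w c) \<ge> 0"
        using root_pos_or_neg[OF R] sign[of ?\<delta>] sign[of "\<lambda>x. - ?\<delta> x"] unfolding neg_roots_iff by auto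
      then show ?thesis by simp
    qed
    then show ?thesis unfolding dominant_def by blast
  qed
  then show ?thesis using u(1) r(1) by blast
qed

subsection \<open>Projections of alcoves\<close>

text \<open>Seen from \<open>- t *\<^sub>R \<mu>\<close>, a point of the end alcove is
  \<open>- (1 - t)\<close> times a vector \<open>\<mu> - w c'\<close> with \<open>c'\<close>
  dominant and small. These vectors share a closed chamber because \<mu> is spherical.\<close>

lemma alcove_of_le_sector:
  assumes \<mu>: "spherical \<mu>" and w: "w \<in> Weyl" and t: "t < 1"
  shows "\<exists>u\<in>Weyl. inv u \<mu> \<in> dominant \<and> alcove_of (\<mu>, w) \<le> principal (sector (- t *\<^sub>R \<mu>) Neg u)"
proof -
  obtain u r where u: "u \<in> Weyl" and r: "r > 0"
    "\<And>c. c \<in> dominant \<Longrightarrow> norm (w c) < r \<Longrightarrow> inv u (\<mu> - w c) \<in> dominant"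
    using chamber_behind_spherical[OF \<mu> w] by blast
  have "inv u \<mu> \<in> dominant"
    using r(2)[OF dominant_0] r(1) Weyl_zero[OF w] by simp
  moreover have "\<forall>c\<in>dominant. norm (w c) < (1 - t) * r \<longrightarrow> - \<mu> + sval Pos *\<^sub>R w c \<in> sector (- t *\<^sub>R \<mu>) Neg u"
  proof (intro ballI impI)
    fix c assume c: "c \<in> dominant" "norm (w c) < (1 - t) * r"
    define c' where "c' = (1 / (1 - t)) *\<^sub>R c"
    have wc: "w c = (1 - t) *\<^sub>R w c'" using t by (simp add: c'_def Weyl_scale[OF w])
    have "c' \<in> dominant" unfolding c'_def using c t by (intro dominant_scale) auto
    moreover have "norm (w c') < r" using c(2) t unfolding wc by simp
    ultimately have "inv u (\<mu> - w c') \<in> dominant" using r(2) by blast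
    then have "(1 - t) *\<^sub>R inv u (\<mu> - w c') \<in> dominant" using t by (intro dominant_scale) auto
    then have "inv u ((1 - t) *\<^sub>R (\<mu> - w c')) \<in> dominant"
      by (simp only: Weyl_scale[OF Weyl_inv[OF u]])
    moreover have "(1 - t) *\<^sub>R (\<mu> - w c') = sval Neg *\<^sub>R (- \<mu> + sval Pos *\<^sub>R w c - - t *\<^sub>R \<mu>)"
      unfolding wc by (simp add: scaleR_right_diff_distrib scaleR_left_diff_distrib)
    ultimately show "- \<mu> + sval Pos *\<^sub>R w c \<in> sector (- t *\<^sub>R \<mu>) Neg u"
      unfolding mem_sector[OF u] by simp
  qed
  then have "alcove_of (\<mu>, w) \<le> principal (sector (- t *\<^sub>R \<mu>) Neg u)"
    unfolding alcove_of_eq_alcove[OF w] le_principal eventually_alcove[OF w]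
    using r(1) t by (intro exI[of _ "(1 - t) * r"]) simp
  ultimately show ?thesis using u by blast
qed

lemma affine_nonneg_zero:
  fixes a b s :: real
  assumes "s > 0" "a + s * b = 0" "a + (2 * s) * b \<ge> 0" "a + (s / 2) * b \<ge> 0"
  shows "b = 0"
proof -
  have "s * b \<ge> 0" "s * b \<le> 0" using assms(2-4) by (auto simp: field_simps)
  then show ?thesis using assms(1) by (metis mult_eq_0_iff order_antisym order_less_irrefl)
qed

text \<open>If a sector contains an alcove, then it contains the points of a ray inside the alcove
  in its interior, since a root that vanishes at such a point changes sign along the ray.\<close>

lemma alcove_in_sector_interior:
  assumes w: "w \<in> Weyl" and u: "u \<in> Weyl" and \<xi>: "\<xi> \<in> fund_chamber"
    and le: "alcove y \<delta> w \<le> principal (sector x \<epsilon> u)"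
  shows "\<exists>s0>0. \<forall>s. 0 < s \<and> s < s0 \<longrightarrow> inv u (sval \<epsilon> *\<^sub>R (y + sval \<delta> *\<^sub>R w (s *\<^sub>R \<xi>) - x)) \<in> fund_chamber"
proof -
  obtain r where r: "r > 0" "\<And>c. c \<in> dominant \<Longrightarrow> norm (w c) < r \<Longrightarrow> y + sval \<delta> *\<^sub>R w c \<in> sector x \<epsilon> u"
    using le unfolding le_principal eventually_alcove[OF w] by blast
  obtain s1 where s1: "s1 > 0" "\<And>s. 0 < s \<Longrightarrow> s \<le> s1 \<Longrightarrow> s * norm (w \<xi>) < r"
    using scale_below[OF norm_ge_zero r(1)] by blast
  define p where "p s = inv u (sval \<epsilon> *\<^sub>R (y + sval \<delta> *\<^sub>R w (s *\<^sub>R \<xi>) - x))" for s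
  have dom: "p s \<in> dominant" if "0 < s" "s \<le> s1" for s
  proof -
    have "norm (w (s *\<^sub>R \<xi>)) < r" using s1(2)[OF that] that by (simp add: Weyl_scale[OF w])
    then show ?thesis
      using r(2)[of "s *\<^sub>R \<xi>"] dominant_scale[OF fund_chamber_dominant[OF \<xi>]] that
      unfolding mem_sector[OF u] p_def by simp
  qed
  have "p s \<in> fund_chamber" if s: "0 < s" "s < s1 / 2" for s
    unfolding fund_chamber_def
  proof (intro CollectI ballI)
    fix i assume i: "i \<in> I"
    define a where "a = \<alpha> i (inv u (sval \<epsilon> *\<^sub>R (y - x)))"
    define b where "b = \<alpha> i (inv u (sval \<epsilon> *\<^sub>R sval \<delta> *\<^sub>R w \<xi>))"
    note lu = Weyl_linear[OF Weyl_inv[OF u]] and li = linear_root[OF i]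
    have R: "\<alpha> i \<circ> inv u \<circ> w \<in> real_roots"
      using root_comp simple_in_real_roots[OF i] Weyl_inv[OF u] w by blast
    have "b = sval \<epsilon> * sval \<delta> * (\<alpha> i \<circ> inv u \<circ> w) \<xi>"
      by (simp add: b_def linear_cmul[OF lu] linear_cmul[OF li])
    then have b0: "b \<noteq> 0"
      using root_fund_chamber_nonzero[OF R \<xi>] by (cases \<epsilon>; cases \<delta>) auto
    have val: "\<alpha> i (p s') = a + s' * b" for s'
    proof -
      have "sval \<epsilon> *\<^sub>R (y + sval \<delta> *\<^sub>R w (s' *\<^sub>R \<xi>) - x) = sval \<epsilon> *\<^sub>R (y - x) + s' *\<^sub>R (sval \<epsilon> *\<^sub>R sval \<delta> *\<^sub>R w \<xi>)"
        by (simp add: Weyl_scale[OF w] scaleR_right_diff_distrib scaleR_right_distrib mult_ac)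
      then show ?thesis
        unfolding p_def a_def b_def by (simp only: linear_add[OF lu] linear_cmul[OF lu] linear_add[OF li] linear_cmul[OF li] real_scaleR_def)
    qed
    have ge: "\<alpha> i (p s') \<ge> 0" if "0 < s'" "s' \<le> s1" for s'
      using dom[OF that] i unfolding dominant_def by blast
    show "0 < \<alpha> i (p s)"
    proof (rule ccontr)
      assume "\<not> 0 < \<alpha> i (p s)"
      then have "a + s * b = 0" using ge[of s] s val[of s] by simp
      then show False
        using affine_nonneg_zero[of s a b] ge[of "2 * s"] ge[of "s / 2"] s b0 unfolding val by simp
    qed
  qed
  then show ?thesis unfolding p_def using s1(1) by (intro exI[of _ "s1 / 2"]) auto
qed

text \<open>The two sectors share an interior point. With equal signs, simple transitivity makes the
  chambers equal; with opposite signs, the Weyl group is finite and the same alcove is presented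
  twice. This makes \<open>alcove_proj\<close> well defined.\<close>

lemma alcove_eq_if_in_sectors:
  assumes w: "w \<in> Weyl" and u: "u \<in> Weyl" "u' \<in> Weyl"
    and le: "alcove y \<delta> w \<le> principal (sector x \<epsilon> u)" "alcove y \<delta> w \<le> principal (sector x \<epsilon>' u')"
  shows "alcove x \<epsilon> u = alcove x \<epsilon>' u'"
proof -
  obtain \<xi> where \<xi>: "\<xi> \<in> fund_chamber" using fund_chamber_nonempty by blast
  obtain s1 where s1: "s1 > 0" "\<And>s. 0 < s \<Longrightarrow> s < s1 \<Longrightarrow> inv u (sval \<epsilon> *\<^sub>R (y + sval \<delta> *\<^sub>R w (s *\<^sub>R \<xi>) - x)) \<in> fund_chamber"
    using alcove_in_sector_interior[OF w u(1) \<xi> le(1)] by blast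
  obtain s2 where s2: "s2 > 0" "\<And>s. 0 < s \<Longrightarrow> s < s2 \<Longrightarrow> inv u' (sval \<epsilon>' *\<^sub>R (y + sval \<delta> *\<^sub>R w (s *\<^sub>R \<xi>) - x)) \<in> fund_chamber"
    using alcove_in_sector_interior[OF w u(2) \<xi> le(2)] by blast
  obtain s where s: "0 < s" "s < s1" "s < s2" using s1(1) s2(1) field_lbound_gt_zero by blast
  define q where "q = y + sval \<delta> *\<^sub>R w (s *\<^sub>R \<xi>) - x"
  have q: "inv u (sval \<epsilon> *\<^sub>R q) \<in> fund_chamber" "inv u' (sval \<epsilon>' *\<^sub>R q) \<in> fund_chamber"
    using s1(2) s2(2) s unfolding q_def by blast+
  have same: "u = u'" if "\<epsilon> = \<epsilon>'"
  proof -
    have "(inv u' \<circ> u) (inv u (sval \<epsilon> *\<^sub>R q)) \<in> dominant"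
      using u(1) q(2) that fund_chamber_dominant by simp
    then have "inv u' \<circ> u = id" using Weyl_eq_id[OF Weyl_comp[OF Weyl_inv[OF u(2)] u(1)] q(1)] by blast
    then show ?thesis using u(2) by (metis Weyl_comp_inv(1) comp_assoc comp_id id_comp)
  qed
  consider "\<epsilon> = \<epsilon>'" | "\<epsilon> = Neg" "\<epsilon>' = Pos" | "\<epsilon> = Pos" "\<epsilon>' = Neg" by (cases \<epsilon>; cases \<epsilon>') auto
  then show ?thesis
  proof cases
    case 1
    then show ?thesis using same by simp
  next
    case 2
    have "- inv u' (u (inv u (sval Neg *\<^sub>R q))) \<in> dominant"
      using u(1) q(2) fund_chamber_dominant 2 by (simp add: Weyl_neg[OF Weyl_inv[OF u(2)]])
    then show ?thesis using opposite_alcove_eq[OF u] q(1) 2 by simp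
  next
    case 3
    have "- inv u (u' (inv u' (sval Neg *\<^sub>R q))) \<in> dominant"
      using u(2) q(1) fund_chamber_dominant 3 by (simp add: Weyl_neg[OF Weyl_inv[OF u(1)]])
    then show ?thesis using opposite_alcove_eq[OF u(2,1)] q(2) 3 by simp
  qed
qed

lemma alcove_proj_eq:
  assumes w: "w \<in> Weyl" and u: "u \<in> Weyl" and le: "alcove y \<delta> w \<le> principal (sector x \<epsilon> u)"
  shows "alcove_proj x (alcove y \<delta> w) = alcove x \<epsilon> u"
  unfolding alcove_proj_def
proof (rule the_equality)
  show "\<exists>\<epsilon>'. \<exists>v\<in>Weyl. alcove x \<epsilon> u = alcove x \<epsilon>' v \<and> alcove y \<delta> w \<le> principal (sector x \<epsilon>' v)"
    using u le by blast
  fix b assume "\<exists>\<epsilon>'. \<exists>v\<in>Weyl. b = alcove x \<epsilon>' v \<and> alcove y \<delta> w \<le> principal (sector x \<epsilon>' v)"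
  then show "b = alcove x \<epsilon> u" using alcove_eq_if_in_sectors[OF w _ u _ le] by blast
qed

text \<open>If \<open>v\<close> and \<open>- v\<close> are both interior, the Tits cone contains the
  opposite of any chamber point: write \<open>- u \<xi>\<close> as a nonnegative combination of
  \<open>v - s *\<^sub>R u \<xi>\<close> and \<open>- v\<close>.\<close>

lemma spherical_uminus_opposite:
  assumes v: "spherical v" "spherical (- v)" and u: "u \<in> Weyl"
  shows "\<exists>u'\<in>Weyl. \<exists>\<xi>\<in>fund_chamber. - inv u' (u \<xi>) \<in> dominant"
proof -
  obtain \<xi> where \<xi>: "\<xi> \<in> fund_chamber" using fund_chamber_nonempty by blast
  obtain r where r: "r > 0" "ball v r \<subseteq> Tits_cone"
    using v(1) unfolding spherical_def mem_interior by blast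
  obtain s where s: "s > 0" "\<And>s'. 0 < s' \<Longrightarrow> s' \<le> s \<Longrightarrow> s' * norm (u \<xi>) < r"
    using scale_below[OF norm_ge_zero r(1)] by blast
  have "v - s *\<^sub>R u \<xi> \<in> Tits_cone" using r(2) s by (auto simp: dist_norm subset_iff)
  moreover have "- v \<in> Tits_cone" using v(2) interior_subset unfolding spherical_def by blast
  ultimately have "(1 / s) *\<^sub>R (v - s *\<^sub>R u \<xi>) + (1 / s) *\<^sub>R (- v) \<in> Tits_cone"
    using s(1) by (intro Tits_cone_combination) auto
  also have "(1 / s) *\<^sub>R (v - s *\<^sub>R u \<xi>) + (1 / s) *\<^sub>R (- v) = - u \<xi>"
    using s(1) by (simp add: scaleR_right_diff_distrib)
  finally obtain u' d where u': "u' \<in> Weyl" "d \<in> dominant" "- u \<xi> = u' d"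
    unfolding Tits_cone_iff_orbit by blast
  have "- inv u' (u \<xi>) = inv u' (- u \<xi>)" by (simp add: Weyl_neg[OF Weyl_inv[OF u'(1)]])
  also have "\<dots> = d" using u' by simp
  finally show ?thesis using u'(1,2) \<xi> by blast
qed

lemma opp_simps: "opp (opp \<epsilon>) = \<epsilon>"
  by (cases \<epsilon>) auto

lemma dominating_alcove:
  "u \<in> Weyl \<Longrightarrow> inv u (sval \<epsilon> *\<^sub>R v) \<in> dominant \<Longrightarrow> alcove x \<epsilon> u \<in> dominating_alcoves \<epsilon> x v"
  unfolding dominating_alcoves_def using mem_closed_direction by blast

text \<open>An alcove that already dominates the germ is at distance of length 0 from itself and
  from no other alcove.\<close>

lemma arg_min_dist_unique:
  assumes u: "u \<in> Weyl" and dom: "alcove x \<epsilon> u \<in> dominating_alcoves \<epsilon> x v"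
  shows "is_arg_min (\<lambda>b. Weyl_length (alcove_dist \<epsilon> (alcove x \<epsilon> u) b)) (\<lambda>b. b \<in> dominating_alcoves \<epsilon> x v) b
    \<longleftrightarrow> b = alcove x \<epsilon> u"
proof -
  have self: "Weyl_length (alcove_dist \<epsilon> (alcove x \<epsilon> u) (alcove x \<epsilon> u)) = 0"
    using alcove_dist_eq[OF u u] u by simp
  show ?thesis
  proof
    assume min: "is_arg_min (\<lambda>b. Weyl_length (alcove_dist \<epsilon> (alcove x \<epsilon> u) b)) (\<lambda>b. b \<in> dominating_alcoves \<epsilon> x v) b"
    then obtain w where w: "w \<in> Weyl" "b = alcove x \<epsilon> w"
      unfolding is_arg_min_def dominating_alcoves_def by blast
    have "Weyl_length (alcove_dist \<epsilon> (alcove x \<epsilon> u) b) = 0"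
      using min dom self unfolding is_arg_min_def by (metis gr0I)
    then have "inv u \<circ> w = id"
      unfolding w(2) alcove_dist_eq[OF u w(1)] using Weyl_length_0 Weyl_comp Weyl_inv u w(1) by blast
    then have "w = u" using u by (metis Weyl_comp_inv(1) comp_assoc comp_id id_comp)
    then show "b = alcove x \<epsilon> u" using w(2) by simp
  next
    assume "b = alcove x \<epsilon> u"
    then show "is_arg_min (\<lambda>b. Weyl_length (alcove_dist \<epsilon> (alcove x \<epsilon> u) b)) (\<lambda>b. b \<in> dominating_alcoves \<epsilon> x v) b"
      unfolding is_arg_min_def using dom self by simp
  qed
qed

text \<open>If an alcove has both signs, then its codistance to itself is the longest element of a
  finite Weyl group.\<close>

lemma arg_max_codist_unique:
  assumes u: "u \<in> Weyl" and u': "u' \<in> Weyl" and eq: "alcove x (opp \<epsilon>) u' = alcove x \<epsilon> u"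
    and long: "\<exists>\<xi>\<in>fund_chamber. - (inv u' \<circ> u) \<xi> \<in> dominant"
    and dom: "alcove x \<epsilon> u \<in> dominating_alcoves \<epsilon> x v"
    and max: "is_arg_max (\<lambda>b. Weyl_length (alcove_codist (opp \<epsilon>) (alcove x (opp \<epsilon>) u') b))
      (\<lambda>b. b \<in> dominating_alcoves \<epsilon> x v) b"
  shows "b = alcove x \<epsilon> u"
proof -
  obtain \<xi> where \<xi>: "\<xi> \<in> fund_chamber" "- (inv u' \<circ> u) \<xi> \<in> dominant" using long by blast
  have W: "inv u' \<circ> u \<in> Weyl" using u u' Weyl_comp Weyl_inv by blast
  obtain w where w: "w \<in> Weyl" "b = alcove x \<epsilon> w"
    using max unfolding is_arg_max_def dominating_alcoves_def by blast
  have cod: "alcove_codist (opp \<epsilon>) (alcove x (opp \<epsilon>) u') (alcove x \<epsilon> w') = inv u' \<circ> w'" if "w' \<in> Weyl" for w'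
    using alcove_codist_eq[OF u' that, of "opp \<epsilon>" x] unfolding opp_simps .
  have W': "inv u' \<circ> w \<in> Weyl" using w(1) u' Weyl_comp Weyl_inv by blast
  have "\<not> Weyl_length (inv u' \<circ> w) < Weyl_length (inv u' \<circ> u)"
    using max dom unfolding is_arg_max_def w(2) by (metis cod u w(1))
  then have "Weyl_length (inv u' \<circ> w) = Weyl_length (inv u' \<circ> u)"
    using longest_element(1)[OF W \<xi> W'] by (intro order_antisym) (simp_all only: not_less)
  then have "inv u' \<circ> w = inv u' \<circ> u" using longest_element(2)[OF W \<xi> W'] by blast
  then have "w = u" using Weyl_left_cancel[OF Weyl_inv[OF u']] by blast
  then show ?thesis using w(2) by simp
qed

text \<open>Existence uses the sign \<open>Neg\<close> and the distance clause. A competitor may use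
  the other sign or the codistance clause; in each such case the alcove also has a positive
  presentation, and the result is again the alcove itself.\<close>

lemma germ_proj_eq:
  assumes sph: "spherical (- v)" and u: "u \<in> Weyl" and dom: "inv u (- v) \<in> dominant"
    and proj: "alcove_proj x a = alcove x Neg u"
  shows "germ_proj x v a = alcove x Neg u"
  unfolding germ_proj_def
proof (rule the_equality)
  let ?p = "alcove x Neg u"
  have domN: "?p \<in> dominating_alcoves Neg x v"
    using dominating_alcove[OF u, of Neg v x] dom by simp
  have pN: "?p \<in> alcoves_at Neg x" unfolding alcoves_at_def using u by blast
  show "is_germ_proj x v a ?p"
    unfolding is_germ_proj_def proj
    by (intro exI[of _ Neg] conjI disjI1) (use sph pN arg_min_dist_unique[OF u domN] in auto)
  fix b assume "is_germ_proj x v a b"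
  then obtain \<epsilon> where \<epsilon>: "spherical (sval \<epsilon> *\<^sub>R v)"
    and b: "?p \<in> alcoves_at \<epsilon> x \<and> is_arg_min (\<lambda>b. Weyl_length (alcove_dist \<epsilon> ?p b)) (\<lambda>b. b \<in> dominating_alcoves \<epsilon> x v) b
      \<or> ?p \<in> alcoves_at (opp \<epsilon>) x \<and> is_arg_max (\<lambda>b. Weyl_length (alcove_codist (opp \<epsilon>) ?p b)) (\<lambda>b. b \<in> dominating_alcoves \<epsilon> x v) b"
    unfolding is_germ_proj_def proj by blast
  obtain \<xi> where \<xi>: "\<xi> \<in> fund_chamber" using fund_chamber_nonempty by blast
  have opposite: "alcove x Pos u' \<in> dominating_alcoves Pos x v" "- (inv u' \<circ> u) \<xi> \<in> dominant"
    "- (inv u \<circ> u') (- (inv u' \<circ> u) \<xi>) \<in> dominant" "- (inv u' \<circ> u) \<xi> \<in> fund_chamber"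
    if u': "u' \<in> Weyl" and eq: "?p = alcove x Pos u'" for u'
  proof -
    have W: "inv u' \<circ> u \<in> Weyl" using u u' Weyl_comp Weyl_inv by blast
    show d: "- (inv u' \<circ> u) \<xi> \<in> dominant"
      using opposite_alcove_dominant[OF u u' eq fund_chamber_dominant[OF \<xi>]] .
    show "- (inv u' \<circ> u) \<xi> \<in> fund_chamber" using opposite_chamber_image(1)[OF W \<xi> d] .
    show "- (inv u \<circ> u') (- (inv u' \<circ> u) \<xi>) \<in> dominant"
      using opposite_chamber_inv[OF W \<xi> d] unfolding Weyl_inv_comp[OF Weyl_inv[OF u'] u] Weyl_inv_cancel(3)[OF u'] .
    have "- (inv u' \<circ> u) (inv u (- v)) \<in> dominant"
      using opposite_alcove_dominant[OF u u' eq dom] .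
    then have "inv u' v \<in> dominant"
      using u by (simp add: Weyl_neg[OF Weyl_inv[OF u']])
    then show "alcove x Pos u' \<in> dominating_alcoves Pos x v"
      using dominating_alcove[OF u', of Pos v x] by simp
  qed
  show "b = ?p"
  proof (cases \<epsilon>)
    case Neg
    from b show ?thesis
    proof
      assume "?p \<in> alcoves_at \<epsilon> x \<and> is_arg_min (\<lambda>b. Weyl_length (alcove_dist \<epsilon> ?p b)) (\<lambda>b. b \<in> dominating_alcoves \<epsilon> x v) b"
      then show ?thesis using arg_min_dist_unique[OF u domN] Neg by blast
    next
      assume *: "?p \<in> alcoves_at (opp \<epsilon>) x \<and> is_arg_max (\<lambda>b. Weyl_length (alcove_codist (opp \<epsilon>) ?p b)) (\<lambda>b. b \<in> dominating_alcoves \<epsilon> x v) b"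
      then obtain u' where u': "u' \<in> Weyl" "?p = alcove x Pos u'" unfolding Neg alcoves_at_def by auto
      show ?thesis
        using arg_max_codist_unique[OF u u'(1), of x Neg v b] * opposite(2)[OF u'] \<xi> domN u'(2) Neg by auto
    qed
  next
    case Pos
    from b show ?thesis
    proof
      assume *: "?p \<in> alcoves_at \<epsilon> x \<and> is_arg_min (\<lambda>b. Weyl_length (alcove_dist \<epsilon> ?p b)) (\<lambda>b. b \<in> dominating_alcoves \<epsilon> x v) b"
      then obtain u' where u': "u' \<in> Weyl" "?p = alcove x Pos u'" unfolding Pos alcoves_at_def by auto
      show ?thesis
        using arg_min_dist_unique[OF u'(1) opposite(1)[OF u'], of b] * u'(2) Pos by simp
    next
      assume *: "?p \<in> alcoves_at (opp \<epsilon>) x \<and> is_arg_max (\<lambda>b. Weyl_length (alcove_codist (opp \<epsilon>) ?p b)) (\<lambda>b. b \<in> dominating_alcoves \<epsilon> x v) b"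
      \<comment> \<open>The clause alone gives no positive presentation here, as every negative
        alcove satisfies its first part; it is sphericity of both \<open>v\<close> and
        \<open>- v\<close> that provides one.\<close>
      have "spherical v" using \<epsilon> Pos by simp
      then obtain u' \<zeta> where u': "u' \<in> Weyl" and \<zeta>: "\<zeta> \<in> fund_chamber" "- inv u' (u \<zeta>) \<in> dominant"
        using spherical_uminus_opposite[OF _ sph u] by blast
      have eq: "?p = alcove x Pos u'" using opposite_alcove_eq[OF u u' \<zeta>] .
      show ?thesis
        using arg_max_codist_unique[OF u' u, of x Pos v b] * opposite[OF u' eq] eq Pos by auto
    qed
  qed
qed

text \<open>The alcove at \<open>-t\<mu>\<close> whose sector contains the end alcove already dominates the germ, so it
  is its own projection.\<close>

lemma straight_deco:
  assumes \<mu>: "spherical \<mu>" and w: "w \<in> Weyl" and t: "0 \<le> t" "t < 1"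
  shows "\<exists>u\<in>Weyl. deco (straight_open_path (\<mu>, w)) (t, Pos) = alcove (- t *\<^sub>R \<mu>) Neg u \<and>
    alcove_of (\<mu>, w) \<le> principal (sector (- t *\<^sub>R \<mu>) Neg u)"
proof -
  obtain u where u: "u \<in> Weyl" "inv u \<mu> \<in> dominant"
    "alcove_of (\<mu>, w) \<le> principal (sector (- t *\<^sub>R \<mu>) Neg u)"
    using alcove_of_le_sector[OF \<mu> w t(2)] by blast
  have "(straight_path \<mu> has_vector_derivative - \<mu>) (at t within {t..1})"
  proof (rule has_vector_derivative_transform)
    show "t \<in> {t..1}" using t by simp
    show "((\<lambda>t. - t *\<^sub>R \<mu>) has_vector_derivative - \<mu>) (at t within {t..1})"
      by (auto intro!: derivative_eq_intros)
    show "straight_path \<mu> s = - s *\<^sub>R \<mu>" if "s \<in> {t..1}" for s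
      using that t by (simp add: straight_path_def)
  qed
  then have "vector_derivative (straight_path \<mu>) (at t within {t..1}) = - \<mu>"
    using vector_derivative_within_cbox[of t 1 t] t by (simp add: vector_derivative_within_closed_interval)
  then have dir: "germ_dir (straight_path \<mu>) (t, Pos) = - \<mu>" by (simp add: germ_dir_def)
  have "alcove_proj (- t *\<^sub>R \<mu>) (alcove_of (\<mu>, w)) = alcove (- t *\<^sub>R \<mu>) Neg u"
    using alcove_proj_eq[OF w u(1)] u(3) unfolding alcove_of_eq_alcove[OF w] by blast
  then have "germ_proj (- t *\<^sub>R \<mu>) (- \<mu>) (alcove_of (\<mu>, w)) = alcove (- t *\<^sub>R \<mu>) Neg u"
    using germ_proj_eq[of "- \<mu>" u] \<mu> u by simp
  moreover have "deco (straight_open_path (\<mu>, w)) (t, Pos) = germ_proj (- t *\<^sub>R \<mu>) (- \<mu>) (alcove_of (\<mu>, w))"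
    using t dir by (simp add: straight_open_path_def signed_interval_def straight_path_def)
  ultimately show ?thesis using u by auto
qed

subsection \<open>Folding sequences\<close>

lemma on_negative_side_uminus:
  "on_negative_side (\<lambda>x. - \<beta> x) (- n) a \<longleftrightarrow> on_negative_side \<beta> n a"
proof -
  have "half_space \<epsilon> (\<lambda>x. - \<beta> x) (- n) = half_space (opp \<epsilon>) \<beta> n" for \<epsilon>
    by (cases \<epsilon>) (auto simp: half_space_def)
  moreover have "(\<exists>\<epsilon>. P (opp \<epsilon>)) \<longleftrightarrow> (\<exists>\<epsilon>. P \<epsilon>)" for P
    using opp_simps by metis
  ultimately show ?thesis unfolding on_negative_side_def by simp
qed

lemma aff_refl_uminus: "\<beta> \<in> real_roots \<Longrightarrow> aff_refl (\<lambda>x. - \<beta> x) (- n) = aff_refl \<beta> n"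
  by (simp add: aff_refl_def coroot_uminus root_refl_uminus)

text \<open>For \<open>n = 0\<close> the wall passes through the origin and positivity of \<beta> on
  the dominant cone decides, in agreement with \<open>sgn(0) = +1\<close>. For \<open>n < 0\<close>
  the wall avoids the origin, and a small ball stays on one side.\<close>

lemma base_alcove_half_space:
  assumes \<beta>: "\<beta> \<in> pos_roots"
  shows "base_alcove \<le> principal (half_space (if n \<ge> 0 then Pos else Neg) \<beta> n)"
proof (cases "n \<ge> 0")
  case True
  have "\<beta> c + of_int n \<ge> 0" if "c \<in> dominant" for c
    using pos_root_dominant[OF \<beta> that] True by simp
  then show ?thesis
    unfolding base_alcove_def le_principal eventually_alcove[OF Weyl_id]
    using True by (intro exI[of _ 1]) (simp add: half_space_def)
next
  case False
  obtain K where K: "K > 0" "\<And>x. \<bar>\<beta> x\<bar> \<le> K * norm x"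
    using functional_bounded[OF real_root_linear[OF pos_root_is_root[OF \<beta>]]] by blast
  have "of_int n \<le> - \<beta> c" if "norm c < 1 / K" for c
  proof -
    have "\<beta> c < 1" using K(2)[of c] that K(1) by (simp add: field_simps)
    moreover have "(of_int n :: real) \<le> -1" using False by linarith
    ultimately show ?thesis by linarith
  qed
  then show ?thesis
    unfolding base_alcove_def le_principal eventually_alcove[OF Weyl_id]
    using False K(1) by (intro exI[of _ "1 / K"]) (simp add: half_space_def)
qed

text \<open>The base point of the alcove gives the weak inequality between \<open>n\<close> and
  \<beta> \<mu>. If it lies on the wall, a point on a ray inside the alcove determines the sign of
  \<beta> composed with \<open>w\<close>, which is the second condition of the order.\<close>

lemma pos_root_negative_side_step:
  assumes z: "(\<mu>, w) \<in> Wplus" and \<beta>: "\<beta> \<in> pos_roots" and neg: "on_negative_side \<beta> n (alcove_of (\<mu>, w))"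
  shows "aff_bruhat_step (aff_mult (aff_refl \<beta> n) (\<mu>, w)) (\<mu>, w)"
proof (rule aff_bruhat_step.intros[OF z \<beta>])
  have w: "w \<in> Weyl" using z Wplus_iff by blast
  note R = pos_root_is_root[OF \<beta>]
  note lin = real_root_linear[OF R]
  obtain \<epsilon> where \<epsilon>: "alcove_of (\<mu>, w) \<le> principal (half_space \<epsilon> \<beta> n)" "\<not> base_alcove \<le> principal (half_space \<epsilon> \<beta> n)"
    using neg unfolding on_negative_side_def by blast
  have \<epsilon>n: "\<epsilon> = (if n \<ge> 0 then Neg else Pos)"
    using base_alcove_half_space[OF \<beta>, of n] \<epsilon>(2) by (cases \<epsilon>) (auto split: if_splits)
  obtain \<xi> where \<xi>: "\<xi> \<in> fund_chamber" using fund_chamber_nonempty by blast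
  obtain r where r: "r > 0" "\<And>c. c \<in> dominant \<Longrightarrow> norm (w c) < r \<Longrightarrow> - \<mu> + w c \<in> half_space \<epsilon> \<beta> n"
    using \<epsilon>(1) unfolding alcove_of_eq_alcove[OF w] le_principal eventually_alcove[OF w] by auto
  obtain s where s: "s > 0" "\<And>s'. 0 < s' \<Longrightarrow> s' \<le> s \<Longrightarrow> s' * norm (w \<xi>) < r"
    using scale_below[OF norm_ge_zero r(1)] by blast
  have "- \<mu> + w 0 \<in> half_space \<epsilon> \<beta> n"
    using r(2)[OF dominant_0] r(1) Weyl_zero[OF w] by simp
  then have at: "sval \<epsilon> * (of_int n - \<beta> \<mu>) \<ge> 0"
    using Weyl_zero[OF w] by (simp add: half_space_def linear_neg[OF lin])
  have "norm (w (s *\<^sub>R \<xi>)) < r" using s by (simp add: Weyl_scale[OF w])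
  then have "- \<mu> + w (s *\<^sub>R \<xi>) \<in> half_space \<epsilon> \<beta> n"
    using r(2) dominant_scale[OF fund_chamber_dominant[OF \<xi>]] s(1) by simp
  then have ray: "sval \<epsilon> * (of_int n - \<beta> \<mu> + s * (\<beta> \<circ> w) \<xi>) \<ge> 0"
    by (simp add: half_space_def Weyl_scale[OF w] linear_add[OF lin] linear_diff[OF lin] linear_cmul[OF lin] algebra_simps)
  have Rw: "\<beta> \<circ> w \<in> real_roots" using root_comp[OF R w] .
  have act: "dual_act (inv w) \<beta> = \<beta> \<circ> w" using w by (simp add: dual_act_def)
  show "of_int \<bar>n\<bar> < sgn_int n * \<beta> \<mu> \<or>
    of_int \<bar>n\<bar> = sgn_int n * \<beta> \<mu> \<and> (\<lambda>x. sgn_int n * dual_act (inv w) \<beta> x) \<in> neg_roots"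
  proof (cases "of_int n = \<beta> \<mu>")
    case True
    then have e: "sval \<epsilon> * (s * (\<beta> \<circ> w) \<xi>) \<ge> 0" using ray by simp
    have nz: "(\<beta> \<circ> w) \<xi> \<noteq> 0" using root_fund_chamber_nonzero[OF Rw \<xi>] .
    show ?thesis
    proof (cases "n \<ge> 0")
      case n: True
      then have "(\<beta> \<circ> w) \<xi> < 0" using e nz s(1) \<epsilon>n by (simp add: mult_le_0_iff)
      then have "\<beta> \<circ> w \<in> neg_roots" using neg_root_iff_fund_chamber[OF Rw \<xi>] by blast
      then show ?thesis using n True unfolding act by (simp add: sgn_int_def comp_def)
    next
      case n: False
      then have "(\<beta> \<circ> w) \<xi> > 0" using e nz s(1) \<epsilon>n by (simp add: zero_le_mult_iff)
      then have "\<beta> \<circ> w \<in> pos_roots" using pos_root_iff_fund_chamber[OF Rw \<xi>] by blast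
      then show ?thesis using n True unfolding act by (simp add: sgn_int_def neg_roots_iff comp_def)
    qed
  next
    case False
    then show ?thesis using at \<epsilon>n by (auto simp: sgn_int_def)
  qed
qed

text \<open>The order is defined by positive roots, foldings by arbitrary real ones; a negative root
  is replaced by its negative with \<open>- n\<close>, which names the same wall and
  reflection.\<close>

lemma negative_side_step:
  assumes z: "z \<in> Wplus" and \<beta>: "\<beta> \<in> real_roots" and neg: "on_negative_side \<beta> n (alcove_of z)"
  shows "aff_bruhat_step (aff_mult (aff_refl \<beta> n) z) z"
proof -
  obtain \<mu> w where z': "z = (\<mu>, w)" by (cases z)
  show ?thesis
    using root_pos_or_neg[OF \<beta>]
  proof
    assume "\<beta> \<in> pos_roots"
    then show ?thesis using pos_root_negative_side_step z neg unfolding z' by blast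
  next
    assume n: "\<beta> \<in> neg_roots"
    then have "aff_bruhat_step (aff_mult (aff_refl (\<lambda>x. - \<beta> x) (- n)) z) z"
      using pos_root_negative_side_step[of \<mu> w "\<lambda>x. - \<beta> x" "- n"] z neg
      unfolding z' neg_roots_iff on_negative_side_uminus by blast
    then show ?thesis unfolding aff_refl_uminus[OF \<beta>] .
  qed
qed

text \<open>The wall contains the image of the vertex \<open>p\<close>, so the pulled-back
  half-space is a cone at \<open>p\<close>. A cone that contains the germ of a sector contains the
  whole sector, and with it \<open>C\<close>.\<close>

lemma negative_side_transfer:
  assumes u: "u \<in> Weyl" and \<beta>: "linear \<beta>" and G: "\<And>z. G z = g + l z" "linear l"
    and wall: "G p \<in> wall \<beta> n" and C: "C \<le> principal (sector p Neg u)"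
    and neg: "on_negative_side \<beta> n (filtermap G (alcove p Neg u))"
  shows "on_negative_side \<beta> n (filtermap G C)"
proof -
  obtain \<epsilon> where \<epsilon>: "filtermap G (alcove p Neg u) \<le> principal (half_space \<epsilon> \<beta> n)"
    and base: "\<not> base_alcove \<le> principal (half_space \<epsilon> \<beta> n)"
    using neg unfolding on_negative_side_def by blast
  obtain r where r: "r > 0" "\<And>c. c \<in> dominant \<Longrightarrow> norm (u c) < r \<Longrightarrow> G (p - u c) \<in> half_space \<epsilon> \<beta> n"
    using \<epsilon> unfolding le_principal eventually_filtermap eventually_alcove[OF u] by auto
  have val: "\<beta> (G (p - v)) + of_int n = - \<beta> (l v)" for v
    using wall unfolding wall_def G(1) by (simp add: linear_add[OF \<beta>] linear_diff[OF \<beta>] linear_diff[OF G(2)])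
  have "G z \<in> half_space \<epsilon> \<beta> n" if z: "z \<in> sector p Neg u" for z
  proof -
    define c where "c = inv u (- (z - p))"
    have c: "c \<in> dominant" "z = p - u c" using z u unfolding mem_sector[OF u] c_def by simp_all
    obtain s where s: "s > 0" "\<And>s'. 0 < s' \<Longrightarrow> s' \<le> s \<Longrightarrow> s' * norm (u c) < r"
      using scale_below[OF norm_ge_zero r(1)] by blast
    have "norm (u (s *\<^sub>R c)) < r" using s by (simp add: Weyl_scale[OF u])
    then have "G (p - u (s *\<^sub>R c)) \<in> half_space \<epsilon> \<beta> n" using r(2) dominant_scale[OF c(1)] s(1) by simp
    then have "sval \<epsilon> * (s * - \<beta> (l (u c))) \<ge> 0"
      unfolding half_space_def mem_Collect_eq val
      by (simp add: Weyl_scale[OF u] linear_cmul[OF G(2)] linear_cmul[OF \<beta>])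
    then have "sval \<epsilon> * - \<beta> (l (u c)) \<ge> 0"
      using s(1) by (cases \<epsilon>) (auto simp: mult_le_0_iff zero_le_mult_iff)
    then show ?thesis unfolding c(2) half_space_def mem_Collect_eq val .
  qed
  then have "filtermap G C \<le> principal (half_space \<epsilon> \<beta> n)"
    using C unfolding le_principal eventually_filtermap by (auto elim: eventually_mono)
  then show ?thesis using base unfolding on_negative_side_def by blast
qed

section \<open>Effect of a folding sequence on elements, alcoves and curves\<close>

lemma fold_seq_Nil [simp]: "fold_seq [] P = P"
  and refl_seq_Nil [simp]: "refl_seq [] z = z"
  by (simp_all add: fold_seq_def refl_seq_def)

lemma fold_seq_snoc [simp]: "fold_seq (fs @ [(t, \<beta>, n)]) P = folding t \<beta> n (fold_seq fs P)"
  and refl_seq_snoc [simp]: "refl_seq (fs @ [(t, \<beta>, n)]) z = aff_act (aff_refl \<beta> n) (refl_seq fs z)"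
  by (simp_all add: fold_seq_def refl_seq_def)

text \<open>Left multiplication by the folding reflections, the counterpart of
  \<open>refl_seq\<close> in the group; despite its name it need not be a translation.\<close>

definition translate :: "(real \<times> ('a \<Rightarrow> real) \<times> int) list \<Rightarrow> 'a \<times> ('a \<Rightarrow> 'a) \<Rightarrow> 'a \<times> ('a \<Rightarrow> 'a)" where
  "translate fs = fold (\<lambda>(t, \<beta>, n). aff_mult (aff_refl \<beta> n)) fs"

lemma translate_Nil [simp]: "translate [] x = x"
  and translate_snoc [simp]: "translate (fs @ [(t, \<beta>, n)]) x = aff_mult (aff_refl \<beta> n) (translate fs x)"
  by (simp_all add: translate_def)

lemma aff_act_refl_mult:
  assumes "\<beta> \<in> real_roots"
  shows "aff_act (aff_mult (aff_refl \<beta> n) h) z = aff_act (aff_refl \<beta> n) (aff_act h z)"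
  using Weyl_linear[OF root_refl_in_Weyl[OF assms]]
  by (simp add: aff_act_def aff_mult_def aff_refl_def linear_add linear_neg linear_diff)

lemma hecke_folding_data_snoc:
  assumes "hecke_folding_data x (fs @ [(t, \<beta>, n)])"
  shows "hecke_folding_data x fs" and "\<And>s \<gamma> m. (s, \<gamma>, m) \<in> set fs \<Longrightarrow> s \<le> t" and "t \<in> {0..1}"
    and "\<beta> \<in> real_roots" and "refl_seq fs (- t *\<^sub>R fst x) \<in> wall \<beta> n"
    and "positive_folding t \<beta> n (fold_seq fs (straight_open_path x))"
proof -
  let ?gs = "fs @ [(t, \<beta>, n)]"
  have sorted: "sorted (map fst ?gs)"
    and each: "\<And>k. k < length ?gs \<Longrightarrow> case ?gs ! k of (t, \<beta>, n) \<Rightarrow>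
        t \<in> {0..1} \<and> \<beta> \<in> real_roots \<and> refl_seq (take k ?gs) (- t *\<^sub>R fst x) \<in> wall \<beta> n \<and>
        positive_folding t \<beta> n (fold_seq (take k ?gs) (straight_open_path x))"
    using assms unfolding hecke_folding_data_def by auto
  show "hecke_folding_data x fs"
    unfolding hecke_folding_data_def
  proof (intro conjI allI impI)
    show "sorted (map fst fs)" using sorted by (simp add: sorted_append)
    fix k assume "k < length fs"
    then show "case fs ! k of (t, \<beta>, n) \<Rightarrow>
        t \<in> {0..1} \<and> \<beta> \<in> real_roots \<and> refl_seq (take k fs) (- t *\<^sub>R fst x) \<in> wall \<beta> n \<and>
        positive_folding t \<beta> n (fold_seq (take k fs) (straight_open_path x))"
      using each[of k] by (simp add: nth_append)
  qed
  show "s \<le> t" if "(s, \<gamma>, m) \<in> set fs" for s \<gamma> m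
    using sorted that by (force simp: sorted_append)
  show "t \<in> {0..1}" "\<beta> \<in> real_roots" "refl_seq fs (- t *\<^sub>R fst x) \<in> wall \<beta> n"
    "positive_folding t \<beta> n (fold_seq fs (straight_open_path x))"
    using each[of "length fs"] by simp_all
qed

lemma hecke_roots:
  "hecke_folding_data x fs \<Longrightarrow> (t, \<beta>, n) \<in> set fs \<Longrightarrow> \<beta> \<in> real_roots"
  unfolding hecke_folding_data_def by (fastforce simp: in_set_conv_nth)

lemma aff_act_translate:
  assumes "\<And>t \<beta> n. (t, \<beta>, n) \<in> set fs \<Longrightarrow> \<beta> \<in> real_roots"
  shows "aff_act (translate fs x) z = refl_seq fs (aff_act x z)"
  using assms
proof (induction fs rule: rev_induct)
  case (snoc f fs)
  obtain t \<beta> n where f: "f = (t, \<beta>, n)" by (cases f)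
  have R: "\<beta> \<in> real_roots" using snoc.prems[of t \<beta> n] f by simp
  have IH: "aff_act (translate fs x) z = refl_seq fs (aff_act x z)"
    by (rule snoc.IH) (use snoc.prems in auto)
  show ?case unfolding f using aff_act_refl_mult[OF R] IH by simp
qed simp

lemma translate_in_Weyl:
  assumes "\<And>t \<beta> n. (t, \<beta>, n) \<in> set fs \<Longrightarrow> \<beta> \<in> real_roots" "snd x \<in> Weyl"
  shows "snd (translate fs x) \<in> Weyl"
  using assms
proof (induction fs rule: rev_induct)
  case (snoc f fs)
  obtain t \<beta> n where f: "f = (t, \<beta>, n)" by (cases f)
  have R: "\<beta> \<in> real_roots" using snoc.prems(1)[of t \<beta> n] f by simp
  have "snd (translate fs x) \<in> Weyl" by (rule snoc.IH) (use snoc.prems in auto)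
  moreover have "snd (translate (fs @ [f]) x) = root_refl \<beta> \<circ> snd (translate fs x)"
    by (simp add: f aff_mult_def aff_refl_def)
  ultimately show ?case using Weyl_comp[OF root_refl_in_Weyl[OF R]] by metis
qed simp

lemma refl_seq_affine:
  assumes "\<And>t \<beta> n. (t, \<beta>, n) \<in> set fs \<Longrightarrow> \<beta> \<in> real_roots"
  shows "\<exists>g l. linear l \<and> (\<forall>z. refl_seq fs z = g + l z)"
proof (intro exI conjI allI)
  let ?g = "translate fs (0, id)"
  show "linear (snd ?g)" using Weyl_linear translate_in_Weyl[OF assms] Weyl_id by simp
  show "refl_seq fs z = - fst ?g + snd ?g z" for z
    using aff_act_translate[of fs "(0, id)" z] assms by (simp add: aff_act_def)
qed

lemma alcove_of_translate:
  assumes "\<And>t \<beta> n. (t, \<beta>, n) \<in> set fs \<Longrightarrow> \<beta> \<in> real_roots"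
  shows "alcove_of (translate fs x) = filtermap (refl_seq fs) (alcove_of x)"
proof -
  have "aff_act (translate fs x) = (\<lambda>z. refl_seq fs (aff_act x z))"
    by (rule ext, rule aff_act_translate, rule assms)
  then show ?thesis unfolding alcove_of_def alcove_act_def filtermap_filtermap by (rule arg_cong)
qed

lemma end_alcove_fold_seq: "end_alcove (fold_seq fs P) = filtermap (refl_seq fs) (end_alcove P)"
proof (induction fs rule: rev_induct)
  case (snoc f fs)
  then show ?case by (cases f) (simp add: folding_def alcove_act_def filtermap_filtermap)
qed (simp add: refl_seq_def filtermap_ident)

lemma deco_fold_seq_after:
  assumes "\<And>s \<beta> n. (s, \<beta>, n) \<in> set fs \<Longrightarrow> s \<le> t" "0 \<le> t" "t < 1"
  shows "deco (fold_seq fs P) (t, Pos) = filtermap (refl_seq fs) (deco P (t, Pos))"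
  using assms(1)
proof (induction fs rule: rev_induct)
  case (snoc f fs)
  obtain s \<beta> n where f: "f = (s, \<beta>, n)" by (cases f)
  have st: "s \<le> t" using snoc.prems[of s \<beta> n] f by simp
  have IH: "deco (fold_seq fs P) (t, Pos) = filtermap (refl_seq fs) (deco P (t, Pos))"
    by (rule snoc.IH) (use snoc.prems in auto)
  have "(t, Pos) \<in> signed_interval 0 1" using assms(2,3) by (simp add: signed_interval_def)
  then show ?case
    unfolding f using st by (auto simp: folding_def alcove_act_def filtermap_filtermap IH)
qed (simp add: refl_seq_def filtermap_ident)

lemma curve_fold_seq_after:
  assumes "\<And>s \<beta> n. (s, \<beta>, n) \<in> set fs \<Longrightarrow> s \<le> t" "0 \<le> t" "t \<le> 1"
  shows "curve (fold_seq fs P) t = refl_seq fs (curve P t)"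
  using assms(1)
proof (induction fs rule: rev_induct)
  case (snoc f fs)
  obtain s \<beta> n where f: "f = (s, \<beta>, n)" by (cases f)
  have st: "s \<le> t" using snoc.prems[of s \<beta> n] f by simp
  have IH: "curve (fold_seq fs P) t = refl_seq fs (curve P t)"
    by (rule snoc.IH) (use snoc.prems in auto)
  show ?case
    unfolding f using st assms(2,3) by (simp add: folding_def IH)
qed simp

lemma hecke_step:
  assumes x: "x \<in> Wplus" "spherical (fst x)" and h: "hecke_folding_data x (fs @ [(t, \<beta>, n)])"
    and W: "translate fs x \<in> Wplus"
  shows "aff_bruhat_step (translate (fs @ [(t, \<beta>, n)]) x) (translate fs x)"
proof -
  note data = hecke_folding_data_snoc[OF h]
  obtain \<mu> w where xw: "x = (\<mu>, w)" by (cases x)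
  have w: "w \<in> Weyl" using x(1) Wplus_iff unfolding xw by blast
  have R: "\<And>t \<beta> n. (t, \<beta>, n) \<in> set fs \<Longrightarrow> \<beta> \<in> real_roots" using hecke_roots[OF data(1)] by blast
  have end_eq: "alcove_of (translate fs x) = filtermap (refl_seq fs) (alcove_of x)"
    by (rule alcove_of_translate, rule R)
  have "on_negative_side \<beta> n (alcove_of (translate fs x))"
  proof (cases "t < 1")
    case True
    have t: "0 \<le> t" using data(3) by simp
    obtain u where u: "u \<in> Weyl" "deco (straight_open_path x) (t, Pos) = alcove (- t *\<^sub>R \<mu>) Neg u"
      "alcove_of x \<le> principal (sector (- t *\<^sub>R \<mu>) Neg u)"
      using straight_deco[of \<mu> w t] x(2) w t True unfolding xw by auto
    have "on_negative_side \<beta> n (filtermap (refl_seq fs) (alcove (- t *\<^sub>R \<mu>) Neg u))"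
    proof -
      have "deco (fold_seq fs (straight_open_path x)) (t, Pos) =
          filtermap (refl_seq fs) (deco (straight_open_path x) (t, Pos))"
        by (rule deco_fold_seq_after[OF _ t True], rule data(2))
      then show ?thesis using data(6) True u(2) unfolding positive_folding_def by simp
    qed
    moreover obtain g l where "linear l" "\<And>z. refl_seq fs z = g + l z"
    proof -
      have "\<exists>g l. linear l \<and> (\<forall>z. refl_seq fs z = g + l z)" by (rule refl_seq_affine, rule R)
      then show ?thesis using that by blast
    qed
    moreover have "refl_seq fs (- t *\<^sub>R \<mu>) \<in> wall \<beta> n" using data(5) xw by simp
    ultimately have "on_negative_side \<beta> n (filtermap (refl_seq fs) (alcove_of x))"
      using negative_side_transfer[OF u(1) real_root_linear[OF data(4)] _ _ _ u(3)] by blast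
    then show ?thesis unfolding end_eq .
  next
    case False
    then show ?thesis
      using data(6) end_eq end_alcove_fold_seq unfolding positive_folding_def
      by (simp add: straight_open_path_def)
  qed
  then show ?thesis using negative_side_step[OF W data(4)] by simp
qed

text \<open>Membership of the intermediate elements in \<open>Wplus\<close> is a result of the chain
  built so far and is what permits the next step, so both advance in one induction. All prefixes are
  recorded because they must lie in the Bruhat interval.\<close>

lemma hecke_chain:
  assumes x: "x \<in> Wplus" "spherical (fst x)" and h: "hecke_folding_data x fs"
  shows "aff_bruhat_step\<^sup>*\<^sup>* (translate fs x) x \<and>
    (\<forall>k\<le>length fs. aff_bruhat_step\<^sup>*\<^sup>* (translate fs x) (translate (take k fs) x) \<and>
      aff_bruhat_step\<^sup>*\<^sup>* (translate (take k fs) x) x)"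
  using h
proof (induction fs rule: rev_induct)
  case (snoc f fs)
  obtain t \<beta> n where f: "f = (t, \<beta>, n)" by (cases f)
  note IH = snoc.IH[OF hecke_folding_data_snoc(1)[OF snoc.prems[unfolded f]]]
  have W: "translate fs x \<in> Wplus" using IH x(1) aff_bruhat_steps_Wplus by blast
  have step: "aff_bruhat_step (translate (fs @ [f]) x) (translate fs x)"
    using hecke_step[OF x snoc.prems[unfolded f] W] unfolding f .
  then have last: "aff_bruhat_step\<^sup>*\<^sup>* (translate (fs @ [f]) x) x"
    using IH by (meson converse_rtranclp_into_rtranclp)
  have "aff_bruhat_step\<^sup>*\<^sup>* (translate (fs @ [f]) x) (translate (take k (fs @ [f])) x) \<and>
      aff_bruhat_step\<^sup>*\<^sup>* (translate (take k (fs @ [f])) x) x" if "k \<le> length (fs @ [f])" for k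
  proof (cases "k \<le> length fs")
    case True
    then show ?thesis using IH step by (auto intro: converse_rtranclp_into_rtranclp)
  next
    case False
    then show ?thesis using that last by simp
  qed
  then show ?case using last by blast
qed simp

subsection \<open>Finiteness of the set of Hecke open paths\<close>

text \<open>The action of z x^{-1}. A folding sequence enters only through the element
  \<open>z\<close>, which makes the number of maps finite.\<close>

definition transport :: "'a \<times> ('a \<Rightarrow> 'a) \<Rightarrow> 'a \<times> ('a \<Rightarrow> 'a) \<Rightarrow> 'a \<Rightarrow> 'a" where
  "transport x z p = aff_act z (inv (snd x) (p + fst x))"

lemma refl_seq_eq_transport:
  assumes "\<And>t \<beta> n. (t, \<beta>, n) \<in> set fs \<Longrightarrow> \<beta> \<in> real_roots" "snd x \<in> Weyl"
  shows "refl_seq fs = transport x (translate fs x)"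
proof
  fix p
  have "aff_act x (inv (snd x) (p + fst x)) = p" using assms(2) by (simp add: aff_act_def)
  moreover have "aff_act (translate fs x) (inv (snd x) (p + fst x)) = refl_seq fs (aff_act x (inv (snd x) (p + fst x)))"
    by (rule aff_act_translate, rule assms(1))
  ultimately show "refl_seq fs p = transport x (translate fs x) p" by (simp add: transport_def)
qed

text \<open>The image of the straight path under z x^{-1}, with factor \<open>1 - t\<close> because
  x^{-1} sends the end point of the path to the origin.\<close>

definition ray :: "'a \<times> ('a \<Rightarrow> 'a) \<Rightarrow> 'a \<times> ('a \<Rightarrow> 'a) \<Rightarrow> real \<Rightarrow> 'a" where
  "ray x z t = - fst z + (1 - t) *\<^sub>R snd z (inv (snd x) (fst x))"

lemma transport_straight:
  assumes "snd x \<in> Weyl" "snd z \<in> Weyl"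
  shows "transport x z (- t *\<^sub>R fst x) = ray x z t"
proof -
  have "- t *\<^sub>R fst x + fst x = (1 - t) *\<^sub>R fst x" by (simp add: scaleR_left_diff_distrib)
  then show ?thesis
    unfolding transport_def ray_def aff_act_def
    by (simp only: Weyl_scale[OF Weyl_inv[OF assms(1)]] Weyl_scale[OF assms(2)])
qed

lemma affine_on_ray: "(\<And>t. t \<in> {a..b} \<Longrightarrow> c t = ray x z t) \<Longrightarrow> affine_on c a b"
  unfolding affine_on_def ray_def
  by (intro exI[of _ "- fst z + snd z (inv (snd x) (fst x))"] exI[of _ "- snd z (inv (snd x) (fst x))"])
    (simp add: scaleR_left_diff_distrib)

lemma ray_eq_if_two_times:
  assumes "ray x z s = ray x z' s" "ray x z s' = ray x z' s'" "s \<noteq> s'"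
  shows "ray x z t = ray x z' t"
proof -
  let ?v = "snd z (inv (snd x) (fst x))" and ?v' = "snd z' (inv (snd x) (fst x))"
  have "(s - s') *\<^sub>R ?v = ray x z s' - ray x z s" "(s - s') *\<^sub>R ?v' = ray x z' s' - ray x z' s"
    by (simp_all add: ray_def scaleR_left_diff_distrib)
  then have v: "?v = ?v'" using assms by (metis eq_iff_diff_eq_0 scaleR_cancel_left)
  then have "fst z = fst z'" using assms(1) by (simp add: ray_def)
  then show ?thesis using v by (simp add: ray_def)
qed

text \<open>Pairs of rays that coincide are left out, since they meet at all times. The end points 0
  and 1 are added so that the gaps cover the unit interval.\<close>

definition crossing_times :: "'a \<times> ('a \<Rightarrow> 'a) \<Rightarrow> ('a \<times> ('a \<Rightarrow> 'a)) set \<Rightarrow> real set" where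
  "crossing_times x S = {0, 1} \<union>
     (\<Union>z\<in>S. \<Union>z'\<in>S. {t \<in> {0..1}. ray x z t = ray x z' t \<and> (\<exists>s. ray x z s \<noteq> ray x z' s)})"

lemma finite_crossing_times: "finite S \<Longrightarrow> finite (crossing_times x S)"
proof -
  have "finite {t \<in> {0..1}. ray x z t = ray x z' t \<and> (\<exists>s. ray x z s \<noteq> ray x z' s)}" for z z'
  proof (cases "\<exists>t0. ray x z t0 = ray x z' t0 \<and> (\<exists>s. ray x z s \<noteq> ray x z' s)")
    case True
    then obtain t0 where "ray x z t0 = ray x z' t0" by blast
    then have "{t \<in> {0..1}. ray x z t = ray x z' t \<and> (\<exists>s. ray x z s \<noteq> ray x z' s)} \<subseteq> {t0}"
      using ray_eq_if_two_times[of x z t0 z'] by blast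
    then show ?thesis using finite_subset by blast
  next
    case False
    then have "{t \<in> {0..1}. ray x z t = ray x z' t \<and> (\<exists>s. ray x z s \<noteq> ray x z' s)} = {}" by blast
    then show ?thesis by (simp only: finite.emptyI)
  qed
  then show "finite S \<Longrightarrow> finite (crossing_times x S)" unfolding crossing_times_def by blast
qed

lemma wall_fixed:
  assumes "\<beta> \<in> real_roots" "p \<in> wall \<beta> n"
  shows "aff_act (aff_refl \<beta> n) p = p"
proof -
  have "\<beta> p = - of_int n" using assms(2) unfolding wall_def by simp
  then show ?thesis by (simp add: aff_act_def aff_refl_def root_refl_apply[OF assms(1)])
qed

text \<open>The foldings performed up to time \<open>t\<close> form an initial segment because the
  times are sorted.\<close>

lemma curve_fold_seq_values:
  assumes "sorted (map fst fs)" "0 \<le> t" "t \<le> 1"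
  shows "\<exists>k\<le>length fs. curve (fold_seq fs P) t = refl_seq (take k fs) (curve P t)"
  using assms(1)
proof (induction fs rule: rev_induct)
  case (snoc f fs)
  obtain s \<beta> n where f: "f = (s, \<beta>, n)" by (cases f)
  show ?case
  proof (cases "s \<le> t")
    case True
    have "curve (fold_seq (fs @ [f]) P) t = refl_seq (fs @ [f]) (curve P t)"
      using snoc.prems True assms(2,3) by (intro curve_fold_seq_after) (force simp: f sorted_append)+
    then show ?thesis by (intro exI[of _ "length (fs @ [f])"]) simp
  next
    case False
    obtain k where "k \<le> length fs" "curve (fold_seq fs P) t = refl_seq (take k fs) (curve P t)"
      using snoc by (auto simp: sorted_append)
    then show ?thesis using False assms(2,3) by (intro exI[of _ k]) (simp add: f folding_def)
  qed
qed simp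

lemma deco_fold_seq_values:
  assumes "sorted (map fst fs)" "0 \<le> t" "t < 1"
  shows "\<exists>k\<le>length fs. deco (fold_seq fs P) (t, Pos) = filtermap (refl_seq (take k fs)) (deco P (t, Pos))"
  using assms(1)
proof (induction fs rule: rev_induct)
  case (snoc f fs)
  obtain s \<beta> n where f: "f = (s, \<beta>, n)" by (cases f)
  show ?case
  proof (cases "s \<le> t")
    case True
    have "deco (fold_seq (fs @ [f]) P) (t, Pos) = filtermap (refl_seq (fs @ [f])) (deco P (t, Pos))"
      using snoc.prems True assms(2,3) by (intro deco_fold_seq_after) (force simp: f sorted_append)+
    then show ?thesis by (intro exI[of _ "length (fs @ [f])"]) simp
  next
    case False
    obtain k where "k \<le> length fs" "deco (fold_seq fs P) (t, Pos) = filtermap (refl_seq (take k fs)) (deco P (t, Pos))"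
      using snoc by (auto simp: sorted_append)
    moreover have "(t, Pos) \<in> signed_interval 0 1" using assms(2,3) by (simp add: signed_interval_def)
    ultimately show ?thesis using False by (intro exI[of _ k]) (simp add: f folding_def)
  qed
qed (simp add: refl_seq_def filtermap_ident)

text \<open>A folding at a time that is not a crossing time happens in a wall containing the rest of
  the path, so it does not change the path.\<close>

lemma hecke_curve_between:
  assumes h: "hecke_folding_data x fs" and x: "snd x \<in> Weyl"
    and S: "\<And>k. k \<le> length fs \<Longrightarrow> translate (take k fs) x \<in> S"
    and ab: "consecutive (crossing_times x S) a b"
  shows "\<exists>z\<in>S. \<forall>t\<in>{a..b}. curve (fold_seq fs (straight_open_path x)) t = ray x z t"
  using h S
proof (induction fs rule: rev_induct)
  case Nil
  have ab01: "0 \<le> a" "b \<le> 1" using ab unfolding consecutive_def crossing_times_def by auto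
  have "- t *\<^sub>R fst x = ray x x t" for t
    using x by (simp add: ray_def scaleR_left_diff_distrib)
  then have "\<forall>t\<in>{a..b}. curve (straight_open_path x) t = ray x x t"
    using ab01 by (simp add: straight_open_path_def straight_path_def)
  then show ?case using Nil.prems(2)[of 0] by auto
next
  case (snoc f fs)
  obtain s \<beta> n where f: "f = (s, \<beta>, n)" by (cases f)
  note data = hecke_folding_data_snoc[OF snoc.prems(1)[unfolded f]]
  have ab01: "0 \<le> a" "b \<le> 1" "a < b" using ab unfolding consecutive_def crossing_times_def by auto
  have R: "\<And>t \<beta> n. (t, \<beta>, n) \<in> set fs \<Longrightarrow> \<beta> \<in> real_roots" using hecke_roots[OF data(1)] by blast
  have R': "\<And>t \<beta> n. (t, \<beta>, n) \<in> set (fs @ [f]) \<Longrightarrow> \<beta> \<in> real_roots" using hecke_roots[OF snoc.prems(1)] by blast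
  have S': "translate (take k fs) x \<in> S" if "k \<le> length fs" for k
    using snoc.prems(2)[of k] that by simp
  obtain z where z: "z \<in> S" "\<And>t. t \<in> {a..b} \<Longrightarrow> curve (fold_seq fs (straight_open_path x)) t = ray x z t"
    using snoc.IH[OF data(1) S'] by blast
  let ?u = "translate fs x" and ?v = "translate (fs @ [f]) x"
  have uv: "?u \<in> S" "?v \<in> S"
    using S'[of "length fs"] snoc.prems(2)[of "length (fs @ [f])"] by simp_all
  have W: "snd ?u \<in> Weyl" "snd ?v \<in> Weyl"
    using translate_in_Weyl[of fs x] translate_in_Weyl[of "fs @ [f]" x] R R' x by blast+
  have ref: "refl_seq fs (- t *\<^sub>R fst x) = ray x ?u t" "refl_seq (fs @ [f]) (- t *\<^sub>R fst x) = ray x ?v t" for t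
    using refl_seq_eq_transport[of fs x] refl_seq_eq_transport[of "fs @ [f]" x] R R' x
      transport_straight[OF x W(1)] transport_straight[OF x W(2)] by metis+
  have after: "curve (fold_seq fs (straight_open_path x)) t = ray x ?u t" if t: "s \<le> t" "t \<in> {a..b}" for t
  proof -
    have "curve (fold_seq fs (straight_open_path x)) t = refl_seq fs (curve (straight_open_path x) t)"
      using data(2) t ab01 by (intro curve_fold_seq_after) force+
    then show ?thesis using t ab01 ref(1)[of t] by (simp add: straight_open_path_def straight_path_def)
  qed
  have new: "curve (fold_seq (fs @ [f]) (straight_open_path x)) t =
      (if s \<le> t then ray x ?v t else curve (fold_seq fs (straight_open_path x)) t)" if t: "t \<in> {a..b}" for t
  proof -
    have "aff_act (aff_refl \<beta> n) (ray x ?u t) = ray x ?v t"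
      using ref[of t] by (simp add: f)
    then show ?thesis using t ab01 after[of t] by (simp add: f folding_def)
  qed
  \<comment> \<open>The folding wall passes through the current point, which the reflection fixes;
    the rays before and after the folding therefore meet at time \<open>s\<close>.\<close>
  have meet: "ray x ?u s = ray x ?v s"
    using wall_fixed[OF data(4,5)] ref[of s] by (simp add: f)
  consider "s \<le> a" | "b \<le> s" | "a < s" "s < b" by linarith
  then show ?case
  proof cases
    case 1
    then show ?thesis using new uv(2) by (intro bexI[of _ ?v]) auto
  next
    case 2
    \<comment> \<open>Only the right end point can be affected, when \<open>b = s\<close>; there the
      two rays meet.\<close>
    have "curve (fold_seq (fs @ [f]) (straight_open_path x)) t = ray x z t" if t: "t \<in> {a..b}" for t
    proof (cases "t = s")
      case True
      then show ?thesis using new[OF t] after[OF _ t] z(2)[OF t] meet by simp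
    next
      case False
      then show ?thesis using new[OF t] z(2)[OF t] t 2 by auto
    qed
    then show ?thesis using z(1) by blast
  next
    case 3
    have "s \<notin> crossing_times x S" using ab 3 unfolding consecutive_def by auto
    then have "ray x ?u t = ray x ?v t" for t
      using meet uv data(3) unfolding crossing_times_def by blast
    then have "curve (fold_seq (fs @ [f]) (straight_open_path x)) t = ray x z t" if t: "t \<in> {a..b}" for t
      using new[OF t] after[OF _ t] z(2)[OF t] by auto
    then show ?thesis using z(1) by blast
  qed
qed

text \<open>Both end alcoves are positive presentations, and for a fixed sign the filter determines
  base point and direction.\<close>

lemma translate_eq_if_end_alcove:
  assumes x: "x \<in> Wplus" "spherical (fst x)" and y: "y \<in> Wplus"
    and h: "hecke_folding_data x fs" and end_eq: "end_alcove (fold_seq fs (straight_open_path x)) = alcove_of y"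
  shows "translate fs x = y"
proof -
  have W: "translate fs x \<in> Wplus" using hecke_chain[OF x h] aff_bruhat_steps_Wplus x(1) by blast
  have "alcove_of (translate fs x) = filtermap (refl_seq fs) (alcove_of x)"
    by (rule alcove_of_translate, rule hecke_roots[OF h])
  then have eq: "alcove_of (translate fs x) = alcove_of y"
    using end_eq by (simp add: end_alcove_fold_seq straight_open_path_def)
  obtain \<mu> v \<nu> w where p: "translate fs x = (\<mu>, v)" "y = (\<nu>, w)" by (cases "translate fs x"; cases y)
  have vw: "v \<in> Weyl" "w \<in> Weyl" using W y unfolding p Wplus_iff by auto
  have "alcove (- \<mu>) Pos v = alcove (- \<nu>) Pos w"
    using eq unfolding p alcove_of_eq_alcove[OF vw(1)] alcove_of_eq_alcove[OF vw(2)] .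
  then show ?thesis
    using alcove_base_point_unique[OF vw] alcove_direction_unique[OF vw] unfolding p by force
qed

lemma hecke_open_path_data:
  assumes x: "x \<in> Wplus" "spherical (fst x)" and y: "y \<in> Wplus" and P: "P \<in> hecke_open_paths x y"
  obtains fs where "hecke_folding_data x fs" "P = fold_seq fs (straight_open_path x)" "translate fs x = y"
    "(\<lambda>k. translate (take k fs) x) ` {..length fs} \<subseteq> bruhat_interval y x"
proof -
  obtain fs where fs: "hecke_folding_data x fs" "P = fold_seq fs (straight_open_path x)"
    using P unfolding hecke_open_paths_def hecke_open_path_def by blast
  have y': "translate fs x = y"
    using translate_eq_if_end_alcove[OF x y fs(1)] P fs(2) unfolding hecke_open_paths_def by blast
  then show ?thesis
    using that[OF fs y'] hecke_chain[OF x fs(1)] unfolding bruhat_interval_def by auto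
qed

lemma hecke_open_path_le:
  assumes x: "x \<in> Wplus" "spherical (fst x)" and y: "y \<in> Wplus" and P: "P \<in> hecke_open_paths x y"
  shows "aff_bruhat_le y x"
proof -
  obtain fs where fs: "hecke_folding_data x fs" "translate fs x = y"
    using hecke_open_path_data[OF assms] by metis
  then have "aff_bruhat_step\<^sup>*\<^sup>* y x" using hecke_chain[OF x fs(1)] by simp
  then show ?thesis unfolding aff_bruhat_le_def aff_bruhat_less_def using rtranclpD by metis
qed

lemma finite_hecke_open_paths:
  assumes x: "x \<in> Wplus" "spherical (fst x)" and y: "y \<in> Wplus"
  shows "finite (hecke_open_paths x y)"
proof -
  define S where "S = bruhat_interval y x"
  \<comment> \<open>One set of times for all paths: it depends on the interval and not on the
    folding sequence.\<close>
  define T where "T = crossing_times x S"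
  have finS: "finite S" unfolding S_def by (rule finite_bruhat_interval[OF x(1)])
  have finT: "finite T" unfolding T_def by (rule finite_crossing_times[OF finS])
  have T01: "0 \<in> T" "1 \<in> T" "T \<subseteq> {0..1}" unfolding T_def crossing_times_def by auto
  have xW: "snd x \<in> Weyl" using x(1) unfolding Wplus_def by auto
  \<comment> \<open>The recorded data of a path; time 1 is left out for decorations because there is
    no germ to the right of it. The end alcove is prescribed by \<open>y\<close>.\<close>
  define f where "f P = (restrict (curve P) T, restrict (\<lambda>t. deco P (t, Pos)) (T - {1}))" for P :: "'a open_path"
  let ?C = "\<Pi>\<^sub>E t\<in>T. (\<lambda>z. transport x z (curve (straight_open_path x) t)) ` S"
  let ?D = "\<Pi>\<^sub>E t\<in>T - {1}. (\<lambda>z. filtermap (transport x z) (deco (straight_open_path x) (t, Pos))) ` S"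
  have "f P \<in> ?C \<times> ?D" if P: "P \<in> hecke_open_paths x y" for P
  proof -
    obtain fs where fs: "hecke_folding_data x fs" "P = fold_seq fs (straight_open_path x)" "translate fs x = y"
      "(\<lambda>k. translate (take k fs) x) ` {..length fs} \<subseteq> S"
      using hecke_open_path_data[OF x y P] unfolding S_def .
    then have k: "\<And>k. k \<le> length fs \<Longrightarrow> translate (take k fs) x \<in> S" by blast
    have sorted: "sorted (map fst fs)" using fs(1) unfolding hecke_folding_data_def by blast
    have tr: "refl_seq (take k fs) = transport x (translate (take k fs) x)" for k
      by (rule refl_seq_eq_transport[OF _ xW]) (use hecke_roots[OF fs(1)] in_set_takeD in fast)
    have "curve P t \<in> (\<lambda>z. transport x z (curve (straight_open_path x) t)) ` S" if "t \<in> T" for t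
    proof -
      have "0 \<le> t" "t \<le> 1" using that T01(3) by auto
      then obtain j where "j \<le> length fs"
        "curve P t = transport x (translate (take j fs) x) (curve (straight_open_path x) t)"
        using curve_fold_seq_values[OF sorted, of t "straight_open_path x"] unfolding fs(2) tr by blast
      then show ?thesis using k by blast
    qed
    moreover have "deco P (t, Pos) \<in> (\<lambda>z. filtermap (transport x z) (deco (straight_open_path x) (t, Pos))) ` S"
      if "t \<in> T - {1}" for t
    proof -
      have "0 \<le> t" "t \<le> 1" "t \<noteq> 1" using that T01(3) by auto
      then obtain j where "j \<le> length fs"
        "deco P (t, Pos) = filtermap (transport x (translate (take j fs) x)) (deco (straight_open_path x) (t, Pos))"
        using deco_fold_seq_values[OF sorted, of t "straight_open_path x"] unfolding fs(2) tr by auto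
      then show ?thesis using k by blast
    qed
    ultimately show ?thesis unfolding f_def by auto
  qed
  then have "f ` hecke_open_paths x y \<subseteq> ?C \<times> ?D" by blast
  moreover have "finite (?C \<times> ?D)" using finT finS by (intro finite_cartesian_product finite_PiE) auto
  ultimately have "finite (f ` hecke_open_paths x y)" by (rule finite_subset)
  moreover have "inj_on f (hecke_open_paths x y)"
  proof (rule inj_onI)
    fix P Q assume P: "P \<in> hecke_open_paths x y" and Q: "Q \<in> hecke_open_paths x y" and eq: "f P = f Q"
    have c: "curve P t = curve Q t" if "t \<in> T" for t
    proof -
      have "restrict (curve P) T = restrict (curve Q) T" using eq unfolding f_def prod.inject by (rule conjunct1)
      then have "restrict (curve P) T t = restrict (curve Q) T t" by (rule arg_cong)
      then show ?thesis using that by simp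
    qed
    have d: "deco P (t, Pos) = deco Q (t, Pos)" if "t \<in> T - {1}" for t
    proof -
      have "restrict (\<lambda>t. deco P (t, Pos)) (T - {1}) = restrict (\<lambda>t. deco Q (t, Pos)) (T - {1})"
        using eq unfolding f_def prod.inject by (rule conjunct2)
      then have "restrict (\<lambda>t. deco P (t, Pos)) (T - {1}) t = restrict (\<lambda>t. deco Q (t, Pos)) (T - {1}) t"
        by (rule arg_cong)
      then show ?thesis using that by simp
    qed
    have affine: "affine_on (curve R) a b" if R: "R \<in> hecke_open_paths x y" and ab: "consecutive T a b" for R a b
    proof -
      obtain fs where fs: "hecke_folding_data x fs" "R = fold_seq fs (straight_open_path x)" "translate fs x = y"
        "(\<lambda>k. translate (take k fs) x) ` {..length fs} \<subseteq> S"
        using hecke_open_path_data[OF x y R] unfolding S_def .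
      then have k: "\<And>k. k \<le> length fs \<Longrightarrow> translate (take k fs) x \<in> S" by blast
      have "\<exists>z\<in>S. \<forall>t\<in>{a..b}. curve R t = ray x z t"
        unfolding fs(2) by (rule hecke_curve_between[OF fs(1) xW k ab[unfolded T_def]])
      then obtain z where "\<And>t. t \<in> {a..b} \<Longrightarrow> curve R t = ray x z t" by blast
      then show ?thesis by (rule affine_on_ray)
    qed
    have "curve P t = curve Q t" if t: "t \<in> {0..1}" for t
    proof (cases "t = 1")
      case True
      then show ?thesis using c T01 by blast
    next
      case False
      then have "(t, Pos) \<in> signed_interval 0 1" using t by (simp add: signed_interval_def)
      then obtain a b where ab: "consecutive T a b" "(t, Pos) \<in> signed_interval a b"
        using signed_interval_consecutive[OF finT T01(1,2)] by blast
      then have "a < b" "curve P a = curve Q a" "curve P b = curve Q b" "t \<in> {a..b}"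
        using c unfolding consecutive_def by (auto simp: signed_interval_def)
      then show ?thesis using affine_on_determined[OF affine[OF P ab(1)] affine[OF Q ab(1)]] by blast
    qed
    moreover have ext: "curve P \<in> extensional {0..1}" "curve Q \<in> extensional {0..1}"
      "deco P \<in> extensional (signed_interval 0 1)" "deco Q \<in> extensional (signed_interval 0 1)"
      using P Q unfolding hecke_open_paths_def hecke_open_path_def is_open_path_def by blast+
    ultimately have curve: "curve P = curve Q" using extensionalityI by blast
    have "deco P p = deco Q p" if p: "p \<in> signed_interval 0 1" for p
    proof -
      obtain t \<epsilon> where t: "p = (t, \<epsilon>)" by (cases p)
      obtain a b where ab: "consecutive T a b" "(t, \<epsilon>) \<in> signed_interval a b"
        using signed_interval_consecutive[OF finT T01(1,2)] p unfolding t by blast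
      have aT: "a \<in> T - {1}" "0 \<le> a" "a < b" "b \<le> 1"
        using ab(1) T01(3) unfolding consecutive_def by force+
      \<comment> \<open>The recorded decoration at the left end of the gap belongs to the gap, so
        admissibility computes all decorations in it from this one.\<close>
      have "(a, Pos) \<in> signed_interval a b" using aT by (simp add: signed_interval_def)
      then have "deco R (t, \<epsilon>) = germ_proj (curve R t) (germ_dir (curve R) (t, \<epsilon>)) (deco R (a, Pos))"
        if "R \<in> hecke_open_paths x y" for R
        using that affine[OF that ab(1)] ab(2) aT
        unfolding hecke_open_paths_def hecke_open_path_def admissible_def by blast
      from this[OF P] this[OF Q] show ?thesis unfolding t curve d[OF aT(1)] by simp
    qed
    then have "deco P = deco Q" using extensionalityI[OF ext(3,4)] by blast
    moreover have "end_alcove P = end_alcove Q" using P Q unfolding hecke_open_paths_def by simp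
    ultimately show "P = Q" using curve by simp
  qed
  ultimately show ?thesis by (rule finite_imageD)
qed

end

theorem proposition1p1:
  fixes I :: "'i set"
    and A :: "'i \<Rightarrow> 'i \<Rightarrow> int"
    and Y :: "'a::real_normed_vector set"
    and \<alpha> :: "'i \<Rightarrow> 'a \<Rightarrow> real"
    and \<alpha>v :: "'i \<Rightarrow> 'a"
    and x y :: "'a \<times> ('a \<Rightarrow> 'a)"
  assumes "kac_moody_root_datum I A Y \<alpha> \<alpha>v"
    and "x \<in> kac_moody_root_datum.Wplus I Y \<alpha> \<alpha>v"
    and "y \<in> kac_moody_root_datum.Wplus I Y \<alpha> \<alpha>v"
    and "kac_moody_root_datum.spherical I \<alpha> \<alpha>v (fst x)"
  shows "finite (kac_moody_root_datum.hecke_open_paths I \<alpha> \<alpha>v x y) \<and>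
         (\<not> kac_moody_root_datum.aff_bruhat_le I Y \<alpha> \<alpha>v y x \<longrightarrow>
           kac_moody_root_datum.hecke_open_paths I \<alpha> \<alpha>v x y = {})"
proof -
  interpret kac_moody_root_datum I A Y \<alpha> \<alpha>v by (rule assms(1))
  show ?thesis
    using finite_hecke_open_paths[OF assms(2,4,3)] hecke_open_path_le[OF assms(2,4,3)] by blast
qed

end
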